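(* Let $G = \mathbb{F}_2$ be freely generated by the elements $a$ and $b$. Define the subset $W_a \subset \mathbb{F}_2$ consisting of all reduced words in $a,b$ that end with a strictly positive power of $a$. Similarly define $W_b \subset \mathbb{F}_2$ (reduced words that end with a strictly positive power of $b$) and put $W = \mathbb{F}_2 \setminus (W_a \cup W_b)$. The Bernoulli action $G \curvearrowright (X,\mu)$ with $(X,\mu) = \prod_{g \in G} (\{0,1\},\mu_g)$ and $$\mu_g(0) = \begin{cases} 3/5 & \text{if } g \in W_a,\\ 2/5 & \text{if } g \in W_b, \\ 1/2 & \text{if } g \in W,\end{cases}$$ is nonsingular, essentially free, ergodic, nonamenable in the sense of Zimmer and of type III$_1$. For every $g \in G \setminus \{e\}$, the transformation $x \mapsto g \cdot x$ is dissipative. For $m \geq 220$, the $m$-th power diagonal action $G \curvearrowright (X^m,\mu^m)$ is dissipative.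
   Context: The Bernoulli action is $(g\cdot x)_h = x_{g^{-1}h}$. Nonsingular means preserving the measure class. A nonsingular action $\Gamma \curvearrowright (X,\mu)$ of a countable group is dissipative if there exists a Borel set $\mathcal{U} \subset X$ such that all $g \cdot \mathcal{U}$, $g \in \Gamma$, are disjoint and $\bigcup_{g \in \Gamma} g \cdot \mathcal{U} = X$ up to measure zero; a nonsingular invertible transformation is dissipative if the action of $\mathbb{Z}$ that it generates is dissipative. The Radon-Nikodym cocycle $\omega$ of a nonsingular action is determined by $\int_X f(x)\,\omega(g,x)\,d\mu(x) = \int_X f(g^{-1}\cdot x)\,d\mu(x)$ for positive Borel $f$, and the Maharam extension is the measure preserving action on $(X\times\mathbb{R},\mu\times\nu)$, $d\nu(s)=e^{-s}ds$, given by $g\cdot(x,s) = (g\cdot x,\log\omega(g,x)+s)$. An essentially free ergodic nonsingular action is of type III$_1$ if and only if its Maharam extension is ergodic. An essentially free nonsingular action $G \curvearrowright (X,\mu)$ is amenable in the sense of Zimmer if the von Neumann algebra $L^\infty(X)\rtimes G$ is injective; equivalently, there is a sequence of Borel maps $\xi_n : X \to \ell^2(G)$ with $\|\xi_n(x)\|_2 = 1$ for a.e. $x$ and $\lim_n \int_X \langle \lambda_g \xi_n(g^{-1}\cdot x),\xi_n(x)\rangle P(x)\,d\mu(x) = \int_X P\,d\mu$ for all $g \in G$, $P \in L^1(X,\mu)$, where $\lambda$ is the left regular representation. It is nonamenable otherwise. *)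

theory Defs
  imports "HOL-Algebra.Algebra" "HOL-Probability.Probability"
begin

section \<open>The free group on two generators\<close>

datatype gen = gen_a | gen_b

text \<open>The letter \<open>(x, True)\<close> stands for the generator \<open>x\<close>, and \<open>(x, False)\<close> for its inverse.
  A word is written from left to right, so that the letter with which it ends is its \<^const>\<open>last\<close>
  element.\<close>

type_synonym letter = "gen \<times> bool"

definition inv_letter :: "letter \<Rightarrow> letter" where
  "inv_letter l = (fst l, \<not> snd l)"

fun reduced :: "letter list \<Rightarrow> bool" where
  "reduced [] \<longleftrightarrow> True"
| "reduced [l] \<longleftrightarrow> True"
| "reduced (l # k # w) \<longleftrightarrow> k \<noteq> inv_letter l \<and> reduced (k # w)"

fun push_letter :: "letter \<Rightarrow> letter list \<Rightarrow> letter list" where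
  "push_letter l [] = [l]"
| "push_letter l (k # w) = (if k = inv_letter l then w else l # k # w)"

text \<open>The product of two reduced words is the reduced form of their concatenation.\<close>

definition F2 :: "letter list monoid" where
  "F2 = \<lparr>carrier = {w. reduced w}, monoid.mult = (\<lambda>u v. foldr push_letter u v), one = []\<rparr>"

lemma inv_letter_inv_letter [simp]: "inv_letter (inv_letter l) = l"
  by (simp add: inv_letter_def)

lemma inv_letter_neq [simp]: "inv_letter l \<noteq> l" "l \<noteq> inv_letter l"
  by (auto simp: inv_letter_def prod_eq_iff)

lemma reduced_tl: "reduced (l # w) \<Longrightarrow> reduced w"
  by (cases w) auto

lemma reduced_push_letter: "reduced w \<Longrightarrow> reduced (push_letter l w)"
  by (cases w) (auto dest: reduced_tl)

lemma reduced_foldr_push_letter: "reduced v \<Longrightarrow> reduced (foldr push_letter u v)"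
  by (induction u) (auto intro: reduced_push_letter)

lemma push_letter_cancel: "reduced w \<Longrightarrow> push_letter (inv_letter l) (push_letter l w) = w"
proof (cases w)
  case (Cons k w')
  assume "reduced w"
  then show ?thesis
    using Cons by (cases w') auto
qed auto

lemma push_letter_cancel': "reduced w \<Longrightarrow> push_letter l (push_letter (inv_letter l) w) = w"
  using push_letter_cancel[of w "inv_letter l"] by simp

lemma foldr_push_letter_push_letter:
  assumes "reduced v"
  shows "foldr push_letter (push_letter l u) v = push_letter l (foldr push_letter u v)"
  by (cases u) (auto simp: push_letter_cancel' reduced_foldr_push_letter[OF assms])

lemma foldr_push_letter_assoc:
  assumes "reduced w"
  shows "foldr push_letter (foldr push_letter u v) w = foldr push_letter u (foldr push_letter v w)"
  by (induction u) (simp_all add: foldr_push_letter_push_letter[OF assms])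

lemma foldr_push_letter_reduced: "reduced u \<Longrightarrow> foldr push_letter u [] = u"
proof (induction u)
  case (Cons l u)
  then show ?case by (cases u) (auto dest: reduced_tl)
qed simp

lemma push_letter_left_inverse:
  "\<exists>v. reduced v \<and> foldr push_letter v u = []" if "reduced u"
  using that
proof (induction u)
  case Nil
  show ?case by (rule exI[of _ "[]"]) simp
next
  case (Cons l u)
  then obtain v where v: "reduced v" "foldr push_letter v u = []"
    by (auto dest: reduced_tl)
  let ?l' = "inv_letter l"
  have "foldr push_letter (foldr push_letter v [?l']) (l # u)
      = foldr push_letter v (foldr push_letter [?l'] (l # u))"
    using Cons.prems by (rule foldr_push_letter_assoc)
  also have "\<dots> = []" using v by simp
  finally show ?case
    by (metis reduced.simps(2) reduced_foldr_push_letter)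
qed

lemma group_F2: "group F2"
  by (rule groupI)
     (auto simp: F2_def reduced_foldr_push_letter foldr_push_letter_assoc
           dest: push_letter_left_inverse)


section \<open>Nonsingular actions\<close>

text \<open>In \<^locale>\<open>group_action\<close>, the map \<open>act g\<close> is extensional, that is, \<^const>\<open>undefined\<close>
  outside \<^term>\<open>space M\<close>.\<close>

locale nonsingular_action =
  group_action G "space M" act + sigma_finite_measure M
  for G :: "('g, 'r) monoid_scheme" and M :: "'x measure" and act :: "'g \<Rightarrow> 'x \<Rightarrow> 'x" +
  assumes countable_group: "countable (carrier G)"
    and measurable_act: "g \<in> carrier G \<Longrightarrow> act g \<in> M \<rightarrow>\<^sub>M M"
    and null_sets_distr_act: "g \<in> carrier G \<Longrightarrow> null_sets (distr M M (act g)) = null_sets M"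

definition essentially_free ::
  "('g, 'r) monoid_scheme \<Rightarrow> 'x measure \<Rightarrow> ('g \<Rightarrow> 'x \<Rightarrow> 'x) \<Rightarrow> bool" where
  "essentially_free G M act \<longleftrightarrow>
     (AE x in M. \<forall>g\<in>carrier G - {\<one>\<^bsub>G\<^esub>}. act g x \<noteq> x)"

text \<open>Invariance is only required up to null sets, so that the notion also makes sense for
  \<open>act\<close> given by maps that are determined, and compose as an action, only almost everywhere, such
  as the Maharam extension below.\<close>

definition ergodic ::
  "('g, 'r) monoid_scheme \<Rightarrow> 'x measure \<Rightarrow> ('g \<Rightarrow> 'x \<Rightarrow> 'x) \<Rightarrow> bool" where
  "ergodic G M act \<longleftrightarrow>
     (\<forall>A\<in>sets M. (\<forall>g\<in>carrier G. AE x in M. act g x \<in> A \<longleftrightarrow> x \<in> A) \<longrightarrow>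
        A \<in> null_sets M \<or> space M - A \<in> null_sets M)"

definition dissipative ::
  "('g, 'r) monoid_scheme \<Rightarrow> 'x measure \<Rightarrow> ('g \<Rightarrow> 'x \<Rightarrow> 'x) \<Rightarrow> bool" where
  "dissipative G M act \<longleftrightarrow> nonsingular_action G M act \<and>
     (\<exists>U\<in>sets M. disjoint_family_on (\<lambda>g. act g ` U) (carrier G) \<and>
        space M - (\<Union>g\<in>carrier G. act g ` U) \<in> null_sets M)"

definition dissipative_transformation :: "'x measure \<Rightarrow> ('x \<Rightarrow> 'x) \<Rightarrow> bool" where
  "dissipative_transformation M T \<longleftrightarrow> T \<in> Bij (space M) \<and>
     dissipative integer_group M (\<lambda>n::int. T [^]\<^bsub>BijGroup (space M)\<^esub> n)"


section \<open>The Maharam extension and type III\<open>\<^sub>1\<close>\<close>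

text \<open>The right-hand side of \<open>\<integral>f(x) \<omega>(g,x) d\<mu>(x) = \<integral>f(g\<inverse>\<cdot>x) d\<mu>(x)\<close> is the
  integral of \<open>f\<close> with respect to the image of \<open>\<mu>\<close> under \<open>g\<inverse>\<close>.\<close>

definition RN_cocycle ::
  "('g, 'r) monoid_scheme \<Rightarrow> 'x measure \<Rightarrow> ('g \<Rightarrow> 'x \<Rightarrow> 'x) \<Rightarrow> 'g \<Rightarrow> 'x \<Rightarrow> real" where
  "RN_cocycle G M act g x = enn2real (RN_deriv M (distr M M (act (inv\<^bsub>G\<^esub> g))) x)"

definition maharam_measure :: "'x measure \<Rightarrow> ('x \<times> real) measure" where
  "maharam_measure M = M \<Otimes>\<^sub>M density lborel (\<lambda>s. ennreal (exp (- s)))"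

definition maharam_action ::
  "('g, 'r) monoid_scheme \<Rightarrow> 'x measure \<Rightarrow> ('g \<Rightarrow> 'x \<Rightarrow> 'x) \<Rightarrow> 'g \<Rightarrow> 'x \<times> real \<Rightarrow> 'x \<times> real" where
  "maharam_action G M act g = (\<lambda>(x, s). (act g x, ln (RN_cocycle G M act g x) + s))"

definition type_III\<^sub>1 ::
  "('g, 'r) monoid_scheme \<Rightarrow> 'x measure \<Rightarrow> ('g \<Rightarrow> 'x \<Rightarrow> 'x) \<Rightarrow> bool" where
  "type_III\<^sub>1 G M act \<longleftrightarrow>
     nonsingular_action G M act \<and> essentially_free G M act \<and> ergodic G M act \<and>
     ergodic G (maharam_measure M) (maharam_action G M act)"


section \<open>Amenability in the sense of Zimmer\<close>

definition ell2 :: "('g, 'r) monoid_scheme \<Rightarrow> ('g \<Rightarrow> complex) set" where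
  "ell2 G = {f \<in> extensional (carrier G). (\<lambda>h. (cmod (f h))\<^sup>2) summable_on carrier G}"

definition ell2_norm :: "('g, 'r) monoid_scheme \<Rightarrow> ('g \<Rightarrow> complex) \<Rightarrow> real" where
  "ell2_norm G f = sqrt (\<Sum>\<^sub>\<infinity>h\<in>carrier G. (cmod (f h))\<^sup>2)"

definition ell2_inner ::
  "('g, 'r) monoid_scheme \<Rightarrow> ('g \<Rightarrow> complex) \<Rightarrow> ('g \<Rightarrow> complex) \<Rightarrow> complex" where
  "ell2_inner G f k = (\<Sum>\<^sub>\<infinity>h\<in>carrier G. f h * cnj (k h))"

definition ell2_open :: "('g, 'r) monoid_scheme \<Rightarrow> ('g \<Rightarrow> complex) set \<Rightarrow> bool" where
  "ell2_open G V \<longleftrightarrow> V \<subseteq> ell2 G \<and>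
     (\<forall>f\<in>V. \<exists>e>0. \<forall>k\<in>ell2 G. ell2_norm G (\<lambda>h. k h - f h) < e \<longrightarrow> k \<in> V)"

definition ell2_borel :: "('g, 'r) monoid_scheme \<Rightarrow> ('g \<Rightarrow> complex) measure" where
  "ell2_borel G = sigma (ell2 G) (Collect (ell2_open G))"

definition left_regular ::
  "('g, 'r) monoid_scheme \<Rightarrow> 'g \<Rightarrow> ('g \<Rightarrow> complex) \<Rightarrow> 'g \<Rightarrow> complex" where
  "left_regular G g f = (\<lambda>h\<in>carrier G. f (inv\<^bsub>G\<^esub> g \<otimes>\<^bsub>G\<^esub> h))"

text \<open>For essentially free nonsingular actions, this is equivalent to the injectivity of the
  crossed product von Neumann algebra \<open>L\<^sup>\<infinity>(X) \<rtimes> G\<close>.\<close>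

definition zimmer_amenable ::
  "('g, 'r) monoid_scheme \<Rightarrow> 'x measure \<Rightarrow> ('g \<Rightarrow> 'x \<Rightarrow> 'x) \<Rightarrow> bool" where
  "zimmer_amenable G M act \<longleftrightarrow>
     (\<exists>\<xi> :: nat \<Rightarrow> 'x \<Rightarrow> 'g \<Rightarrow> complex.
        (\<forall>n. \<xi> n \<in> M \<rightarrow>\<^sub>M ell2_borel G) \<and>
        (\<forall>n. AE x in M. ell2_norm G (\<xi> n x) = 1) \<and>
        (\<forall>g\<in>carrier G. \<forall>P :: 'x \<Rightarrow> complex. integrable M P \<longrightarrow>
           (\<lambda>n. \<integral>x. ell2_inner G (left_regular G g (\<xi> n (act (inv\<^bsub>G\<^esub> g) x))) (\<xi> n x) * P x \<partial>M)
             \<longlonglongrightarrow> (\<integral>x. P x \<partial>M)))"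


section \<open>Bernoulli actions and diagonal actions\<close>

definition bernoulli_action ::
  "('g, 'r) monoid_scheme \<Rightarrow> ('g \<Rightarrow> 'y measure) \<Rightarrow> 'g \<Rightarrow> ('g \<Rightarrow> 'y) \<Rightarrow> 'g \<Rightarrow> 'y" where
  "bernoulli_action G \<mu> g =
     (\<lambda>x\<in>space (PiM (carrier G) \<mu>). \<lambda>h\<in>carrier G. x (inv\<^bsub>G\<^esub> g \<otimes>\<^bsub>G\<^esub> h))"

definition power_measure :: "nat \<Rightarrow> 'x measure \<Rightarrow> (nat \<Rightarrow> 'x) measure" where
  "power_measure m M = PiM {..<m} (\<lambda>_. M)"

definition power_action ::
  "nat \<Rightarrow> 'x measure \<Rightarrow> ('g \<Rightarrow> 'x \<Rightarrow> 'x) \<Rightarrow> 'g \<Rightarrow> (nat \<Rightarrow> 'x) \<Rightarrow> nat \<Rightarrow> 'x" where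
  "power_action m M act g = (\<lambda>x\<in>space (power_measure m M). \<lambda>i\<in>{..<m}. act g (x i))"


section \<open>The Bernoulli action of the free group\<close>

definition W_pos :: "gen \<Rightarrow> letter list set" where
  "W_pos x = {w \<in> carrier F2. w \<noteq> [] \<and> last w = (x, True)}"

definition F2_prob_zero :: "letter list \<Rightarrow> real" where
  "F2_prob_zero w =
     (if w \<in> W_pos gen_a then 3 / 5 else if w \<in> W_pos gen_b then 2 / 5 else 1 / 2)"

text \<open>The base space \<open>{0, 1}\<close> is the type \<^typ>\<open>bool\<close>, with \<^const>\<open>False\<close> as \<open>0\<close>.\<close>

definition F2_base :: "letter list \<Rightarrow> bool measure" where
  "F2_base w = measure_pmf (bernoulli_pmf (1 - F2_prob_zero w))"

lemma measure_F2_base_False: "measure (F2_base w) {False} = F2_prob_zero w"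
  by (simp add: F2_base_def F2_prob_zero_def measure_pmf_single)

definition F2_space :: "(letter list \<Rightarrow> bool) measure" where
  "F2_space = PiM (carrier F2) F2_base"

definition F2_action :: "letter list \<Rightarrow> (letter list \<Rightarrow> bool) \<Rightarrow> letter list \<Rightarrow> bool" where
  "F2_action = bernoulli_action F2 F2_base"

end

theory Submission
  imports Defs
begin

text \<open>
  Everything rests on one feature of the distributions: they depend only on the last letter of a word.
  Multiplication by a group element \<open>g\<close> on the left changes the last letters of finitely many words
  only, and the generators change the distribution at the single coordinate \<open>[]\<close>, from the fair one to
  one of the two biased ones. So the action is nonsingular, with a cocycle that is a finite product of
  explicit ratios.

  \<^bold>\<open>Dissipativity and freeness.\<close> The integral of the square root of the cocycle of \<open>g\<close> is a product of
  Hellinger integrals, and by induction on the word \<open>g\<close> it is at most \<open>\<rho> ^ length g\<close> with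
  \<open>\<rho> = sqrt (3 / 10) + sqrt (1 / 5)\<close> (\<open>nn_integral_sqrt_cocycle_le\<close>). Along the powers of a nontrivial
  element, whose lengths grow linearly, and over the whole group for the \<open>m\<close>-th power of the action
  with \<open>3 * \<rho> ^ m < 1\<close>, these bounds are summable. Then the cocycle tends to 0 along almost every
  orbit. This rules out fixed points, and choosing the points of an orbit where the cocycle is maximal
  gives a fundamental domain (\<open>cocycle_action.dissipativeI\<close>).

  \<^bold>\<open>Nonamenability.\<close> The Cayley graph is a tree in which every vertex has one neighbour closer to the root
  and three further away. A weighted arithmetic-geometric mean inequality along its edges bounds the
  sum over the four letters of the inner products in the definition of amenability by a constant less
  than 4 (\<open>sum_letter_inner_le\<close>). The cocycle of a letter is close enough to 1 for this to survive the
  change of variables.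

  \<^bold>\<open>Ergodicity and type.\<close> At each point one generator multiplies the density by \<open>6 / 5\<close> and the other one
  by \<open>4 / 5\<close>. Let \<open>step True\<close> and \<open>step False\<close> apply the former and the latter. The random walk
  with these steps, taken with probabilities \<open>3 / 5\<close> and \<open>2 / 5\<close>, preserves the measure. A set that is
  invariant under the Maharam extension cannot distinguish the endpoints of two walks that take the
  same steps in a different order, since both change the second coordinate by the same amount. Two
  walks whose first steps differ move into disjoint cones of the tree, so that their endpoints are
  independent on a large ball. Thus a horizontal section of an invariant set is independent of itself
  and has measure 0 or 1 (\<open>exchange_invariant_zero_one\<close>). It remains to see that the measure of
  the section does not depend on the height: it is invariant under translation by the logarithms of
  \<open>6 / 5\<close> and \<open>4 / 5\<close>, which generate a dense subgroup of the line (\<open>dense_translations_ergodic\<close>).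
\<close>

section \<open>Words in the free group\<close>

interpretation F2: group F2
  by (rule group_F2)

abbreviation F2_mult (infixl "\<cdot>" 70) where
  "u \<cdot> v \<equiv> u \<otimes>\<^bsub>F2\<^esub> v"

lemma carrier_F2 [simp]: "w \<in> carrier F2 \<longleftrightarrow> reduced w"
  by (simp add: F2_def)

lemma one_F2 [simp]: "\<one>\<^bsub>F2\<^esub> = []"
  by (simp add: F2_def)

lemma mult_F2: "u \<cdot> v = foldr push_letter u v"
  by (simp add: F2_def)

lemma mult_letter_F2 [simp]: "[l] \<cdot> w = push_letter l w"
  by (simp add: F2_def)

lemma Nil_mult_F2 [simp]: "[] \<cdot> w = w"
  by (simp add: F2_def)

lemma mult_Nil_F2 [simp]: "reduced w \<Longrightarrow> w \<cdot> [] = w"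
  using F2.r_one[of w] by simp

lemma Cons_eq_mult_F2: "reduced (l # w) \<Longrightarrow> l # w = [l] \<cdot> w"
  by (cases w) auto

lemma inv_letter_eq_iff: "inv_letter l = k \<longleftrightarrow> l = inv_letter k"
  by auto

lemma snd_inv_letter [simp]: "snd (inv_letter l) \<longleftrightarrow> \<not> snd l"
  by (simp add: inv_letter_def)

lemma fst_inv_letter [simp]: "fst (inv_letter l) = fst l"
  by (simp add: inv_letter_def)

lemma reduced_iff_successively: "reduced w \<longleftrightarrow> successively (\<lambda>l k. k \<noteq> inv_letter l) w"
  by (induction w rule: reduced.induct) auto

lemma reduced_append_iff:
  "reduced (u @ v) \<longleftrightarrow> reduced u \<and> reduced v \<and> (u = [] \<or> v = [] \<or> hd v \<noteq> inv_letter (last u))"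
  by (auto simp: reduced_iff_successively successively_append_iff)

lemma mult_F2_eq_append: "reduced (u @ v) \<Longrightarrow> u \<cdot> v = u @ v"
proof (induction u)
  case (Cons l u)
  then have "foldr push_letter u v = u @ v"
    by (auto simp: mult_F2 dest: reduced_tl)
  with Cons.prems show ?case
    by (cases "u @ v") (auto simp: mult_F2)
qed (simp add: mult_F2)

lemma inv_letter_F2: "inv\<^bsub>F2\<^esub> [l] = [inv_letter l]"
  by (rule F2.inv_equality) auto

lemma inv_F2: "reduced w \<Longrightarrow> inv\<^bsub>F2\<^esub> w = rev (map inv_letter w)"
proof (induction w)
  case Nil
  show ?case using F2.inv_one by simp
next
  case (Cons l w)
  have red: "reduced w" using Cons.prems by (rule reduced_tl)
  have "inv\<^bsub>F2\<^esub> (l # w) = inv\<^bsub>F2\<^esub> w \<cdot> [inv_letter l]"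
    using Cons_eq_mult_F2[OF Cons.prems] F2.inv_mult_group[of "[l]" w] red
    by (simp add: inv_letter_F2)
  also have "\<dots> = rev (map inv_letter w) @ [inv_letter l]"
  proof -
    have inv_red: "reduced (rev (map inv_letter w))"
      using F2.inv_closed[of w] red Cons.IH by simp
    have "w = [] \<or> inv_letter (hd w) \<noteq> l"
      using Cons.prems by (cases w) auto
    then have "reduced (rev (map inv_letter w) @ [inv_letter l])"
      unfolding reduced_append_iff using inv_red by (auto simp: last_rev hd_map inv_letter_eq_iff)
    then show ?thesis
      using Cons.IH[OF red] mult_F2_eq_append by simp
  qed
  finally show ?case by simp
qed

lemma length_inv_F2: "reduced w \<Longrightarrow> length (inv\<^bsub>F2\<^esub> w) = length w"
  by (simp add: inv_F2)

lemma length_push_letter_le: "length (push_letter l w) \<le> Suc (length w)"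
  by (cases w) auto

lemma length_mult_F2_le: "length (u \<cdot> v) \<le> length u + length v"
proof (induction u)
  case (Cons l u)
  show ?case
    using length_push_letter_le[of l "foldr push_letter u v"] Cons by (simp add: mult_F2)
qed (simp add: mult_F2)

lemma finite_UNIV_letter: "finite (UNIV :: letter set)"
proof -
  have "finite (UNIV :: gen set)"
    by (rule finite_subset[of _ "{gen_a, gen_b}"]) (use gen.exhaust in auto)
  then show ?thesis by (simp add: finite_prod)
qed

lemma UNIV_letter: "UNIV = {(gen_a, True), (gen_a, False), (gen_b, True), (gen_b, False)}"
proof -
  have "l \<in> {(gen_a, True), (gen_a, False), (gen_b, True), (gen_b, False)}" for l :: letter
    by (cases l, cases "fst l"; cases "snd l") auto
  then show ?thesis by blast
qed

lemma card_UNIV_letter: "card (UNIV :: letter set) = 4"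
  by (simp add: UNIV_letter)

lemma countable_F2: "countable (carrier F2)"
proof -
  have "countable (lists (UNIV :: letter set))"
    by (rule countable_lists) (simp add: finite_UNIV_letter countable_finite)
  then show ?thesis
    by (rule countable_subset[rotated]) auto
qed

lemma finite_words_of_length: "finite {w :: letter list. length w = n}"
  using finite_lists_length_eq[OF finite_UNIV_letter, of n] by simp

text \<open>After its first letter, a reduced word has three possibilities for each further letter.\<close>

lemma card_reduced_Cons_le: "card {w. reduced (l # w) \<and> length w = n} \<le> 3 ^ n"
proof (induction n arbitrary: l)
  case 0
  have "{w. reduced (l # w) \<and> length w = 0} = {[]}" by auto
  then show ?case by simp
next
  case (Suc n)
  have "{w. reduced (l # w) \<and> length w = Suc n}
      \<subseteq> (\<Union>k\<in>UNIV - {inv_letter l}. Cons k ` {w. reduced (k # w) \<and> length w = n})"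
    by (auto simp: length_Suc_conv)
  moreover have fin: "finite {w. reduced (k # w) \<and> length w = n}" for k
    by (rule finite_subset[OF _ finite_words_of_length[of n]]) auto
  ultimately have "card {w. reduced (l # w) \<and> length w = Suc n}
      \<le> card (\<Union>k\<in>UNIV - {inv_letter l}. Cons k ` {w. reduced (k # w) \<and> length w = n})"
    by (intro card_mono) (auto simp: finite_UNIV_letter intro: finite_subset[OF _ finite_UNIV_letter])
  also have "\<dots> \<le> (\<Sum>k\<in>UNIV - {inv_letter l}. card (Cons k ` {w. reduced (k # w) \<and> length w = n}))"
    by (rule card_UN_le) (auto intro: finite_subset[OF _ finite_UNIV_letter])
  also have "\<dots> \<le> (\<Sum>k\<in>UNIV - {inv_letter l}. 3 ^ n)"
    by (intro sum_mono) (simp add: card_image Suc.IH)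
  also have "\<dots> = 3 ^ Suc n"
    using card_UNIV_letter by (simp add: card_Diff_singleton)
  finally show ?case .
qed

lemma card_reduced_le: "card {w. reduced w \<and> length w = n} \<le> 4 * 3 ^ n"
proof (cases n)
  case 0
  then have "{w. reduced w \<and> length w = n} = {[]}" by auto
  then show ?thesis using 0 by simp
next
  case (Suc n')
  have fin: "finite {w. reduced (k # w) \<and> length w = n'}" for k
    by (rule finite_subset[OF _ finite_words_of_length[of n']]) auto
  have "{w. reduced w \<and> length w = n} \<subseteq> (\<Union>k. Cons k ` {w. reduced (k # w) \<and> length w = n'})"
    using Suc by (auto simp: length_Suc_conv)
  then have "card {w. reduced w \<and> length w = n}
      \<le> card (\<Union>k. Cons k ` {w. reduced (k # w) \<and> length w = n'})"
    using fin by (intro card_mono) (auto simp: finite_UNIV_letter)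
  also have "\<dots> \<le> (\<Sum>k\<in>UNIV. card (Cons k ` {w. reduced (k # w) \<and> length w = n'}))"
    by (rule card_UN_le[OF finite_UNIV_letter])
  also have "\<dots> \<le> (\<Sum>k\<in>(UNIV :: letter set). 3 ^ n')"
    by (intro sum_mono) (simp add: card_image card_reduced_Cons_le)
  also have "\<dots> \<le> 4 * 3 ^ n"
    using Suc by (simp only: sum_constant card_UNIV_letter) simp
  finally show ?thesis .
qed

lemma (in group) inv_mult_cancel_left:
  "x \<in> carrier G \<Longrightarrow> y \<in> carrier G \<Longrightarrow> inv x \<otimes> (x \<otimes> y) = y"
  by (simp add: m_assoc[symmetric])

lemma (in group) mult_inv_cancel_left:
  "x \<in> carrier G \<Longrightarrow> y \<in> carrier G \<Longrightarrow> x \<otimes> (inv x \<otimes> y) = y"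
  by (simp add: m_assoc[symmetric])

text \<open>If no cancellation occurs between two copies of \<open>g\<close>, the powers of \<open>g\<close> are concatenations.
  Otherwise \<open>g\<close> is conjugate to a shorter word, and conjugation by a letter changes the length of
  each power by at most 2.\<close>

lemma length_pow_F2_ge:
  assumes "reduced g" "g \<noteq> []"
  shows "\<exists>C. \<forall>n::nat. n \<le> length (g [^]\<^bsub>F2\<^esub> n) + C"
  using assms
proof (induction g rule: length_induct)
  case (1 g)
  show ?case
  proof (cases "hd g = inv_letter (last g)")
    case False
    have "g [^]\<^bsub>F2\<^esub> n = concat (replicate n g) \<and> reduced (concat (replicate n g))" for n :: nat
    proof (induction n)
      case (Suc n)
      have shift: "concat (replicate n g) @ g = g @ concat (replicate n g)"
        by (induction n) auto
      have "last (concat (replicate n g)) = last g" if "n \<noteq> 0"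
        using that by (cases n) (auto simp: replicate_append_same[symmetric] \<open>g \<noteq> []\<close>
          simp del: replicate_append_same)
      then have "reduced (concat (replicate n g) @ g)"
        unfolding reduced_append_iff using Suc 1 False by (cases n) auto
      then show ?case
        using Suc mult_F2_eq_append shift by (simp add: F2.nat_pow_Suc)
    qed simp
    moreover have "n \<le> length (concat (replicate n g))" for n
      using \<open>g \<noteq> []\<close> by (induction n) (auto simp: Suc_le_eq less_eq_Suc_le[symmetric] add_strict_increasing)
    ultimately show ?thesis by (intro exI[of _ 0]) simp
  next
    case True
    define l where "l = hd g"
    have "length g \<noteq> 1"
      using True by (auto simp: length_Suc_conv)
    then obtain g' k where "g = l # g' @ [k]"
    proof -
      have "tl g \<noteq> []" using \<open>length g \<noteq> 1\<close> \<open>g \<noteq> []\<close> by (cases g) auto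
      then have "g = l # butlast (tl g) @ [last (tl g)]"
        using \<open>g \<noteq> []\<close> by (simp add: l_def)
      then show thesis by (rule that)
    qed
    moreover from this have "last g = k" by simp
    ultimately have g: "g = l # g' @ [inv_letter l]"
      using True l_def inv_letter_inv_letter by metis
    have red: "reduced g" using 1 by simp
    then have "reduced (g' @ [inv_letter l])"
      unfolding g by (rule reduced_tl)
    then have red': "reduced g'" and g'_mult: "g' @ [inv_letter l] = g' \<cdot> [inv_letter l]"
      using mult_F2_eq_append by (auto simp: reduced_append_iff)
    have "g' \<noteq> []" using red g by auto
    then obtain C where C: "n \<le> length (g' [^]\<^bsub>F2\<^esub> n) + C" for n :: nat
      using 1 g red' by (metis length_Cons length_append_singleton less_Suc_eq)
    have g_eq: "g = [l] \<cdot> (g' \<cdot> [inv_letter l])"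
      using Cons_eq_mult_F2[of l "g' @ [inv_letter l]"] red g g'_mult by simp
    have conj: "[l] \<cdot> (g' [^]\<^bsub>F2\<^esub> n \<cdot> [inv_letter l]) = g [^]\<^bsub>F2\<^esub> n" for n :: nat
    proof (induction n)
      case (Suc n)
      define L where "L = [l]"
      define p where "p = g' [^]\<^bsub>F2\<^esub> n"
      have L: "L \<in> carrier F2" "[inv_letter l] = inv\<^bsub>F2\<^esub> L" "g' \<in> carrier F2" "p \<in> carrier F2"
        using red' F2.nat_pow_closed[of g' n] by (auto simp: L_def p_def inv_letter_F2)
      have "g [^]\<^bsub>F2\<^esub> Suc n = (L \<cdot> (p \<cdot> inv\<^bsub>F2\<^esub> L)) \<cdot> (L \<cdot> (g' \<cdot> inv\<^bsub>F2\<^esub> L))"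
        unfolding F2.nat_pow_Suc Suc[symmetric] L(2)[symmetric] p_def
        using g_eq by (simp add: L_def)
      also have "\<dots> = L \<cdot> (p \<cdot> g' \<cdot> inv\<^bsub>F2\<^esub> L)"
        using L(1,3,4) F2.inv_closed[of L] F2.m_closed
        by (simp add: F2.m_assoc F2.inv_mult_cancel_left del: carrier_F2)
      finally show ?case
        using L by (simp add: L_def p_def F2.nat_pow_Suc)
    qed (simp add: mult_F2)
    have conj_le: "length (g' [^]\<^bsub>F2\<^esub> n) \<le> length (g [^]\<^bsub>F2\<^esub> n) + 2" for n :: nat
    proof -
      define L where "L = [l]"
      define p where "p = g' [^]\<^bsub>F2\<^esub> n"
      have L: "L \<in> carrier F2" "[inv_letter l] = inv\<^bsub>F2\<^esub> L" "p \<in> carrier F2"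
        using red' F2.nat_pow_closed[of g' n] by (auto simp: L_def p_def inv_letter_F2)
      have "p = inv\<^bsub>F2\<^esub> L \<cdot> (g [^]\<^bsub>F2\<^esub> n \<cdot> L)"
        unfolding conj[symmetric] L(2) L_def[symmetric] p_def[symmetric]
        using L(1,3) F2.inv_closed[of L]
        by (simp add: F2.m_assoc F2.inv_mult_cancel_left F2.l_inv F2.r_one del: carrier_F2 one_F2)
      then have "length p \<le> length (inv\<^bsub>F2\<^esub> L) + (length (g [^]\<^bsub>F2\<^esub> n) + length L)"
        using length_mult_F2_le[of "inv\<^bsub>F2\<^esub> L" "g [^]\<^bsub>F2\<^esub> n \<cdot> L"]
          length_mult_F2_le[of "g [^]\<^bsub>F2\<^esub> n" L] by simp
      also have "\<dots> = length (g [^]\<^bsub>F2\<^esub> n) + 2"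
        unfolding L(2)[symmetric] by (simp add: L_def)
      finally show ?thesis by (simp add: p_def)
    qed
    have "n \<le> length (g [^]\<^bsub>F2\<^esub> n) + (C + 2)" for n :: nat
      using C[of n] conj_le[of n] by simp
    then show ?thesis by blast
  qed
qed

lemma length_int_pow_F2_ge:
  assumes "reduced g" "g \<noteq> []"
  obtains C where "\<And>n::int. nat \<bar>n\<bar> \<le> length (g [^]\<^bsub>F2\<^esub> n) + C"
proof -
  obtain C where C: "n \<le> length (g [^]\<^bsub>F2\<^esub> n) + C" for n :: nat
    using length_pow_F2_ge[OF assms] by blast
  have "nat \<bar>n\<bar> \<le> length (g [^]\<^bsub>F2\<^esub> n) + C" for n :: int
  proof (cases "0 \<le> n")
    case True
    then show ?thesis
      using C[of "nat n"] int_pow_int[of F2 g "nat n"] by simp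
  next
    case False
    define k where "k = nat \<bar>n\<bar>"
    with False have n: "n = - int k" by simp
    have "length (g [^]\<^bsub>F2\<^esub> n) = length (g [^]\<^bsub>F2\<^esub> k)"
      using F2.int_pow_neg_int[of g k] length_inv_F2[of "g [^]\<^bsub>F2\<^esub> k"] F2.nat_pow_closed[of g k] assms
      unfolding n by simp
    then show ?thesis
      using C[of k] by (simp add: n)
  qed
  then show thesis by (rule that)
qed

section \<open>Infinite products of probability measures\<close>

text \<open>Only the finite subproduct matters, and there the integral splits.\<close>

lemma (in product_prob_space) nn_integral_PiM_prod:
  assumes "finite D" "D \<subseteq> I" "\<And>i. i \<in> D \<Longrightarrow> f i \<in> borel_measurable (M i)"
  shows "(\<integral>\<^sup>+x. (\<Prod>i\<in>D. f i (x i)) \<partial>PiM I M) = (\<Prod>i\<in>D. \<integral>\<^sup>+y. f i y \<partial>M i)"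
proof -
  have [measurable]: "(\<lambda>x. \<Prod>i\<in>D. f i (x i)) \<in> borel_measurable (PiM D M)"
    using assms(3)
    by (intro borel_measurable_prod_ennreal measurable_compose[OF measurable_component_singleton]) auto
  have "(\<integral>\<^sup>+x. (\<Prod>i\<in>D. f i (x i)) \<partial>PiM I M) = (\<integral>\<^sup>+x. (\<Prod>i\<in>D. f i (restrict x D i)) \<partial>PiM I M)"
    by simp
  also have "\<dots> = (\<integral>\<^sup>+x. (\<Prod>i\<in>D. f i (x i)) \<partial>distr (PiM I M) (PiM D M) (\<lambda>x. restrict x D))"
    using assms(2) by (intro nn_integral_distr[symmetric] measurable_restrict_subset) auto
  also have "\<dots> = (\<Prod>i\<in>D. \<integral>\<^sup>+y. f i y \<partial>M i)"
    using assms by (simp add: distr_PiM_restrict_finite product_nn_integral_prod)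
  finally show ?thesis .
qed

text \<open>Cylinder sets determine a measure on the product, and on a cylinder set both sides are
  integrals of finite products of functions of one coordinate.\<close>

lemma (in product_prob_space) PiM_density:
  assumes w [measurable]: "\<And>i. i \<in> I \<Longrightarrow> w i \<in> borel_measurable (M i)"
    and prob: "\<And>i. i \<in> I \<Longrightarrow> prob_space (density (M i) (w i))"
    and D: "finite D" "D \<subseteq> I"
    and one: "\<And>i x. i \<in> I - D \<Longrightarrow> x \<in> space (M i) \<Longrightarrow> w i x = 1"
  shows "PiM I (\<lambda>i. density (M i) (w i)) = density (PiM I M) (\<lambda>x. \<Prod>i\<in>D. w i (x i))"
proof (rule measure_eqI_PiM_infinite)
  show "sets (PiM I (\<lambda>i. density (M i) (w i))) = sets (PiM I M)"
    by (rule sets_PiM_cong) auto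
  show "sets (density (PiM I M) (\<lambda>x. \<Prod>i\<in>D. w i (x i))) = sets (PiM I M)" by simp
  interpret Q: prob_space "PiM I (\<lambda>i. density (M i) (w i))"
    by (rule prob_space_PiM) (rule prob)
  show "finite_measure (PiM I (\<lambda>i. density (M i) (w i)))" by unfold_locales
  fix A J assume J: "finite J" "J \<subseteq> I" and A: "\<And>i. i \<in> J \<Longrightarrow> A i \<in> sets (M i)"
  note A[measurable]
  let ?E = "prod_emb I M J (Pi\<^sub>E J A)"
  define f where "f i y = (if i \<in> D then w i y else 1) * (if i \<in> J then indicator (A i) y else 1)" for i y
  have E [measurable]: "?E \<in> sets (PiM I M)"
    using J A by (intro sets_PiM_I) auto
  have DE: "(\<lambda>x. \<Prod>i\<in>D. w i (x i)) \<in> borel_measurable (PiM I M)"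
    using D by (intro borel_measurable_prod_ennreal measurable_compose[OF measurable_component_singleton]) auto
  have "emeasure (density (PiM I M) (\<lambda>x. \<Prod>i\<in>D. w i (x i))) ?E
      = (\<integral>\<^sup>+x. (\<Prod>i\<in>D. w i (x i)) * indicator ?E x \<partial>PiM I M)"
    by (rule emeasure_density[OF DE E])
  also have "\<dots> = (\<integral>\<^sup>+x. (\<Prod>i\<in>D \<union> J. f i (x i)) \<partial>PiM I M)"
  proof (rule nn_integral_cong)
    fix x assume x: "x \<in> space (PiM I M)"
    have "(\<Prod>i\<in>D \<union> J. f i (x i)) = (\<Prod>i\<in>D \<union> J. if i \<in> D then w i (x i) else 1)
        * (\<Prod>i\<in>D \<union> J. if i \<in> J then indicator (A i) (x i) else 1)"
      unfolding f_def by (rule prod.distrib)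
    also have "(\<Prod>i\<in>D \<union> J. if i \<in> D then w i (x i) else 1) = (\<Prod>i\<in>D. w i (x i))"
      using D J by (intro prod.mono_neutral_cong_right) auto
    also have "(\<Prod>i\<in>D \<union> J. if i \<in> J then indicator (A i) (x i) else (1::ennreal)) = (\<Prod>i\<in>J. indicator (A i) (x i))"
      using D J by (intro prod.mono_neutral_cong_right) auto
    also have "(\<Prod>i\<in>J. indicator (A i) (x i) :: ennreal) = indicator ?E x"
    proof (cases "x \<in> ?E")
      case True
      then show ?thesis by (auto simp: prod_emb_def PiE_iff intro!: prod.neutral)
    next
      case False
      then obtain i where "i \<in> J" "x i \<notin> A i"
        using x by (auto simp: prod_emb_def PiE_iff space_PiM)
      then show ?thesis using False J by (auto intro!: prod_zero simp: indicator_def)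
    qed
    finally show "(\<Prod>i\<in>D. w i (x i)) * indicator ?E x = (\<Prod>i\<in>D \<union> J. f i (x i))" by simp
  qed
  also have "\<dots> = (\<Prod>i\<in>D \<union> J. \<integral>\<^sup>+y. f i y \<partial>M i)"
  proof (rule nn_integral_PiM_prod)
    fix i assume "i \<in> D \<union> J"
    then show "f i \<in> borel_measurable (M i)"
      using D J unfolding f_def by (cases "i \<in> D"; cases "i \<in> J") auto
  qed (use D J in auto)
  also have "\<dots> = (\<Prod>i\<in>J. emeasure (density (M i) (w i)) (A i))"
  proof (rule prod.mono_neutral_cong_right)
    show "\<forall>i\<in>D \<union> J - J. (\<integral>\<^sup>+y. f i y \<partial>M i) = 1"
    proof
      fix i assume i: "i \<in> D \<union> J - J"
      then have "i \<in> I" using D by auto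
      interpret prob_space "density (M i) (w i)" by (rule prob) fact
      have "(\<integral>\<^sup>+y. f i y \<partial>M i) = emeasure (density (M i) (w i)) (space (M i))"
        using i \<open>i \<in> I\<close> by (auto simp: f_def emeasure_density intro!: nn_integral_cong)
      then show "(\<integral>\<^sup>+y. f i y \<partial>M i) = 1" using emeasure_space_1 by simp
    qed
    fix i assume i: "i \<in> J"
    then have "i \<in> I" using J by auto
    then have "f i y = w i y * indicator (A i) y" if "y \<in> space (M i)" for y
      using i that one[of i y] by (auto simp: f_def)
    then show "(\<integral>\<^sup>+y. f i y \<partial>M i) = emeasure (density (M i) (w i)) (A i)"
      using A[OF i] \<open>i \<in> I\<close> by (simp add: emeasure_density cong: nn_integral_cong)
  qed (use D J in auto)
  also have "\<dots> = emeasure (PiM I (\<lambda>i. density (M i) (w i))) (prod_emb I (\<lambda>i. density (M i) (w i)) J (Pi\<^sub>E J A))"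
    using J A prob by (intro Infinite_Product_Measure.emeasure_PiM_emb[symmetric]) auto
  also have "prod_emb I (\<lambda>i. density (M i) (w i)) J (Pi\<^sub>E J A) = ?E"
    by (simp add: prod_emb_def)
  finally show "emeasure (PiM I (\<lambda>i. density (M i) (w i))) ?E
      = emeasure (density (PiM I M) (\<lambda>x. \<Prod>i\<in>D. w i (x i))) ?E" by simp
qed

text \<open>Measurability with respect to the coordinates in \<open>J\<close>, as a condition on points, so that it
  can be checked for preimages under maps that permute coordinates.\<close>

definition determined_on :: "'i set \<Rightarrow> ('i \<Rightarrow> 'a measure) \<Rightarrow> 'i set \<Rightarrow> ('i \<Rightarrow> 'a) set set" where
  "determined_on I M J = {E \<in> sets (PiM I M).
     \<forall>x\<in>E. \<forall>y\<in>space (PiM I M). (\<forall>j\<in>J. x j = y j) \<longrightarrow> y \<in> E}"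

lemma determined_on_sets [dest]: "E \<in> determined_on I M J \<Longrightarrow> E \<in> sets (PiM I M)"
  by (simp add: determined_on_def)

lemma determined_onD:
  assumes "E \<in> determined_on I M J" "\<And>j. j \<in> J \<Longrightarrow> x j = y j"
    "x \<in> space (PiM I M)" "y \<in> space (PiM I M)"
  shows "x \<in> E \<longleftrightarrow> y \<in> E"
proof
  assume "x \<in> E"
  then show "y \<in> E" using assms by (auto simp: determined_on_def)
next
  assume "y \<in> E"
  moreover have "\<forall>j\<in>J. y j = x j" using assms(2) by simp
  ultimately show "x \<in> E" using assms(1,3) by (auto simp: determined_on_def)
qed

lemma determined_onI:
  assumes "E \<in> sets (PiM I M)"
    "\<And>x y. x \<in> E \<Longrightarrow> y \<in> space (PiM I M) \<Longrightarrow> (\<And>j. j \<in> J \<Longrightarrow> x j = y j) \<Longrightarrow> y \<in> E"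
  shows "E \<in> determined_on I M J"
  using assms by (auto simp: determined_on_def)

lemma determined_on_mono: "J \<subseteq> K \<Longrightarrow> determined_on I M J \<subseteq> determined_on I M K"
  by (auto simp: determined_on_def subset_iff)

lemma space_determined_on: "space (PiM I M) \<in> determined_on I M J"
  by (rule determined_onI) auto

lemma determined_on_Int:
  "E \<in> determined_on I M J \<Longrightarrow> F \<in> determined_on I M J \<Longrightarrow> E \<inter> F \<in> determined_on I M J"
  unfolding determined_on_def by blast

lemma determined_on_Un:
  "E \<in> determined_on I M J \<Longrightarrow> F \<in> determined_on I M J \<Longrightarrow> E \<union> F \<in> determined_on I M J"
  unfolding determined_on_def by blast

lemma determined_on_Diff_space:
  assumes E: "E \<in> determined_on I M J"
  shows "space (PiM I M) - E \<in> determined_on I M J"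
proof (rule determined_onI)
  show "space (PiM I M) - E \<in> sets (PiM I M)" using E by auto
  fix x y assume "x \<in> space (PiM I M) - E" "y \<in> space (PiM I M)" "\<And>j. j \<in> J \<Longrightarrow> x j = y j"
  then show "y \<in> space (PiM I M) - E" using determined_onD[OF E, of x y] by auto
qed

text \<open>A set determined on \<open>J\<close> is the preimage, under restriction to \<open>J\<close>, of the set obtained by
  filling the other coordinates with those of a fixed point.\<close>

lemma (in product_prob_space) determined_on_indep:
  assumes E: "E \<in> determined_on I M J" and F: "F \<in> determined_on I M K"
    and JK: "J \<inter> K = {}" "J \<subseteq> I" "K \<subseteq> I"
  shows "measure (PiM I M) (E \<inter> F) = measure (PiM I M) E * measure (PiM I M) F"
proof (cases "I = {}")
  case True
  then have "E = {} \<or> E = space (PiM I M)" "F = {} \<or> F = space (PiM I M)"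
    using sets.sets_into_space[OF determined_on_sets[OF E]] sets.sets_into_space[OF determined_on_sets[OF F]]
    by (auto simp: space_PiM)
  then show ?thesis using P.prob_space by auto
next
  case False
  obtain c where c: "c \<in> space (PiM I M)" using P.not_empty by blast
  define fill where "fill L z = (\<lambda>i\<in>I. if i \<in> L then z i else c i)" for L and z :: "'i \<Rightarrow> 'a"
  have fill [measurable]: "fill L \<in> PiM L M \<rightarrow>\<^sub>M PiM I M" if "L \<subseteq> I" for L
    unfolding fill_def
  proof (rule measurable_restrict)
    fix i assume "i \<in> I"
    then have "c i \<in> space (M i)" using c by (auto simp: space_PiM)
    then show "(\<lambda>z. if i \<in> L then z i else c i) \<in> PiM L M \<rightarrow>\<^sub>M M i" by (cases "i \<in> L") auto
  qed
  have pre: "E' = (\<lambda>x. restrict x L) -` (fill L -` E' \<inter> space (PiM L M)) \<inter> space (PiM I M)"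
    if E': "E' \<in> determined_on I M L" and L: "L \<subseteq> I" for E' L
  proof -
    have "x \<in> E' \<longleftrightarrow> restrict x L \<in> fill L -` E' \<inter> space (PiM L M)" if x: "x \<in> space (PiM I M)" for x
    proof -
      have r: "restrict x L \<in> space (PiM L M)" using x L by (auto simp: space_PiM)
      then have "fill L (restrict x L) \<in> space (PiM I M)"
        using fill[OF L] by (auto dest: measurable_space)
      moreover have "x j = fill L (restrict x L) j" if "j \<in> L" for j
        using that L by (auto simp: fill_def)
      ultimately show ?thesis using determined_onD[OF E', of x] x r by auto
    qed
    then show ?thesis using sets.sets_into_space[OF determined_on_sets[OF E']] by blast
  qed
  have "P.indep_vars M (\<lambda>i x. x i) I"
  proof (subst P.indep_vars_iff_distr_eq_PiM'[OF False])
    show "(\<lambda>x. x i) \<in> PiM I M \<rightarrow>\<^sub>M M i" if "i \<in> I" for i using that by simp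
    have "distr (PiM I M) (PiM I M) (\<lambda>x. restrict x I) = distr (PiM I M) (PiM I M) (\<lambda>x. x)"
      by (rule distr_cong) (auto simp: space_PiM)
    also have "\<dots> = PiM I M" by (simp add: distr_id2)
    also have "\<dots> = PiM I (\<lambda>i. distr (PiM I M) (M i) (\<lambda>x. x i))"
      by (rule PiM_cong) (auto simp: PiM_component)
    finally show "distr (PiM I M) (PiM I M) (\<lambda>x. \<lambda>i\<in>I. x i) = PiM I (\<lambda>i. distr (PiM I M) (M i) (\<lambda>x. x i))" .
  qed
  from P.indep_var_restrict[OF this JK]
  have "measure (PiM I M) ((\<lambda>x. (restrict x J, restrict x K)) -` ((fill J -` E \<inter> space (PiM J M)) \<times> (fill K -` F \<inter> space (PiM K M))) \<inter> space (PiM I M))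
    = measure (PiM I M) ((\<lambda>x. restrict x J) -` (fill J -` E \<inter> space (PiM J M)) \<inter> space (PiM I M))
    * measure (PiM I M) ((\<lambda>x. restrict x K) -` (fill K -` F \<inter> space (PiM K M)) \<inter> space (PiM I M))"
    using fill[OF JK(2)] fill[OF JK(3)] E F by (intro P.indep_varD) (auto simp: measurable_sets)
  also have "(\<lambda>x. (restrict x J, restrict x K)) -` ((fill J -` E \<inter> space (PiM J M)) \<times> (fill K -` F \<inter> space (PiM K M))) \<inter> space (PiM I M)
    = ((\<lambda>x. restrict x J) -` (fill J -` E \<inter> space (PiM J M)) \<inter> space (PiM I M)) \<inter>
      ((\<lambda>x. restrict x K) -` (fill K -` F \<inter> space (PiM K M)) \<inter> space (PiM I M))"
    by auto
  finally show ?thesis unfolding pre[OF E JK(2), symmetric] pre[OF F JK(3), symmetric] .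
qed

text \<open>The sets with such approximations form a sigma-algebra that contains the cylinder sets.\<close>

lemma (in product_prob_space) determined_on_approx:
  assumes "E \<in> sets (PiM I M)" "0 < e"
  shows "\<exists>J F. finite J \<and> J \<subseteq> I \<and> F \<in> determined_on I M J
    \<and> measure (PiM I M) ((E - F) \<union> (F - E)) < e"
  using assms unfolding sets_PiM
proof (induction arbitrary: e rule: sigma_sets.induct)
    case (Basic a)
    from Basic.hyps obtain J A where a: "a = prod_emb I M J (Pi\<^sub>E J A)"
      and J: "finite J" "J \<subseteq> I" and A: "\<And>i. i \<in> J \<Longrightarrow> A i \<in> sets (M i)"
      by (rule prod_algebraE) blast
    have "a \<in> determined_on I M J"
      unfolding a
    proof (rule determined_onI)
      show "prod_emb I M J (Pi\<^sub>E J A) \<in> sets (PiM I M)" using J A by (intro sets_PiM_I) auto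
    qed (use J in \<open>auto simp: prod_emb_def PiE_iff space_PiM\<close>)
    then show ?case using J Basic.prems by (intro exI[of _ J] exI[of _ a]) auto
  next
    case Empty
    then show ?case by (intro exI[of _ "{}"]) (auto simp: determined_on_def)
  next
    case (Compl a)
    then obtain J F where J: "finite J" "J \<subseteq> I" "F \<in> determined_on I M J" "measure (PiM I M) ((a - F) \<union> (F - a)) < e"
      by blast
    have "a \<in> sets (PiM I M)" using Compl.hyps by (simp add: sets_PiM)
    then have "a \<subseteq> space (PiM I M)" "F \<subseteq> space (PiM I M)"
      using sets.sets_into_space J(3) by blast+
    then have "((space (PiM I M) - a) - (space (PiM I M) - F)) \<union> ((space (PiM I M) - F) - (space (PiM I M) - a))
        = (a - F) \<union> (F - a)"
      by auto
    with J determined_on_Diff_space[OF J(3)] show ?case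
      unfolding space_PiM[symmetric]
      by (intro exI[of _ J] exI[of _ "space (PiM I M) - F"]) simp
  next
    case (Union a)
    have a [measurable]: "a i \<in> sets (PiM I M)" for i
      using Union.hyps[of i] by (simp add: sets_PiM)
    have "incseq (\<lambda>n. \<Union>i\<in>{0..<n}. a i)"
      by (intro monoI UN_mono) auto
    then have "(\<lambda>n. measure (PiM I M) (\<Union>i\<in>{0..<n}. a i)) \<longlonglongrightarrow> measure (PiM I M) (\<Union>n. \<Union>i\<in>{0..<n}. a i)"
      by (intro P.finite_Lim_measure_incseq) auto
    then have "(\<lambda>n. measure (PiM I M) (\<Union>i<n. a i)) \<longlonglongrightarrow> measure (PiM I M) (\<Union>i. a i)"
      unfolding UN_UN_finite_eq by (simp add: atLeast0LessThan)
    from order_tendstoD(1)[OF this, of "measure (PiM I M) (\<Union>i. a i) - e / 2"]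
    have "\<forall>\<^sub>F n in sequentially. measure (PiM I M) (\<Union>i. a i) - e / 2 < measure (PiM I M) (\<Union>i<n. a i)"
      using Union.prems by simp
    then obtain n where n: "measure (PiM I M) (\<Union>i. a i) - e / 2 < measure (PiM I M) (\<Union>i<n. a i)"
      by (auto simp: eventually_sequentially)
    define d where "d = e / (2 * (n + 1))"
    have "0 < d" using Union.prems by (simp add: d_def)
    then have "\<forall>i. \<exists>J F. finite J \<and> J \<subseteq> I \<and> F \<in> determined_on I M J \<and> measure (PiM I M) ((a i - F) \<union> (F - a i)) < d"
      using Union.IH by blast
    then obtain J F where JF: "finite (J i)" "J i \<subseteq> I" "F i \<in> determined_on I M (J i)"
      "measure (PiM I M) ((a i - F i) \<union> (F i - a i)) < d" for i
      by metis
    have F [measurable]: "F i \<in> sets (PiM I M)" for i using JF(3) by auto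
    let ?F = "\<Union>i<n. F i" and ?J = "\<Union>i<n. J i"
    have "?F \<in> determined_on I M ?J"
    proof (rule determined_onI)
      fix x y assume "x \<in> ?F" and y: "y \<in> space (PiM I M)" "\<And>j. j \<in> ?J \<Longrightarrow> x j = y j"
      then obtain i where i: "i < n" "x \<in> F i" by auto
      then have "x \<in> space (PiM I M)" using sets.sets_into_space[OF F[of i]] by auto
      then have "y \<in> F i" using determined_onD[OF JF(3)[of i], of x y] y i by auto
      then show "y \<in> ?F" using i by auto
    qed auto
    moreover have "measure (PiM I M) (((\<Union>i. a i) - ?F) \<union> (?F - (\<Union>i. a i))) < e"
    proof -
      have "measure (PiM I M) (((\<Union>i. a i) - ?F) \<union> (?F - (\<Union>i. a i)))
          \<le> measure (PiM I M) (((\<Union>i. a i) - (\<Union>i<n. a i)) \<union> (\<Union>i<n. (a i - F i) \<union> (F i - a i)))"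
      proof (rule P.finite_measure_mono)
        show "((\<Union>i. a i) - ?F) \<union> (?F - (\<Union>i. a i))
            \<subseteq> ((\<Union>i. a i) - (\<Union>i<n. a i)) \<union> (\<Union>i<n. (a i - F i) \<union> (F i - a i))"
          by blast
      qed auto
      also have "\<dots> \<le> measure (PiM I M) ((\<Union>i. a i) - (\<Union>i<n. a i)) + measure (PiM I M) (\<Union>i<n. (a i - F i) \<union> (F i - a i))"
        by (rule measure_Un_le) auto
      also have "measure (PiM I M) (\<Union>i<n. (a i - F i) \<union> (F i - a i)) \<le> (\<Sum>i<n. measure (PiM I M) ((a i - F i) \<union> (F i - a i)))"
        by (rule P.finite_measure_subadditive_finite) auto
      also have "\<dots> \<le> (\<Sum>i<n. d)" by (intro sum_mono less_imp_le JF)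
      also have "\<dots> \<le> e / 2" using Union.prems by (simp add: d_def field_simps)
      also have "measure (PiM I M) ((\<Union>i. a i) - (\<Union>i<n. a i)) = measure (PiM I M) (\<Union>i. a i) - measure (PiM I M) (\<Union>i<n. a i)"
        by (rule P.finite_measure_Diff) auto
      finally show ?thesis using n by simp
    qed
    ultimately show ?case using JF by (intro exI[of _ ?J] exI[of _ ?F]) auto
qed

section \<open>Integrals with respect to counting measures\<close>

lemma nn_integral_count_space_eq_infsum:
  fixes f :: "'a \<Rightarrow> real"
  assumes "f summable_on A" "\<And>h. h \<in> A \<Longrightarrow> 0 \<le> f h"
  shows "(\<integral>\<^sup>+h. ennreal (f h) \<partial>count_space A) = ennreal (infsum f A)"
proof -
  have abs: "Infinite_Set_Sum.abs_summable_on f A"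
    by (rule abs_summable_equivalent[THEN iffD1]) (use assms in \<open>simp cong: summable_on_cong\<close>)
  show ?thesis
    using nn_integral_conv_infsetsum[OF abs assms(2)] infsetsum_infsum[OF abs] by simp
qed

lemma borel_measurable_nn_integral_count_space:
  fixes f :: "'i \<Rightarrow> 'a \<Rightarrow> ennreal"
  assumes I: "countable I" and f: "\<And>i. i \<in> I \<Longrightarrow> f i \<in> borel_measurable M"
  shows "(\<lambda>x. \<integral>\<^sup>+i. f i x \<partial>count_space I) \<in> borel_measurable M"
proof -
  interpret sigma_finite_measure "count_space I"
    using I by (rule sigma_finite_measure_count_space_countable)
  have "(\<lambda>p. f (snd p) (fst p)) \<in> borel_measurable (M \<Otimes>\<^sub>M count_space I)"
    using f by (intro measurable_compose_countable'[where f = "\<lambda>i p. f i (fst p)" and g = snd and I = I] I)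
      (auto intro: measurable_compose[OF measurable_fst])
  then show ?thesis
    by (intro borel_measurable_nn_integral) (simp add: case_prod_beta')
qed

section \<open>Actions with an explicit Radon-Nikodym cocycle\<close>

text \<open>The function \<open>w\<close> is a version of the Radon-Nikodym cocycle for which the cocycle identity holds
  at every point. Arguments about a single orbit then involve no exceptional null sets.\<close>

locale cocycle_action = group G + prob_space M
  for G :: "('g, 'r) monoid_scheme" (structure) and M :: "'x measure" +
  fixes act :: "'g \<Rightarrow> 'x \<Rightarrow> 'x" and w :: "'g \<Rightarrow> 'x \<Rightarrow> real"
  assumes countable_carrier: "countable (carrier G)"
    and act_measurable: "g \<in> carrier G \<Longrightarrow> act g \<in> M \<rightarrow>\<^sub>M M"
    and act_extensional: "g \<in> carrier G \<Longrightarrow> act g \<in> extensional (space M)"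
    and act_one: "x \<in> space M \<Longrightarrow> act \<one> x = x"
    and act_mult: "g \<in> carrier G \<Longrightarrow> h \<in> carrier G \<Longrightarrow> x \<in> space M \<Longrightarrow> act (g \<otimes> h) x = act g (act h x)"
    and w_measurable: "g \<in> carrier G \<Longrightarrow> w g \<in> borel_measurable M"
    and w_pos: "g \<in> carrier G \<Longrightarrow> x \<in> space M \<Longrightarrow> 0 < w g x"
    and w_mult: "g \<in> carrier G \<Longrightarrow> h \<in> carrier G \<Longrightarrow> x \<in> space M \<Longrightarrow>
      w (g \<otimes> h) x = w g (act h x) * w h x"
    and distr_act_inv: "g \<in> carrier G \<Longrightarrow> distr M M (act (inv g)) = density M (\<lambda>x. ennreal (w g x))"
begin

lemma act_space: "g \<in> carrier G \<Longrightarrow> x \<in> space M \<Longrightarrow> act g x \<in> space M"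
  using act_measurable by (rule measurable_space)

lemma act_inv_act: "g \<in> carrier G \<Longrightarrow> x \<in> space M \<Longrightarrow> act (inv g) (act g x) = x"
  using act_mult[of "inv g" g x] by (simp add: act_one)

lemma act_act_inv: "g \<in> carrier G \<Longrightarrow> x \<in> space M \<Longrightarrow> act g (act (inv g) x) = x"
  using act_mult[of g "inv g" x] by (simp add: act_one)

lemma act_in_Bij: "g \<in> carrier G \<Longrightarrow> act g \<in> Bij (space M)"
  unfolding Bij_def
  by (auto simp: act_extensional act_space act_inv_act act_act_inv
      intro!: bij_betw_byWitness[where f' = "act (inv g)"])

lemma act_in_hom: "act \<in> hom G (BijGroup (space M))"
proof (rule homI)
  fix g h assume g: "g \<in> carrier G" and h: "h \<in> carrier G"
  have "act (g \<otimes> h) = compose (space M) (act g) (act h)"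
  proof
    fix x
    show "act (g \<otimes> h) x = compose (space M) (act g) (act h) x"
      using act_extensional[of "g \<otimes> h"] g h
      by (cases "x \<in> space M") (auto simp: compose_eq act_mult compose_def extensional_def)
  qed
  then show "act (g \<otimes> h) = act g \<otimes>\<^bsub>BijGroup (space M)\<^esub> act h"
    using act_in_Bij g h by (simp add: BijGroup_def)
qed (simp add: act_in_Bij BijGroup_def)

lemma group_action: "group_action G (space M) act"
  by (simp add: group_action_def group_hom_def group_hom_axioms_def group_BijGroup act_in_hom is_group)

lemma nonsingular: "nonsingular_action G M act"
proof -
  interpret group_action G "space M" act by (rule group_action)
  show ?thesis
  proof
    show "countable (carrier G)" by (rule countable_carrier)
    fix g assume g: "g \<in> carrier G"
    then show "act g \<in> M \<rightarrow>\<^sub>M M" by (rule act_measurable)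
    have "null_sets (distr M M (act g)) = null_sets (density M (\<lambda>x. ennreal (w (inv g) x)))"
      using distr_act_inv[of "inv g"] g by simp
    also have "\<dots> = null_sets M"
    proof -
      have "A \<in> null_sets (density M (\<lambda>x. ennreal (w (inv g) x))) \<longleftrightarrow> A \<in> null_sets M" for A
      proof -
        have "A \<in> null_sets (density M (\<lambda>x. ennreal (w (inv g) x))) \<longleftrightarrow>
            A \<in> sets M \<and> (AE x in M. x \<in> A \<longrightarrow> ennreal (w (inv g) x) = 0)"
          using w_measurable[of "inv g"] g by (intro null_sets_density_iff) auto
        also have "\<dots> \<longleftrightarrow> A \<in> sets M \<and> (AE x in M. x \<notin> A)"
          using w_pos[of "inv g"] g
          by (intro conj_cong refl AE_cong) (force simp: ennreal_eq_0_iff not_le[symmetric])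
        finally show ?thesis using AE_iff_null_sets[of A M] null_setsD2[of A M] by blast
      qed
      then show ?thesis by blast
    qed
    finally show "null_sets (distr M M (act g)) = null_sets M" .
  qed
qed

lemma nn_integral_act_inv:
  assumes g: "g \<in> carrier G" and f: "f \<in> borel_measurable M"
  shows "(\<integral>\<^sup>+x. f (act (inv g) x) \<partial>M) = (\<integral>\<^sup>+x. ennreal (w g x) * f x \<partial>M)"
proof -
  have "(\<integral>\<^sup>+x. f (act (inv g) x) \<partial>M) = (\<integral>\<^sup>+x. f x \<partial>distr M M (act (inv g)))"
    using g f act_measurable[of "inv g"] by (intro nn_integral_distr[symmetric]) auto
  also have "\<dots> = (\<integral>\<^sup>+x. ennreal (w g x) * f x \<partial>M)"
    unfolding distr_act_inv[OF g] using f w_measurable[OF g] by (intro nn_integral_density) auto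
  finally show ?thesis .
qed

lemma AE_act:
  assumes P: "AE x in M. P x" and g: "g \<in> carrier G"
  shows "AE x in M. P (act g x)"
proof -
  interpret ns: nonsingular_action G M act by (rule nonsingular)
  obtain N where N: "{x \<in> space M. \<not> P x} \<subseteq> N" "emeasure M N = 0" "N \<in> sets M"
    using P by (rule AE_E)
  then have "N \<in> null_sets M" by (intro null_setsI)
  then have "N \<in> null_sets (distr M M (act g))"
    using ns.null_sets_distr_act[OF g] by simp
  then have "act g -` N \<inter> space M \<in> null_sets M"
    using act_measurable[OF g] by (simp add: null_sets_distr_iff)
  moreover have "{x \<in> space M. \<not> P (act g x)} \<subseteq> act g -` N \<inter> space M"
    using N(1) act_space[OF g] by auto
  ultimately show ?thesis by (rule AE_I')
qed

lemma w_one: "x \<in> space M \<Longrightarrow> w \<one> x = 1"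
  using w_mult[of \<one> \<one> x] w_pos[of \<one> x] by (simp add: act_one)

lemma w_inv: "g \<in> carrier G \<Longrightarrow> x \<in> space M \<Longrightarrow> w (inv g) (act g x) * w g x = 1"
  using w_mult[of "inv g" g x] by (simp add: w_one)

lemma image_act:
  assumes "g \<in> carrier G" "U \<subseteq> space M"
  shows "act g ` U = act (inv g) -` U \<inter> space M"
proof (intro Set.set_eqI iffI)
  fix y assume "y \<in> act g ` U"
  then show "y \<in> act (inv g) -` U \<inter> space M"
    using assms act_space act_inv_act by auto
next
  fix y assume "y \<in> act (inv g) -` U \<inter> space M"
  then have "act (inv g) y \<in> U" "y = act g (act (inv g) y)"
    using assms act_act_inv[of g y] by auto
  then show "y \<in> act g ` U" by blast
qed

text \<open>Along almost every orbit \<open>w g x\<close> is bounded away from 0 only finitely often, so it attains its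
  maximum over \<open>g\<close>, and does so on a finite nonempty set of points \<open>act g x\<close>, which depends only on
  the orbit. The point of this set with the smallest value of \<open>f\<close> represents the orbit in the
  fundamental domain.\<close>

lemma dissipativeI:
  assumes f [measurable]: "f \<in> borel_measurable M"
    and sep: "AE x in M. \<forall>g\<in>carrier G - {\<one>}. f (act g x) \<noteq> (f x :: real)"
    and fin: "AE x in M. \<forall>e>0. finite {g \<in> carrier G. e \<le> w g x}"
  shows "dissipative G M act"
proof -
  define U where "U = {x \<in> space M. \<forall>g\<in>carrier G - {\<one>}. w g x < 1 \<or> w g x = 1 \<and> f x < f (act g x)}"
  have U: "U \<in> sets M"
  proof -
    have "{x \<in> space M. w g x < 1 \<or> w g x = 1 \<and> f x < f (act g x)} \<in> sets M" if "g \<in> carrier G" for g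
    proof -
      note act_measurable[OF that, measurable] w_measurable[OF that, measurable]
      show ?thesis by measurable
    qed
    then have "{x \<in> space M. g \<noteq> \<one> \<longrightarrow> w g x < 1 \<or> w g x = 1 \<and> f x < f (act g x)} \<in> sets M"
      if "g \<in> carrier G" for g
      using that by (cases "g = \<one>") auto
    then have "(\<Inter>g\<in>carrier G. {x \<in> space M. g \<noteq> \<one> \<longrightarrow> w g x < 1 \<or> w g x = 1 \<and> f x < f (act g x)}) \<in> sets M"
      using countable_carrier by (intro sets.countable_INT') auto
    also have "(\<Inter>g\<in>carrier G. {x \<in> space M. g \<noteq> \<one> \<longrightarrow> w g x < 1 \<or> w g x = 1 \<and> f x < f (act g x)}) = U"
      using one_closed unfolding U_def by blast
    finally show ?thesis .
  qed
  then have U_space: "U \<subseteq> space M" by (rule sets.sets_into_space)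
  have disj: "disjoint_family_on (\<lambda>g. act g ` U) (carrier G)"
    unfolding disjoint_family_on_def
  proof (intro ballI impI, rule ccontr)
    fix g h assume g: "g \<in> carrier G" and h: "h \<in> carrier G" and "g \<noteq> h" and "act g ` U \<inter> act h ` U \<noteq> {}"
    then obtain u v where uv: "u \<in> U" "v \<in> U" "act g u = act h v" by auto
    then have sp: "u \<in> space M" "v \<in> space M" using U_space by auto
    define k where "k = inv h \<otimes> g"
    have k: "k \<in> carrier G" "k \<noteq> \<one>" "inv k \<noteq> \<one>"
      using g h \<open>g \<noteq> h\<close> by (auto simp: k_def inv_mult_group dest: inv_equality inv_solve_left[THEN iffD1, rotated -1])
    have v: "v = act k u"
      using uv(3) act_inv_act[OF h sp(2)] act_mult[of "inv h" g u] g h sp by (simp add: k_def)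
    have u: "u = act (inv k) v" using act_inv_act[OF k(1) sp(1)] by (simp add: v)
    have prod: "w (inv k) v * w k u = 1" using w_inv[OF k(1) sp(1)] by (simp add: v)
    have "w k u < 1 \<or> w k u = 1 \<and> f u < f v" using uv(1) k by (auto simp: U_def v)
    moreover have "w (inv k) v < 1 \<or> w (inv k) v = 1 \<and> f v < f u"
      using uv(2) k by (auto simp: U_def u[symmetric])
    moreover have "0 < w k u" "0 < w (inv k) v" using w_pos k sp by auto
    ultimately show False
      using prod mult_strict_mono[of "w (inv k) v" 1 "w k u" 1] by fastforce
  qed
  let ?P = "\<lambda>x. (\<forall>g\<in>carrier G - {\<one>}. f (act g x) \<noteq> f x) \<and> (\<forall>e>0. finite {g \<in> carrier G. e \<le> w g x})"
  have "AE x in M. ?P x" using sep fin by eventually_elim auto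
  then have "AE x in M. \<forall>g\<in>carrier G. ?P (act g x)"
    by (intro AE_ball_countable[THEN iffD2] countable_carrier ballI AE_act)
  then have "AE x in M. x \<in> (\<Union>g\<in>carrier G. act g ` U)"
  proof (rule AE_mp, intro AE_I2 impI)
    fix x assume x: "x \<in> space M" and P: "\<forall>g\<in>carrier G. ?P (act g x)"
    have fin: "finite {g \<in> carrier G. e \<le> w g x}" if "0 < e" for e
      using P that act_one[OF x] by (metis one_closed)
    define A where "A = {g \<in> carrier G. 1 \<le> w g x}"
    have A: "finite A" "\<one> \<in> A" using fin[of 1] by (auto simp: A_def w_one x)
    define m where "m = Max ((\<lambda>g. w g x) ` A)"
    have m_le: "w g x \<le> m" if "g \<in> carrier G" for g
    proof (cases "g \<in> A")
      case True
      then show ?thesis using A by (auto simp: m_def)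
    next
      case False
      then have "w g x \<le> w \<one> x" using that by (auto simp: A_def w_one x)
      also have "\<dots> \<le> m" unfolding m_def using A by (intro Max_ge) auto
      finally show ?thesis .
    qed
    define B where "B = {g \<in> A. w g x = m}"
    have "m \<in> (\<lambda>g. w g x) ` A" unfolding m_def using A by (intro Max_in) auto
    then have B: "finite B" "B \<noteq> {}" using A by (auto simp: B_def)
    define g where "g = arg_min_on (\<lambda>g. f (act g x)) B"
    have "g \<in> B" using B unfolding g_def by (rule arg_min_if_finite)
    have g_min: "f (act g x) \<le> f (act h x)" if "h \<in> B" for h
      unfolding g_def using B that by (intro arg_min_least) auto
    have g: "g \<in> carrier G" "w g x = m" using \<open>g \<in> B\<close> by (auto simp: B_def A_def)
    have "act g x \<in> U"
      unfolding U_def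
    proof (intro CollectI conjI ballI act_space g x)
      fix h assume h: "h \<in> carrier G - {\<one>}"
      have eq: "w (h \<otimes> g) x = w h (act g x) * m" using w_mult[of h g x] h g x by simp
      have "0 < m" using w_pos[OF g(1) x] g by simp
      have "f (act h (act g x)) \<noteq> f (act g x)" using P g h by auto
      moreover have "f (act g x) \<le> f (act h (act g x))" if "w h (act g x) = 1"
      proof -
        have "w (h \<otimes> g) x = m" using eq that by simp
        moreover have "1 \<le> m" using m_le[of \<one>] w_one[OF x] by simp
        ultimately have "h \<otimes> g \<in> B" using h g by (auto simp: B_def A_def)
        from g_min[OF this] show ?thesis using h g x by (simp add: act_mult)
      qed
      moreover have "w h (act g x) \<le> 1"
        using m_le[of "h \<otimes> g"] eq \<open>0 < m\<close> h g by simp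
      ultimately show "w h (act g x) < 1 \<or> w h (act g x) = 1 \<and> f (act g x) < f (act h (act g x))"
        by linarith
    qed
    moreover have "x = act (inv g) (act g x)" using act_inv_act g x by simp
    ultimately show "x \<in> (\<Union>g\<in>carrier G. act g ` U)" using g by blast
  qed
  moreover have "(\<Union>g\<in>carrier G. act g ` U) \<in> sets M"
    using countable_carrier U act_measurable
    by (intro sets.countable_UN'') (auto simp: image_act[OF _ U_space] intro!: measurable_sets)
  ultimately have "space M - (\<Union>g\<in>carrier G. act g ` U) \<in> null_sets M"
    by (subst AE_iff_null_sets) (auto elim: AE_mp)
  then show ?thesis
    unfolding dissipative_def using nonsingular U disj by blast
qed

text \<open>A Borel-Cantelli argument: if the sum over \<open>g\<close> of the integrals of \<open>sqrt (w g x)\<close> is finite, then so is the sum of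
  \<open>sqrt (w g x)\<close> for almost every \<open>x\<close>.\<close>

lemma AE_finite_large_cocycle:
  assumes B: "B summable_on carrier G" "\<And>g. g \<in> carrier G \<Longrightarrow> 0 \<le> B g"
    and le: "\<And>g. g \<in> carrier G \<Longrightarrow> (\<integral>\<^sup>+x. ennreal (sqrt (w g x)) \<partial>M) \<le> ennreal (B g)"
  shows "AE x in M. \<forall>e>0. finite {g \<in> carrier G. e \<le> w g x}"
proof -
  have [measurable]: "(\<lambda>x. ennreal (sqrt (w g x))) \<in> borel_measurable M" if "g \<in> carrier G" for g
    using w_measurable[OF that] by measurable
  have "(\<integral>\<^sup>+g. ennreal (B g) \<partial>count_space (carrier G)) < \<infinity>"
    using nn_integral_count_space_eq_infsum[OF B] by simp
  have "(\<integral>\<^sup>+x. (\<integral>\<^sup>+g. ennreal (sqrt (w g x)) \<partial>count_space (carrier G)) \<partial>M)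
      = (\<integral>\<^sup>+g. (\<integral>\<^sup>+x. ennreal (sqrt (w g x)) \<partial>M) \<partial>count_space (carrier G))"
    by (rule nn_integral_count_space_nn_integral) (auto simp: countable_carrier)
  also have "\<dots> \<le> (\<integral>\<^sup>+g. ennreal (B g) \<partial>count_space (carrier G))"
    by (intro nn_integral_mono) (simp add: le)
  also have "\<dots> < \<infinity>" by fact
  finally have "AE x in M. (\<integral>\<^sup>+g. ennreal (sqrt (w g x)) \<partial>count_space (carrier G)) \<noteq> \<infinity>"
    by (intro nn_integral_noteq_infinite borel_measurable_nn_integral_count_space) (auto simp: countable_carrier)
  then show ?thesis
  proof eventually_elim
    fix x assume fin: "(\<integral>\<^sup>+g. ennreal (sqrt (w g x)) \<partial>count_space (carrier G)) \<noteq> \<infinity>"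
    show "\<forall>e>0. finite {g \<in> carrier G. e \<le> w g x}"
    proof (intro allI impI)
      fix e :: real assume "0 < e"
      let ?S = "{g \<in> carrier G. e \<le> w g x}"
      have "ennreal (sqrt e) * emeasure (count_space (carrier G)) ?S
          = (\<integral>\<^sup>+g. ennreal (sqrt e) * indicator ?S g \<partial>count_space (carrier G))"
        by (subst nn_integral_cmult_indicator) auto
      also have "\<dots> \<le> (\<integral>\<^sup>+g. ennreal (sqrt (w g x)) \<partial>count_space (carrier G))"
        by (intro nn_integral_mono) (auto simp: indicator_def intro!: ennreal_leI)
      finally have "ennreal (sqrt e) * emeasure (count_space (carrier G)) ?S \<noteq> \<infinity>"
        using fin by (auto simp: top_unique)
      then have "emeasure (count_space (carrier G)) ?S \<noteq> \<infinity>"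
        using \<open>0 < e\<close> by (auto simp: ennreal_mult_eq_top_iff)
      then show "finite ?S"
        by (auto simp: emeasure_count_space split: if_splits)
    qed
  qed
qed

end

text \<open>At a point fixed by \<open>n\<close> the cocycle is multiplicative along the multiples of \<open>n\<close>, hence at
  least 1 on one of \<open>k n\<close> and \<open>- k n\<close> for every \<open>k\<close>.\<close>

lemma cocycle_action_integer_group_no_fixed_point:
  assumes "cocycle_action integer_group M act w"
    and x: "x \<in> space M" and fin: "finite {n. 1 \<le> w n x}" and "n \<noteq> 0"
  shows "act n x \<noteq> x"
proof
  interpret cocycle_action integer_group M act w by fact
  assume fix': "act n x = x"
  have fix_mult: "act (int k * n) x = x" for k
  proof (induction k)
    case 0
    show ?case using act_one[OF x] by simp
  next
    case (Suc k)
    have "act (n + int k * n) x = x"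
      using act_mult[of n "int k * n" x] Suc fix' x by simp
    then show ?case by (simp add: algebra_simps)
  qed
  have "1 \<le> w (int k * n) x \<or> 1 \<le> w (- (int k * n)) x" for k
  proof (rule ccontr)
    assume "\<not> ?thesis"
    moreover have "0 < w (int k * n) x" "0 < w (- (int k * n)) x"
      using w_pos x by auto
    ultimately have "w (- (int k * n)) x * w (int k * n) x < 1 * 1"
      by (intro mult_strict_mono) auto
    then show False using w_inv[of "int k * n" x] x fix_mult[of k] by simp
  qed
  then have "range (\<lambda>k. int k * n) \<subseteq> {i. 1 \<le> w i x} \<union> uminus ` {i. 1 \<le> w i x}"
    by (force simp: image_iff)
  then have "finite (range (\<lambda>k. int k * n))"
    by (rule finite_subset) (use fin in auto)
  then have "finite (UNIV :: nat set)"
    by (rule finite_imageD) (use \<open>n \<noteq> 0\<close> in \<open>auto simp: inj_on_def\<close>)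
  then show False by simp
qed

context cocycle_action
begin

text \<open>A single transformation is studied through the homomorphism from the integers that it
  generates.\<close>

lemma cocycle_action_hom:
  assumes "group H" "\<phi> \<in> hom H G" "countable (carrier H)"
  shows "cocycle_action H M (\<lambda>n. act (\<phi> n)) (\<lambda>n. w (\<phi> n))"
proof -
  interpret \<phi>: group_hom H G \<phi>
    using assms is_group by (simp add: group_hom_def group_hom_axioms_def)
  show ?thesis
  proof
    show "distr M M (act (\<phi> (inv\<^bsub>H\<^esub> n))) = density M (\<lambda>x. ennreal (w (\<phi> n) x))" if "n \<in> carrier H" for n
      using distr_act_inv[of "\<phi> n"] that by simp
  qed (use assms in \<open>auto simp: act_measurable act_extensional act_one act_mult w_measurable w_pos w_mult\<close>)
qed

lemma space_power_measure: "x \<in> space (power_measure m M) \<longleftrightarrow> x \<in> {..<m} \<rightarrow>\<^sub>E space M"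
  by (simp add: power_measure_def space_PiM)

lemma product_prob_space_power: "product_prob_space (\<lambda>_::nat. M)"
  by unfold_locales

lemma nn_integral_power_measure:
  assumes "f \<in> borel_measurable M"
  shows "(\<integral>\<^sup>+x. (\<Prod>i<m. f (x i)) \<partial>power_measure m M) = (\<integral>\<^sup>+x. f x \<partial>M) ^ m"
proof -
  interpret PP: product_prob_space "\<lambda>_::nat. M" "{..<m}" by (rule product_prob_space_power)
  show ?thesis
    using PP.nn_integral_PiM_prod[of "{..<m}" "\<lambda>_. f"] assms by (simp add: power_measure_def)
qed

lemma cocycle_action_power:
  "cocycle_action G (power_measure m M) (power_action m M act) (\<lambda>g x. \<Prod>i<m. w g (x i))"
proof -
  interpret PP: product_prob_space "\<lambda>_::nat. M" "{..<m}" by (rule product_prob_space_power)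
  interpret PM: prob_space "power_measure m M"
    unfolding power_measure_def by (rule PP.prob_space_axioms)
  have sp: "x i \<in> space M" if "x \<in> space (power_measure m M)" "i < m" for x i
    using that by (auto simp: space_power_measure)
  have act_i: "power_action m M act g x i = act g (x i)" if "x \<in> space (power_measure m M)" "i < m" for g x i
    using that by (simp add: power_action_def)
  have act_sp: "power_action m M act g x \<in> space (power_measure m M)"
    if "x \<in> space (power_measure m M)" "g \<in> carrier G" for g x
    using that sp act_space by (auto simp: power_action_def space_power_measure)
  have meas: "power_action m M act g \<in> power_measure m M \<rightarrow>\<^sub>M power_measure m M" if "g \<in> carrier G" for g
  proof -
    have "(\<lambda>x. \<lambda>i\<in>{..<m}. act g (x i)) \<in> power_measure m M \<rightarrow>\<^sub>M power_measure m M"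
      unfolding power_measure_def using act_measurable[OF that]
      by (intro measurable_restrict measurable_compose[OF measurable_component_singleton]) auto
    then show ?thesis
      by (rule measurable_cong[THEN iffD1, rotated]) (simp add: power_action_def)
  qed
  have w_meas: "(\<lambda>x. \<Prod>i<m. w g (x i)) \<in> borel_measurable (power_measure m M)" if "g \<in> carrier G" for g
    unfolding power_measure_def using w_measurable[OF that]
    by (intro borel_measurable_prod measurable_compose[OF measurable_component_singleton]) auto
  show ?thesis
  proof
    show "countable (carrier G)" by (rule countable_carrier)
  next
    fix g assume g: "g \<in> carrier G"
    show "power_action m M act g \<in> power_measure m M \<rightarrow>\<^sub>M power_measure m M" by (rule meas) fact
    show "power_action m M act g \<in> extensional (space (power_measure m M))"
      by (simp add: power_action_def)
    show "(\<lambda>x. \<Prod>i<m. w g (x i)) \<in> borel_measurable (power_measure m M)" by (rule w_meas) fact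
    show "0 < (\<Prod>i<m. w g (x i))" if "x \<in> space (power_measure m M)" for x
      using w_pos g sp that by (intro prod_pos) auto
    interpret d: prob_space "density M (\<lambda>x. ennreal (w g x))"
      unfolding distr_act_inv[OF g, symmetric]
      using act_measurable[of "inv g"] g by (intro prob_space_distr) auto
    have "distr (power_measure m M) (power_measure m M) (power_action m M act (inv g))
        = distr (PiM {..<m} (\<lambda>_. M)) (PiM {..<m} (\<lambda>_. M)) (compose {..<m} (act (inv g)))"
      by (rule distr_cong) (auto simp: power_measure_def power_action_def compose_def)
    also have "\<dots> = PiM {..<m} (\<lambda>_. density M (\<lambda>x. ennreal (w g x)))"
      unfolding distr_act_inv[OF g, symmetric]
      using act_measurable[of "inv g"] g
      by (intro distr_PiM_finite_prob_space') (auto simp: prob_space_axioms)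
    also have "\<dots> = density (PiM {..<m} (\<lambda>_. M)) (\<lambda>x. \<Prod>i<m. ennreal (w g (x i)))"
      using w_measurable[OF g] d.prob_space_axioms by (intro PP.PiM_density) auto
    also have "\<dots> = density (power_measure m M) (\<lambda>x. ennreal (\<Prod>i<m. w g (x i)))"
      unfolding power_measure_def[symmetric]
    proof (rule density_cong)
      show "(\<lambda>x. \<Prod>i<m. ennreal (w g (x i))) \<in> borel_measurable (power_measure m M)"
        unfolding power_measure_def using w_measurable[OF g]
        by (intro borel_measurable_prod_ennreal measurable_compose[OF measurable_component_singleton]
            measurable_compose[OF _ measurable_ennreal]) auto
      show "(\<lambda>x. ennreal (\<Prod>i<m. w g (x i))) \<in> borel_measurable (power_measure m M)"
        using w_meas[OF g] by measurable
      show "AE x in power_measure m M. (\<Prod>i<m. ennreal (w g (x i))) = ennreal (\<Prod>i<m. w g (x i))"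
        using w_pos[OF g] sp by (intro AE_I2 prod_ennreal) (auto intro: less_imp_le)
    qed
    finally show "distr (power_measure m M) (power_measure m M) (power_action m M act (inv g))
        = density (power_measure m M) (\<lambda>x. ennreal (\<Prod>i<m. w g (x i)))" .
  next
    fix x assume x: "x \<in> space (power_measure m M)"
    show "power_action m M act \<one> x = x"
      using x sp act_one
      by (auto simp: power_action_def space_power_measure PiE_iff extensional_def restrict_def)
    fix g h assume gh: "g \<in> carrier G" "h \<in> carrier G"
    show "power_action m M act (g \<otimes> h) x = power_action m M act g (power_action m M act h x)"
      using x sp[OF x] act_sp[OF x gh(2)] gh
      unfolding power_action_def[of m M act "g \<otimes> h"] power_action_def[of m M act g]
      by (auto simp: act_mult act_i intro!: restrict_ext)
    show "(\<Prod>i<m. w (g \<otimes> h) (x i)) = (\<Prod>i<m. w g (power_action m M act h x i)) * (\<Prod>i<m. w h (x i))"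
      using gh x sp[OF x] by (simp add: w_mult act_i prod.distrib)
  qed
qed

end

section \<open>The cocycle of the Bernoulli action\<close>

lemma prob_zero_Nil: "F2_prob_zero [] = 1 / 2"
  by (simp add: F2_prob_zero_def W_pos_def)

lemma prob_zero_last:
  "reduced w \<Longrightarrow> w \<noteq> [] \<Longrightarrow> F2_prob_zero w = F2_prob_zero [last w]"
  by (simp add: F2_prob_zero_def W_pos_def)

lemma prob_zero_letter:
  "F2_prob_zero [l] = (if snd l then if fst l = gen_a then 3 / 5 else 2 / 5 else 1 / 2)"
  by (cases l; cases "fst l") (auto simp: F2_prob_zero_def W_pos_def)

lemma prob_zero_range: "F2_prob_zero w \<in> {2 / 5, 1 / 2, 3 / 5}"
  by (simp add: F2_prob_zero_def)

text \<open>Multiplying by \<open>l\<close> on the left changes the last letter of a word only if it creates or deletes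
  the only letter of a word. Since negative letters do not influence the distributions, there is just
  one word for each \<open>l\<close> at which multiplication by \<open>l\<close> changes the distribution.\<close>

definition critical_word :: "letter \<Rightarrow> letter list" where
  "critical_word l = (if snd l then [] else [inv_letter l])"

lemma reduced_critical_word: "reduced (critical_word l)"
  by (simp add: critical_word_def)

lemma prob_zero_push_letter:
  assumes "reduced w" "w \<noteq> critical_word l"
  shows "F2_prob_zero (push_letter l w) = F2_prob_zero w"
proof (cases "w = [] \<or> w = [inv_letter l]")
  case True
  then show ?thesis
    using assms(2) by (cases "snd l") (auto simp: critical_word_def prob_zero_letter prob_zero_Nil)
next
  case False
  then have "push_letter l w \<noteq> []" "last (push_letter l w) = last w" "w \<noteq> []"
    by (cases w; auto)+
  then show ?thesis
    using prob_zero_last assms(1) reduced_push_letter[OF assms(1)] by metis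
qed

definition changed :: "letter list \<Rightarrow> letter list set" where
  "changed g = {h \<in> carrier F2. F2_prob_zero (g \<cdot> h) \<noteq> F2_prob_zero h}"

lemma changed_subset: "changed g \<subseteq> carrier F2"
  by (auto simp: changed_def)

lemma prob_zero_Cons_mult:
  assumes "reduced (l # g)" "reduced h" "h \<noteq> inv\<^bsub>F2\<^esub> g \<cdot> critical_word l"
  shows "F2_prob_zero ((l # g) \<cdot> h) = F2_prob_zero (g \<cdot> h)"
proof -
  have g: "g \<in> carrier F2" using reduced_tl[OF assms(1)] by simp
  have "g \<cdot> h \<noteq> critical_word l"
    using assms(2,3) g F2.inv_solve_left[of h g "critical_word l"] reduced_critical_word[of l] by auto
  moreover have "(l # g) \<cdot> h = push_letter l (g \<cdot> h)"
    using Cons_eq_mult_F2[OF assms(1)] F2.m_assoc[of "[l]" g h] g assms(2) by simp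
  moreover have "reduced (g \<cdot> h)" using F2.m_closed[of g h] g assms(2) by simp
  ultimately show ?thesis by (simp add: prob_zero_push_letter)
qed

lemma changed_letter: "changed [l] \<subseteq> {critical_word l}"
  using prob_zero_push_letter[of _ l] by (auto simp: changed_def)

text \<open>Each letter of \<open>g\<close> contributes at most one coordinate. This makes the action nonsingular.\<close>

lemma finite_changed: "reduced g \<Longrightarrow> finite (changed g)"
proof (induction g)
  case (Cons l g)
  have "changed (l # g) \<subseteq> insert (inv\<^bsub>F2\<^esub> g \<cdot> critical_word l) (changed g)"
    using prob_zero_Cons_mult[OF Cons.prems] by (auto simp: changed_def)
  then show ?case
    using Cons.IH[OF reduced_tl[OF Cons.prems]] by (meson finite.insertI finite_subset)
qed (auto simp: changed_def)

definition bit_prob :: "letter list \<Rightarrow> bool \<Rightarrow> real" where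
  "bit_prob h b = (if b then 1 - F2_prob_zero h else F2_prob_zero h)"

lemma bit_prob_pos [simp]: "0 < bit_prob h b"
  using prob_zero_range[of h] by (auto simp: bit_prob_def)

lemma bit_prob_neq_0 [simp]: "bit_prob h b \<noteq> 0"
  using bit_prob_pos[of h b] by linarith

lemma bit_prob_nonneg [simp]: "0 \<le> bit_prob h b"
  using bit_prob_pos[of h b] by linarith

lemma sets_F2_base [simp, measurable_cong]: "sets (F2_base h) = UNIV" and space_F2_base [simp]: "space (F2_base h) = UNIV"
  by (simp_all add: F2_base_def)

lemma nn_integral_F2_base:
  "(\<integral>\<^sup>+b. f b \<partial>F2_base h) = f True * ennreal (bit_prob h True) + f False * ennreal (bit_prob h False)"
  using prob_zero_range[of h] unfolding F2_base_def by (subst nn_integral_bernoulli_pmf) (auto simp: bit_prob_def)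

lemma F2_base_density: "density (F2_base h) (\<lambda>b. ennreal (bit_prob k b / bit_prob h b)) = F2_base k"
proof (rule measure_eqI)
  fix A :: "bool set"
  have "emeasure (density (F2_base h) (\<lambda>b. ennreal (bit_prob k b / bit_prob h b))) A
      = (\<integral>\<^sup>+b. ennreal (bit_prob k b / bit_prob h b) * indicator A b \<partial>F2_base h)"
    by (rule emeasure_density) (auto simp: measurable_def)
  also have "\<dots> = (\<integral>\<^sup>+b. indicator A b \<partial>F2_base k)"
    by (simp add: nn_integral_F2_base indicator_def ennreal_mult'[symmetric] divide_nonneg_pos)
  also have "\<dots> = emeasure (F2_base k) A" by simp
  finally show "emeasure (density (F2_base h) (\<lambda>b. ennreal (bit_prob k b / bit_prob h b))) A = emeasure (F2_base k) A" .
qed simp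

lemma prob_space_F2_base: "prob_space (F2_base h)"
  unfolding F2_base_def by (rule prob_space_measure_pmf)

interpretation F2P: product_prob_space F2_base "carrier F2"
  by (intro product_prob_space.intro product_sigma_finite.intro product_prob_space_axioms.intro
      prob_space_F2_base prob_space_imp_sigma_finite)

lemma prob_space_F2_space: "prob_space F2_space"
  unfolding F2_space_def by (rule F2P.prob_space_axioms)

interpretation F2S: prob_space F2_space
  by (rule prob_space_F2_space)

lemma space_F2_space: "x \<in> space F2_space \<longleftrightarrow> x \<in> extensional (carrier F2)"
  by (simp add: F2_space_def space_PiM PiE_def)

lemma measurable_coordinate [measurable]:
  "reduced h \<Longrightarrow> (\<lambda>x. x h) \<in> F2_space \<rightarrow>\<^sub>M count_space UNIV"
proof -
  assume "reduced h"
  then have "(\<lambda>x. x h) \<in> F2_space \<rightarrow>\<^sub>M F2_base h"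
    unfolding F2_space_def by (intro measurable_component_singleton) simp
  then show ?thesis by (simp add: measurable_def)
qed

definition F2_cocycle :: "letter list \<Rightarrow> (letter list \<Rightarrow> bool) \<Rightarrow> real" where
  "F2_cocycle g x = (\<Prod>h\<in>changed g. bit_prob (g \<cdot> h) (x h) / bit_prob h (x h))"

lemma F2_cocycle_superset:
  assumes "finite D" "changed g \<subseteq> D" "D \<subseteq> carrier F2"
  shows "F2_cocycle g x = (\<Prod>h\<in>D. bit_prob (g \<cdot> h) (x h) / bit_prob h (x h))"
  unfolding F2_cocycle_def using assms
proof (intro prod.mono_neutral_left ballI)
  fix h assume "h \<in> D - changed g"
  then have "F2_prob_zero (g \<cdot> h) = F2_prob_zero h" using assms by (auto simp: changed_def)
  then have "bit_prob (g \<cdot> h) (x h) = bit_prob h (x h)" by (simp add: bit_prob_def)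
  then show "bit_prob (g \<cdot> h) (x h) / bit_prob h (x h) = 1" by simp
qed auto

lemma F2_action_apply:
  "x \<in> space F2_space \<Longrightarrow> reduced h \<Longrightarrow> F2_action g x h = x (inv\<^bsub>F2\<^esub> g \<cdot> h)"
  by (simp add: F2_action_def bernoulli_action_def F2_space_def)

lemma F2_action_space: "x \<in> space F2_space \<Longrightarrow> F2_action g x \<in> space F2_space"
  by (simp add: F2_action_def bernoulli_action_def F2_space_def[symmetric] space_F2_space)

lemma F2_space_eqI:
  "x \<in> space F2_space \<Longrightarrow> y \<in> space F2_space \<Longrightarrow> (\<And>h. reduced h \<Longrightarrow> x h = y h) \<Longrightarrow> x = y"
  unfolding space_F2_space by (rule extensionalityI) auto

lemma F2_action_mult:
  assumes "g \<in> carrier F2" "h \<in> carrier F2" "x \<in> space F2_space"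
  shows "F2_action (g \<cdot> h) x = F2_action g (F2_action h x)"
proof (rule F2_space_eqI)
  fix k :: "letter list" assume k: "reduced k"
  then have "reduced (inv\<^bsub>F2\<^esub> g \<cdot> k)" using assms F2.m_closed[of "inv\<^bsub>F2\<^esub> g" k] F2.inv_closed[of g] by simp
  then show "F2_action (g \<cdot> h) x k = F2_action g (F2_action h x) k"
    using assms k F2.inv_mult_group[of g h] F2.m_assoc[of "inv\<^bsub>F2\<^esub> h" "inv\<^bsub>F2\<^esub> g" k] F2.inv_closed[of g] F2.inv_closed[of h]
    by (simp add: F2_action_apply F2_action_space)
qed (simp_all add: assms F2_action_space)

text \<open>The substitution \<open>k \<mapsto> h \<cdot> k\<close> turns the first factor into a product over the coordinates of
  \<open>x\<close>, and the product of the ratios telescopes on a common finite set of coordinates.\<close>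

lemma F2_cocycle_mult:
  assumes "g \<in> carrier F2" "h \<in> carrier F2" "x \<in> space F2_space"
  shows "F2_cocycle (g \<cdot> h) x = F2_cocycle g (F2_action h x) * F2_cocycle h x"
proof -
  let ?t = "\<lambda>k. inv\<^bsub>F2\<^esub> h \<cdot> k"
  define D where "D = changed (g \<cdot> h) \<union> changed h \<union> ?t ` changed g"
  have D: "finite D" "changed (g \<cdot> h) \<subseteq> D" "changed h \<subseteq> D" "?t ` changed g \<subseteq> D" "D \<subseteq> carrier F2"
    using assms finite_changed[of "g \<cdot> h"] finite_changed[of g] finite_changed[of h] F2.m_closed[of g h]
      changed_subset F2.m_closed[of "inv\<^bsub>F2\<^esub> h"] F2.inv_closed[of h]
    unfolding D_def by (auto dest: subsetD[OF changed_subset])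
  define E where "E = (\<lambda>k. h \<cdot> k) ` D"
  have E: "finite E" "changed g \<subseteq> E" "E \<subseteq> carrier F2"
  proof -
    show "finite E" using D by (simp add: E_def)
    show "E \<subseteq> carrier F2" using D assms F2.m_closed unfolding E_def by blast
    show "changed g \<subseteq> E"
    proof
      fix k assume k: "k \<in> changed g"
      then have "k = h \<cdot> ?t k" using F2.mult_inv_cancel_left[of h k] assms subsetD[OF changed_subset k] by simp
      then show "k \<in> E" using k D(4) unfolding E_def by blast
    qed
  qed
  have inj: "inj_on (\<lambda>k. h \<cdot> k) D"
    using F2.inj_on_cmult[of h] assms D(5) by (auto intro: inj_on_subset)
  have "F2_cocycle g (F2_action h x) = (\<Prod>k\<in>E. bit_prob (g \<cdot> k) (F2_action h x k) / bit_prob k (F2_action h x k))"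
    by (rule F2_cocycle_superset) fact+
  also have "\<dots> = (\<Prod>k\<in>D. bit_prob (g \<cdot> (h \<cdot> k)) (F2_action h x (h \<cdot> k)) / bit_prob (h \<cdot> k) (F2_action h x (h \<cdot> k)))"
    unfolding E_def using inj by (simp add: prod.reindex)
  also have "\<dots> = (\<Prod>k\<in>D. bit_prob (g \<cdot> h \<cdot> k) (x k) / bit_prob (h \<cdot> k) (x k))"
  proof (rule prod.cong[OF refl])
    fix k assume "k \<in> D"
    then have k: "k \<in> carrier F2" using D by auto
    have "F2_action h x (h \<cdot> k) = x k"
      using F2_action_apply[of x "h \<cdot> k" h] assms k F2.m_closed[of h k] F2.inv_mult_cancel_left[of h k] by simp
    then show "bit_prob (g \<cdot> (h \<cdot> k)) (F2_action h x (h \<cdot> k)) / bit_prob (h \<cdot> k) (F2_action h x (h \<cdot> k))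
        = bit_prob (g \<cdot> h \<cdot> k) (x k) / bit_prob (h \<cdot> k) (x k)"
      using F2.m_assoc[of g h k] assms k by simp
  qed
  finally have "F2_cocycle g (F2_action h x) * F2_cocycle h x
      = (\<Prod>k\<in>D. bit_prob (g \<cdot> h \<cdot> k) (x k) / bit_prob k (x k))"
    using F2_cocycle_superset[of D h x] D by (simp add: prod.distrib[symmetric])
  also have "\<dots> = F2_cocycle (g \<cdot> h) x"
    by (rule F2_cocycle_superset[symmetric]) fact+
  finally show ?thesis by simp
qed

lemma measurable_F2_action: "g \<in> carrier F2 \<Longrightarrow> F2_action g \<in> F2_space \<rightarrow>\<^sub>M F2_space"
proof -
  assume g: "g \<in> carrier F2"
  have "(\<lambda>x. \<lambda>h\<in>carrier F2. x (inv\<^bsub>F2\<^esub> g \<cdot> h)) \<in> F2_space \<rightarrow>\<^sub>M PiM (carrier F2) F2_base"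
  proof (rule measurable_restrict)
    fix h assume "h \<in> carrier F2"
    then have "reduced (inv\<^bsub>F2\<^esub> g \<cdot> h)" using g F2.m_closed[of "inv\<^bsub>F2\<^esub> g" h] F2.inv_closed[of g] by simp
    from measurable_coordinate[OF this]
    show "(\<lambda>x. x (inv\<^bsub>F2\<^esub> g \<cdot> h)) \<in> F2_space \<rightarrow>\<^sub>M F2_base h" by (simp add: measurable_def)
  qed
  then show ?thesis
    unfolding F2_space_def[symmetric]
    by (rule measurable_cong[THEN iffD1, rotated]) (simp add: F2_action_def bernoulli_action_def F2_space_def)
qed

lemma measurable_F2_cocycle: "g \<in> carrier F2 \<Longrightarrow> F2_cocycle g \<in> borel_measurable F2_space"
  unfolding F2_cocycle_def
  by (intro borel_measurable_prod measurable_compose[OF measurable_coordinate])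
    (auto dest: subsetD[OF changed_subset])

text \<open>The image of the product measure under \<open>inv g\<close> is the product of the measures at the
  coordinates \<open>g h\<close>.\<close>

lemma distr_F2_action_inv:
  assumes g: "g \<in> carrier F2"
  shows "distr F2_space F2_space (F2_action (inv\<^bsub>F2\<^esub> g)) = density F2_space (\<lambda>x. ennreal (F2_cocycle g x))"
proof -
  let ?N = "\<lambda>h. F2_base (g \<cdot> h)"
  have "distr F2_space F2_space (F2_action (inv\<^bsub>F2\<^esub> g))
      = distr (PiM (carrier F2) F2_base) (PiM (carrier F2) ?N) (\<lambda>x. \<lambda>h\<in>carrier F2. x (g \<cdot> h))"
    using g F2.inv_inv[of g] unfolding F2_space_def
    by (intro distr_cong sets_PiM_cong) (auto simp: F2_action_def bernoulli_action_def simp del: carrier_F2)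
  also have "\<dots> = PiM (carrier F2) ?N"
    using g F2.l_cancel F2.m_closed
    by (intro distr_PiM_reindex prob_space_F2_base) (auto simp: inj_on_def simp del: carrier_F2)
  also have "\<dots> = PiM (carrier F2) (\<lambda>h. density (F2_base h) (\<lambda>b. ennreal (bit_prob (g \<cdot> h) b / bit_prob h b)))"
    by (simp add: F2_base_density)
  also have "\<dots> = density F2_space (\<lambda>x. \<Prod>h\<in>changed g. ennreal (bit_prob (g \<cdot> h) (x h) / bit_prob h (x h)))"
    unfolding F2_space_def
  proof (rule F2P.PiM_density)
    show "prob_space (density (F2_base h) (\<lambda>b. ennreal (bit_prob (g \<cdot> h) b / bit_prob h b)))" for h
      unfolding F2_base_density by (rule prob_space_F2_base)
    fix h b assume "h \<in> carrier F2 - changed g"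
    then have "bit_prob (g \<cdot> h) b = bit_prob h b" by (simp add: changed_def bit_prob_def)
    then show "ennreal (bit_prob (g \<cdot> h) b / bit_prob h b) = 1" by simp
  qed (use g finite_changed changed_subset in \<open>auto simp: measurable_def\<close>)
  also have "\<dots> = density F2_space (\<lambda>x. ennreal (F2_cocycle g x))"
    by (simp add: F2_cocycle_def prod_ennreal)
  finally show ?thesis .
qed

interpretation F2A: cocycle_action F2 F2_space F2_action F2_cocycle
proof
  show "countable (carrier F2)" by (rule countable_F2)
  show "F2_action g \<in> extensional (space F2_space)" for g
    by (simp add: F2_action_def bernoulli_action_def F2_space_def)
  show "F2_action \<one>\<^bsub>F2\<^esub> x = x" if "x \<in> space F2_space" for x
    using that F2.inv_one by (intro F2_space_eqI) (auto simp: F2_action_apply F2_action_space)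
  show "0 < F2_cocycle g x" for g x by (simp add: F2_cocycle_def prod_pos)
qed (simp_all add: measurable_F2_action F2_action_mult measurable_F2_cocycle F2_cocycle_mult distr_F2_action_inv del: carrier_F2)

section \<open>Decay of the Hellinger integrals\<close>

text \<open>The integral of the square root of the density of one measure on two points with respect to
  another one, where the first point has mass \<open>p\<close> and \<open>q\<close>.\<close>

definition hellinger :: "real \<Rightarrow> real \<Rightarrow> real" where
  "hellinger p q = sqrt (p * q) + sqrt ((1 - p) * (1 - q))"

text \<open>The Hellinger integral of the fair distribution and either of the two biased ones.\<close>

definition \<rho> :: real where
  "\<rho> = sqrt (3 / 10) + sqrt (1 / 5)"

lemma \<rho>_pos: "0 < \<rho>" and \<rho>_less_1: "\<rho> < 1" and \<rho>_squared_less: "\<rho>\<^sup>2 < 9899 / 10000"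
  and \<rho>_squared_gt: "98 / 100 < \<rho>\<^sup>2"
proof -
  show "0 < \<rho>" by (simp add: \<rho>_def add_pos_pos)
  have sq: "\<rho>\<^sup>2 = 1 / 2 + 2 * sqrt (3 / 50)"
    by (simp add: \<rho>_def power2_sum real_sqrt_mult[symmetric])
  have "sqrt (3 / 50) < sqrt ((24495 / 100000)\<^sup>2)"
    by (rule real_sqrt_less_mono) (simp add: power2_eq_square)
  then show 1: "\<rho>\<^sup>2 < 9899 / 10000"
    unfolding sq real_sqrt_abs by simp
  have "sqrt ((241 / 1000)\<^sup>2) < sqrt (3 / 50)"
    by (rule real_sqrt_less_mono) (simp add: power2_eq_square)
  then show "98 / 100 < \<rho>\<^sup>2"
    unfolding sq real_sqrt_abs by simp
  show "\<rho> < 1"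
    using 1 one_le_power[of \<rho> 2] by linarith
qed

lemma hellinger_self: "0 \<le> p \<Longrightarrow> p \<le> 1 \<Longrightarrow> hellinger p p = 1"
  by (simp add: hellinger_def)

lemma hellinger_nonneg: "0 \<le> p \<Longrightarrow> p \<le> 1 \<Longrightarrow> 0 \<le> q \<Longrightarrow> q \<le> 1 \<Longrightarrow> 0 \<le> hellinger p q"
  by (simp add: hellinger_def)

lemma hellinger_commute: "hellinger p q = hellinger q p"
  by (simp add: hellinger_def mult.commute)

lemma hellinger_half: "p \<in> {2 / 5, 3 / 5} \<Longrightarrow> hellinger p (1 / 2) = \<rho>"
  by (elim insertE emptyE; hypsubst; simp add: hellinger_def \<rho>_def)

text \<open>A change from one bias to the other counts at least as much as two changes of size \<open>\<rho>\<close>, so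
  that the bound below does not suffer when two letters act on the same coordinate.\<close>

lemma hellinger_opposite:
  assumes "p \<in> {2 / 5, 3 / 5}"
  shows "hellinger p (1 - p) \<le> \<rho>\<^sup>2"
proof -
  have "hellinger p (1 - p) = 2 * sqrt (6 / 25)"
    using assms by (elim insertE emptyE; hypsubst; simp add: hellinger_def)
  also have "sqrt (6 / 25) \<le> sqrt ((49 / 100)\<^sup>2)"
    by (rule real_sqrt_le_mono) (simp add: power2_eq_square)
  also have "2 * sqrt ((49 / 100)\<^sup>2) = 98 / 100" by (simp add: real_sqrt_abs)
  also have "\<dots> \<le> \<rho>\<^sup>2" using \<rho>_squared_gt by simp
  finally show ?thesis by simp
qed

lemma prob_zero_bounds: "0 \<le> F2_prob_zero h" "F2_prob_zero h \<le> 1"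
  using prob_zero_range[of h] by auto

lemma nn_integral_sqrt_ratio:
  "(\<integral>\<^sup>+b. ennreal (sqrt (bit_prob k b / bit_prob h b)) \<partial>F2_base h)
    = ennreal (hellinger (F2_prob_zero k) (F2_prob_zero h))"
proof -
  have "sqrt (bit_prob k b / bit_prob h b) * bit_prob h b = sqrt (bit_prob k b * bit_prob h b)" for b
  proof -
    have "sqrt (bit_prob k b / bit_prob h b) * bit_prob h b
        = sqrt (bit_prob k b / bit_prob h b) * sqrt ((bit_prob h b)\<^sup>2)" by simp
    also have "\<dots> = sqrt (bit_prob k b / bit_prob h b * (bit_prob h b)\<^sup>2)" by (rule real_sqrt_mult[symmetric])
    finally show ?thesis by (simp add: power2_eq_square)
  qed
  from this[of True] this[of False] show ?thesis
    using bit_prob_nonneg[of h] bit_prob_nonneg[of k]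
    by (simp add: nn_integral_F2_base ennreal_mult'[symmetric] ennreal_plus[symmetric] hellinger_def
        bit_prob_def[of h] bit_prob_def[of k] prob_zero_bounds add.commute del: ennreal_plus)
qed

lemma sqrt_prod: "sqrt (prod f A) = (\<Prod>a\<in>A. sqrt (f a))" for f :: "'a \<Rightarrow> real"
  by (induction A rule: infinite_finite_induct) (simp_all add: real_sqrt_mult)

lemma nn_integral_sqrt_cocycle:
  assumes "reduced g"
  shows "(\<integral>\<^sup>+x. ennreal (sqrt (F2_cocycle g x)) \<partial>F2_space)
    = ennreal (\<Prod>h\<in>changed g. hellinger (F2_prob_zero (g \<cdot> h)) (F2_prob_zero h))"
proof -
  have "(\<integral>\<^sup>+x. ennreal (sqrt (F2_cocycle g x)) \<partial>F2_space)
      = (\<integral>\<^sup>+x. (\<Prod>h\<in>changed g. ennreal (sqrt (bit_prob (g \<cdot> h) (x h) / bit_prob h (x h)))) \<partial>F2_space)"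
    by (simp add: F2_cocycle_def sqrt_prod prod_ennreal)
  also have "\<dots> = (\<Prod>h\<in>changed g. \<integral>\<^sup>+b. ennreal (sqrt (bit_prob (g \<cdot> h) b / bit_prob h b)) \<partial>F2_base h)"
    unfolding F2_space_def using finite_changed[OF assms] changed_subset
    by (intro F2P.nn_integral_PiM_prod) (auto simp: measurable_def)
  also have "\<dots> = ennreal (\<Prod>h\<in>changed g. hellinger (F2_prob_zero (g \<cdot> h)) (F2_prob_zero h))"
    by (simp add: nn_integral_sqrt_ratio prod_ennreal hellinger_nonneg prob_zero_bounds)
  finally show ?thesis .
qed

lemma gen_eq_a_iff: "x \<noteq> y \<Longrightarrow> x = gen_a \<longleftrightarrow> y \<noteq> gen_a"
  by (cases x; cases y) simp_all

text \<open>A letter \<open>l\<close> put in front of \<open>g\<close> affects only the coordinate \<open>h\<close> for which \<open>g h\<close> is the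
  critical word of \<open>l\<close>. If this coordinate was already changed by \<open>g\<close>, then \<open>l\<close> moves its
  distribution further away from that of \<open>h\<close>, because \<open>l\<close> does not cancel with the first letter of \<open>g\<close>.\<close>

lemma hellinger_step:
  assumes red: "reduced (l # g)" and h: "h = inv\<^bsub>F2\<^esub> g \<cdot> critical_word l"
  shows "hellinger (F2_prob_zero ((l # g) \<cdot> h)) (F2_prob_zero h)
    \<le> \<rho> * hellinger (F2_prob_zero (g \<cdot> h)) (F2_prob_zero h)"
proof -
  have g: "reduced g" using reduced_tl[OF red] .
  have inv_g: "reduced (inv\<^bsub>F2\<^esub> g)" using F2.inv_closed[of g] g by simp
  have gh: "g \<cdot> h = critical_word l"
    unfolding h using F2.mult_inv_cancel_left[of g "critical_word l"] g reduced_critical_word by simp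
  have "(l # g) \<cdot> h = push_letter l (critical_word l)"
    using Cons_eq_mult_F2[OF red] F2.m_assoc[of "[l]" g h] g inv_g gh h
      F2.m_closed[of "inv\<^bsub>F2\<^esub> g" "critical_word l"] reduced_critical_word by simp
  then have lgh: "(l # g) \<cdot> h = (if snd l then [l] else [])"
    by (simp add: critical_word_def)
  have last_inv: "last (inv\<^bsub>F2\<^esub> g) = inv_letter (hd g)" "hd g \<noteq> inv_letter l" "inv\<^bsub>F2\<^esub> g \<noteq> []" if "g \<noteq> []"
    using that red g by (cases g; simp add: inv_F2 last_rev)+
  show ?thesis
  proof (cases "snd l")
    case True
    then have h: "h = inv\<^bsub>F2\<^esub> g" using h inv_g by (simp add: critical_word_def)
    define c where "c = F2_prob_zero [l]"
    have c: "c \<in> {2 / 5, 3 / 5}" using True by (simp add: c_def prob_zero_letter)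
    have "F2_prob_zero h \<in> {1 / 2, 1 - c}"
    proof (cases "g = []")
      case True
      then show ?thesis using F2.inv_one by (simp add: h prob_zero_Nil)
    next
      case False
      then have "F2_prob_zero h = F2_prob_zero [inv_letter (hd g)]"
        using prob_zero_last[OF inv_g] last_inv by (simp add: h)
      moreover have "fst (hd g) \<noteq> fst l" if "\<not> snd (hd g)"
        using last_inv(2)[OF False] that True by (auto simp: inv_letter_def prod_eq_iff)
      ultimately show ?thesis
        using True gen_eq_a_iff[of "fst (hd g)" "fst l"] by (auto simp: prob_zero_letter c_def)
    qed
    moreover have "hellinger c (1 / 2) \<le> \<rho> * hellinger (1 / 2) (1 / 2)"
      using c by (simp add: hellinger_half hellinger_self)
    moreover have "hellinger c (1 - c) \<le> \<rho> * hellinger (1 / 2) (1 - c)"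
      using hellinger_opposite[OF c] hellinger_half[of "1 - c"] c
      by (auto simp: hellinger_commute[of "1 / 2"] power2_eq_square)
    ultimately have "hellinger c (F2_prob_zero h) \<le> \<rho> * hellinger (1 / 2) (F2_prob_zero h)"
      by (elim insertE emptyE) (simp_all only:)
    then show ?thesis
      using True unfolding lgh gh by (simp add: critical_word_def prob_zero_Nil c_def)
  next
    case False
    define c where "c = F2_prob_zero [inv_letter l]"
    have c: "c \<in> {2 / 5, 3 / 5}" using False by (simp add: c_def prob_zero_letter)
    have "reduced (inv\<^bsub>F2\<^esub> g @ [inv_letter l])"
    proof (cases "g = []")
      case True
      then show ?thesis using F2.inv_one by simp
    next
      case False
      then show ?thesis
        unfolding reduced_append_iff using inv_g last_inv by auto
    qed
    then have "h = inv\<^bsub>F2\<^esub> g @ [inv_letter l]" "reduced h"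
      using False h mult_F2_eq_append by (auto simp: critical_word_def)
    then have "F2_prob_zero h = c" using prob_zero_last[of h] by (simp add: c_def)
    moreover have "F2_prob_zero (critical_word l) = c" "F2_prob_zero ((l # g) \<cdot> h) = 1 / 2"
      using False by (simp_all add: critical_word_def c_def lgh prob_zero_Nil)
    moreover have "hellinger (1 / 2) c \<le> \<rho> * hellinger c c"
      using c by (auto simp: hellinger_self hellinger_half hellinger_commute[of "1 / 2"])
    ultimately show ?thesis by (simp only: gh)
  qed
qed

lemma prod_hellinger_le:
  assumes "reduced g" "finite D" "D \<subseteq> carrier F2" "changed g \<subseteq> D"
  shows "(\<Prod>h\<in>D. hellinger (F2_prob_zero (g \<cdot> h)) (F2_prob_zero h)) \<le> \<rho> ^ length g"
  using assms
proof (induction g arbitrary: D)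
  case Nil
  then show ?case by (simp add: hellinger_self prob_zero_bounds)
next
  case (Cons l g)
  let ?H = "\<lambda>g h. hellinger (F2_prob_zero (g \<cdot> h)) (F2_prob_zero h)"
  have nonneg: "0 \<le> ?H g' h" for g' h by (simp add: hellinger_nonneg prob_zero_bounds)
  have g: "reduced g" using reduced_tl[OF Cons.prems(1)] .
  define h\<^sub>0 where "h\<^sub>0 = inv\<^bsub>F2\<^esub> g \<cdot> critical_word l"
  define E where "E = insert h\<^sub>0 (D \<union> changed g)"
  have h\<^sub>0: "h\<^sub>0 \<in> carrier F2"
    unfolding h\<^sub>0_def using F2.m_closed F2.inv_closed[of g] g reduced_critical_word[of l] by simp
  have E: "finite E" "E \<subseteq> carrier F2" "changed g \<subseteq> E" "D \<subseteq> E" "h\<^sub>0 \<in> E"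
    using Cons.prems finite_changed[OF g] changed_subset[of g] h\<^sub>0 by (auto simp: E_def simp del: carrier_F2)
  have "(\<Prod>h\<in>D. ?H (l # g) h) = (\<Prod>h\<in>E. ?H (l # g) h)"
  proof (intro prod.mono_neutral_left ballI)
    fix h assume "h \<in> E - D"
    then have "h \<in> carrier F2" "h \<notin> changed (l # g)" using Cons.prems(4) E by auto
    then show "?H (l # g) h = 1" by (simp add: changed_def hellinger_self prob_zero_bounds)
  qed (use E in auto)
  also have "\<dots> = ?H (l # g) h\<^sub>0 * (\<Prod>h\<in>E - {h\<^sub>0}. ?H (l # g) h)"
    using E by (simp add: prod.remove)
  also have "(\<Prod>h\<in>E - {h\<^sub>0}. ?H (l # g) h) = (\<Prod>h\<in>E - {h\<^sub>0}. ?H g h)"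
    using E prob_zero_Cons_mult[OF Cons.prems(1)] unfolding h\<^sub>0_def[symmetric] by (intro prod.cong refl) auto
  also have "?H (l # g) h\<^sub>0 * \<dots> \<le> (\<rho> * ?H g h\<^sub>0) * (\<Prod>h\<in>E - {h\<^sub>0}. ?H g h)"
    by (intro mult_right_mono hellinger_step Cons.prems(1) h\<^sub>0_def prod_nonneg nonneg ballI)
  also have "\<dots> = \<rho> * (\<Prod>h\<in>E. ?H g h)"
    using E by (simp add: prod.remove)
  also have "\<dots> \<le> \<rho> * \<rho> ^ length g"
    using Cons.IH[OF g] E \<rho>_pos by (intro mult_left_mono) auto
  finally show ?case by simp
qed

lemma nn_integral_sqrt_cocycle_le:
  "reduced g \<Longrightarrow> (\<integral>\<^sup>+x. ennreal (sqrt (F2_cocycle g x)) \<partial>F2_space) \<le> ennreal (\<rho> ^ length g)"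
  unfolding nn_integral_sqrt_cocycle
  by (intro ennreal_leI prod_hellinger_le finite_changed changed_subset order_refl)

section \<open>Freeness and dissipativity\<close>

text \<open>There are at most \<open>4 * 3 ^ n\<close> words of length \<open>n\<close>.\<close>

lemma summable_on_words:
  assumes "0 \<le> \<theta>" "3 * \<theta> < (1 :: real)"
  shows "(\<lambda>g. \<theta> ^ length g) summable_on carrier F2"
proof (rule nonneg_bdd_above_summable_on)
  show "bdd_above (sum (\<lambda>g. \<theta> ^ length g) ` {F. F \<subseteq> carrier F2 \<and> finite F})"
  proof (rule bdd_aboveI2)
    fix F assume F: "F \<in> {F. F \<subseteq> carrier F2 \<and> finite F}"
    define N where "N = Suc (Max (insert 0 (length ` F)))"
    have len: "length g < N" if "g \<in> F" for g
    proof -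
      have "length g \<le> Max (insert 0 (length ` F))" using F that by (intro Max_ge) auto
      then show ?thesis by (simp add: N_def)
    qed
    have fin: "finite {w. reduced w \<and> length w = n}" for n
      by (rule finite_subset[OF _ finite_words_of_length[of n]]) auto
    have "(\<Sum>g\<in>F. \<theta> ^ length g) \<le> (\<Sum>g\<in>(\<Union>n<N. {w. reduced w \<and> length w = n}). \<theta> ^ length g)"
      using F len assms
      by (intro sum_mono2) (auto simp: fin)
    also have "\<dots> = (\<Sum>n<N. \<Sum>g | reduced g \<and> length g = n. \<theta> ^ length g)"
      by (rule sum.UNION_disjoint) (auto simp: fin)
    also have "\<dots> = (\<Sum>n<N. real (card {w. reduced w \<and> length w = n}) * \<theta> ^ n)"
      by (intro sum.cong refl) simp
    also have "\<dots> \<le> (\<Sum>n<N. 4 * (3 * \<theta>) ^ n)"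
    proof (rule sum_mono)
      fix n
      have "real (card {w. reduced w \<and> length w = n}) \<le> real (4 * 3 ^ n)"
        using card_reduced_le[of n] by (rule of_nat_mono)
      then show "real (card {w. reduced w \<and> length w = n}) * \<theta> ^ n \<le> 4 * (3 * \<theta>) ^ n"
        using mult_right_mono[of "real (card {w. reduced w \<and> length w = n})" "real (4 * 3 ^ n)" "\<theta> ^ n"] assms
        by (simp add: power_mult_distrib mult.assoc)
    qed
    also have "\<dots> \<le> suminf (\<lambda>n. 4 * (3 * \<theta>) ^ n)"
      using assms by (intro sum_le_suminf summable_mult summable_geometric) auto
    finally show "(\<Sum>g\<in>F. \<theta> ^ length g) \<le> suminf (\<lambda>n. 4 * (3 * \<theta>) ^ n)" .
  qed
qed (use assms in auto)

lemma summable_on_int_geometric: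
  assumes "0 \<le> \<theta>" "\<theta> < (1 :: real)"
  shows "(\<lambda>n::int. \<theta> ^ nat \<bar>n\<bar>) summable_on UNIV"
proof -
  have "(\<lambda>n::nat. \<theta> ^ n) summable_on UNIV"
    using assms by (intro norm_summable_imp_summable_on) (simp add: summable_geometric)
  then have "(\<lambda>n::int. \<theta> ^ nat \<bar>n\<bar>) summable_on range int"
      "(\<lambda>n::int. \<theta> ^ nat \<bar>n\<bar>) summable_on range (\<lambda>n. - int n)"
    by (subst summable_on_reindex; simp add: o_def inj_on_def)+
  then have "(\<lambda>n::int. \<theta> ^ nat \<bar>n\<bar>) summable_on range int \<union> (range (\<lambda>n. - int n) - range int)"
    by (intro summable_on_Un_disjoint) (auto intro: summable_on_subset)
  moreover have "range int \<union> (range (\<lambda>n. - int n) - range int) = UNIV"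
  proof -
    have "n \<in> range int \<union> range (\<lambda>n. - int n)" for n
      by (cases n rule: int_cases2) auto
    then show ?thesis by auto
  qed
  ultimately show ?thesis by simp
qed

text \<open>An injective measurable function with real values, which orders the points of an orbit.\<close>

definition ternary_code :: "(letter list \<Rightarrow> bool) \<Rightarrow> real" where
  "ternary_code x = suminf (\<lambda>n. (1 / 3) ^ n * of_bool (x (from_nat_into (carrier F2) n)))"

lemma from_nat_into_F2: "reduced (from_nat_into (carrier F2) n)"
  using from_nat_into[of "carrier F2" n] F2.one_closed by auto

lemma measurable_ternary_code: "ternary_code \<in> borel_measurable F2_space"
proof -
  have "(\<lambda>x. of_bool (x (from_nat_into (carrier F2) n)) :: real) \<in> borel_measurable F2_space" for n
    by (rule measurable_compose[OF measurable_coordinate[OF from_nat_into_F2]]) simp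
  then show ?thesis unfolding ternary_code_def by measurable
qed

lemma ternary_code_inj:
  assumes x: "x \<in> space F2_space" and y: "y \<in> space F2_space" and "x \<noteq> y"
  shows "ternary_code x \<noteq> ternary_code y"
proof
  let ?e = "from_nat_into (carrier F2)"
  assume eq: "ternary_code x = ternary_code y"
  obtain h where h: "reduced h" "x h \<noteq> y h"
    using F2_space_eqI[OF x y] \<open>x \<noteq> y\<close> by blast
  then have "h \<in> range ?e"
    using range_from_nat_into[OF F2.carrier_not_empty countable_F2] by simp
  then have "\<exists>n. x (?e n) \<noteq> y (?e n)" using h by auto
  define n where "n = (LEAST n. x (?e n) \<noteq> y (?e n))"
  have n: "x (?e n) \<noteq> y (?e n)" unfolding n_def by (rule LeastI_ex) fact
  have less: "x (?e k) = y (?e k)" if "k < n" for k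
    using not_less_Least[of k] that unfolding n_def by blast
  define d where "d k = (1 / 3) ^ k * (of_bool (x (?e k)) - of_bool (y (?e k)) :: real)" for k
  have summ: "summable (\<lambda>k. (1 / 3) ^ k * (of_bool (z (?e k)) :: real))" for z
    by (rule summable_comparison_test[of _ "\<lambda>k. (1 / 3) ^ k"]) (auto intro!: exI[of _ 0] summable_geometric)
  have d: "summable d" "suminf d = 0"
    using eq summable_diff[OF summ[of x] summ[of y]] suminf_diff[OF summ[of x] summ[of y]]
    unfolding ternary_code_def d_def by (auto simp: right_diff_distrib)
  have "suminf d = suminf (\<lambda>k. d (k + Suc n)) + (\<Sum>k<Suc n. d k)"
    by (rule suminf_split_initial_segment[OF d(1)])
  also have "(\<Sum>k<Suc n. d k) = d n"
    using less by (simp add: d_def)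
  finally have "\<bar>d n\<bar> = \<bar>suminf (\<lambda>k. d (k + Suc n))\<bar>" using d by simp
  also have "\<dots> \<le> suminf (\<lambda>k. (1 / 3) ^ Suc n * (1 / 3) ^ k)"
  proof -
    have geo: "summable (\<lambda>k. (1 / 3 :: real) ^ Suc n * (1 / 3) ^ k)"
      by (intro summable_mult summable_geometric) simp
    have "norm (d (k + Suc n)) \<le> (1 / 3) ^ Suc n * (1 / 3) ^ k" for k
      by (auto simp: d_def power_add abs_mult)
    then show ?thesis
      using norm_suminf_le[of "\<lambda>k. d (k + Suc n)", OF _ geo] by simp
  qed
  also have "\<dots> = (1 / 3) ^ Suc n * (3 / 2)"
    by (subst suminf_mult) (simp_all add: suminf_geometric summable_geometric)
  also have "\<dots> < (1 / 3) ^ n" by simp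
  also have "\<dots> = \<bar>d n\<bar>" using n by (auto simp: d_def abs_mult)
  finally show False by simp
qed

lemma cocycle_action_int_pow:
  assumes "reduced g"
  shows "cocycle_action integer_group F2_space (\<lambda>n. F2_action (g [^]\<^bsub>F2\<^esub> n)) (\<lambda>n. F2_cocycle (g [^]\<^bsub>F2\<^esub> (n::int)))"
  using assms F2.hom_integer_group_pow[of g]
  by (intro F2A.cocycle_action_hom) auto

lemma AE_finite_large_int_pow:
  assumes "reduced g" "g \<noteq> []"
  shows "AE x in F2_space. \<forall>e>0. finite {n::int. e \<le> F2_cocycle (g [^]\<^bsub>F2\<^esub> n) x}"
proof -
  interpret I: cocycle_action integer_group F2_space "\<lambda>n. F2_action (g [^]\<^bsub>F2\<^esub> n)" "\<lambda>n. F2_cocycle (g [^]\<^bsub>F2\<^esub> n)"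
    using assms(1) by (rule cocycle_action_int_pow)
  obtain C where C: "nat \<bar>n\<bar> \<le> length (g [^]\<^bsub>F2\<^esub> n) + C" for n :: int
    using length_int_pow_F2_ge[OF assms] by blast
  have "AE x in F2_space. \<forall>e>0. finite {n \<in> carrier integer_group. e \<le> F2_cocycle (g [^]\<^bsub>F2\<^esub> (n::int)) x}"
  proof (rule I.AE_finite_large_cocycle)
    show "(\<lambda>n. \<rho> ^ nat \<bar>n\<bar> / \<rho> ^ C) summable_on carrier integer_group"
      using summable_on_cmult_left[OF summable_on_int_geometric, of \<rho> "inverse (\<rho> ^ C)"] \<rho>_pos \<rho>_less_1
      by (simp add: divide_inverse)
    show "0 \<le> \<rho> ^ nat \<bar>n\<bar> / \<rho> ^ C" for n using \<rho>_pos by simp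
    fix n :: int
    have "\<rho> ^ (length (g [^]\<^bsub>F2\<^esub> n) + C) \<le> \<rho> ^ nat \<bar>n\<bar>"
      using C[of n] \<rho>_pos \<rho>_less_1 by (intro power_decreasing) auto
    then have "\<rho> ^ length (g [^]\<^bsub>F2\<^esub> n) \<le> \<rho> ^ nat \<bar>n\<bar> / \<rho> ^ C"
      using \<rho>_pos by (simp add: power_add field_simps)
    then show "(\<integral>\<^sup>+x. ennreal (sqrt (F2_cocycle (g [^]\<^bsub>F2\<^esub> n) x)) \<partial>F2_space) \<le> ennreal (\<rho> ^ nat \<bar>n\<bar> / \<rho> ^ C)"
      using nn_integral_sqrt_cocycle_le[of "g [^]\<^bsub>F2\<^esub> n"] F2.int_pow_closed[of g n] assms
      by (auto intro: order_trans ennreal_leI)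
  qed
  then show ?thesis by simp
qed

text \<open>Freeness follows from the same estimate as dissipativity: at a fixed point of a power of \<open>g\<close> the
  cocycle would be at least 1 infinitely often.\<close>

lemma AE_int_pow_no_fixed_point:
  assumes "reduced g" "g \<noteq> []"
  shows "AE x in F2_space. \<forall>n::int. n \<noteq> 0 \<longrightarrow> F2_action (g [^]\<^bsub>F2\<^esub> n) x \<noteq> x"
  using AE_finite_large_int_pow[OF assms] AE_space
proof eventually_elim
  case (elim x)
  show ?case
  proof (intro allI impI)
    fix n :: int assume "n \<noteq> 0"
    moreover have "finite {n::int. 1 \<le> F2_cocycle (g [^]\<^bsub>F2\<^esub> n) x}"
      using elim(1) by simp
    ultimately show "F2_action (g [^]\<^bsub>F2\<^esub> n) x \<noteq> x"
      using cocycle_action_integer_group_no_fixed_point[OF cocycle_action_int_pow[OF assms(1)] elim(2)] by blast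
  qed
qed

lemma AE_F2_free: "AE x in F2_space. \<forall>g\<in>carrier F2 - {[]}. F2_action g x \<noteq> x"
proof (intro AE_ball_countable[THEN iffD2] ballI)
  show "countable (carrier F2 - {[]})" using countable_F2 by simp
  fix g assume "g \<in> carrier F2 - {[]}"
  then have g: "reduced g" "g \<noteq> []" by auto
  from AE_int_pow_no_fixed_point[OF this] show "AE x in F2_space. F2_action g x \<noteq> x"
  proof eventually_elim
    case (elim x)
    then have "F2_action (g [^]\<^bsub>F2\<^esub> (1::int)) x \<noteq> x" using zero_neq_one by metis
    then show ?case using F2.int_pow_1[of g] g by simp
  qed
qed

lemma F2_essentially_free: "essentially_free F2 F2_space F2_action"
  using AE_F2_free by (simp add: essentially_free_def)

lemma F2_dissipative_transformation:
  assumes "reduced g" "g \<noteq> []"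
  shows "dissipative_transformation F2_space (F2_action g)"
proof -
  interpret I: cocycle_action integer_group F2_space "\<lambda>n. F2_action (g [^]\<^bsub>F2\<^esub> n)" "\<lambda>n. F2_cocycle (g [^]\<^bsub>F2\<^esub> n)"
    using assms(1) by (rule cocycle_action_int_pow)
  interpret h: group_hom F2 "BijGroup (space F2_space)" F2_action
    using F2A.act_in_hom F2.is_group group_BijGroup by (simp add: group_hom_def group_hom_axioms_def)
  have "dissipative integer_group F2_space (\<lambda>n::int. F2_action (g [^]\<^bsub>F2\<^esub> n))"
  proof (rule I.dissipativeI[OF measurable_ternary_code])
    show "AE x in F2_space. \<forall>n\<in>carrier integer_group - {\<one>\<^bsub>integer_group\<^esub>}.
        ternary_code (F2_action (g [^]\<^bsub>F2\<^esub> (n::int)) x) \<noteq> ternary_code x"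
      using AE_int_pow_no_fixed_point[OF assms] AE_space
    proof eventually_elim
      case (elim x)
      then show ?case
        using ternary_code_inj[OF F2_action_space[OF elim(2)] elim(2)] by simp
    qed
    show "AE x in F2_space. \<forall>e>0. finite {n \<in> carrier integer_group. e \<le> F2_cocycle (g [^]\<^bsub>F2\<^esub> (n::int)) x}"
      using AE_finite_large_int_pow[OF assms] by simp
  qed
  then show ?thesis
    using F2A.act_in_Bij[of g] h.hom_int_pow[of g] assms
    by (simp add: dissipative_transformation_def)
qed

text \<open>For the \<open>m\<close>-th power the Hellinger integral of \<open>g\<close> is at most \<open>(\<rho> ^ m) ^ length g\<close>. Its sum over
  the group converges if \<open>3 * \<rho> ^ m < 1\<close>, and \<open>\<rho> ^ 220\<close> is about \<open>0.327\<close>.\<close>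

lemma F2_power_dissipative:
  assumes m: "220 \<le> m"
  shows "dissipative F2 (power_measure m F2_space) (power_action m F2_space F2_action)"
proof -
  interpret P: cocycle_action F2 "power_measure m F2_space" "power_action m F2_space F2_action"
    "\<lambda>g x. \<Prod>i<m. F2_cocycle g (x i)"
    by (rule F2A.cocycle_action_power)
  have comp: "(\<lambda>x. x 0) \<in> power_measure m F2_space \<rightarrow>\<^sub>M F2_space"
    unfolding power_measure_def using m by (intro measurable_component_singleton) auto
  have "\<rho> ^ m \<le> \<rho> ^ 220" using m \<rho>_pos \<rho>_less_1 by (intro power_decreasing) auto
  also have "\<rho> ^ 220 = (\<rho>\<^sup>2) ^ 110" by (simp flip: power_mult)
  also have "\<dots> \<le> (9899 / 10000) ^ 110" using \<rho>_squared_less by (intro power_mono) auto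
  \<comment> \<open>Rounding in between keeps the numerals short.\<close>
  also have "\<dots> = ((9899 / 10000) ^ 10) ^ 11" by (simp only: power_mult[symmetric]) simp
  also have "\<dots> \<le> (904 / 1000 :: real) ^ 11" by (intro power_mono) (simp_all add: power_divide)
  also have "\<dots> < 1 / 3" by (simp add: power_divide)
  finally have \<theta>: "3 * \<rho> ^ m < 1" by simp
  show ?thesis
  proof (rule P.dissipativeI[where f = "\<lambda>x. ternary_code (x 0)"])
    show "(\<lambda>x. ternary_code (x 0)) \<in> borel_measurable (power_measure m F2_space)"
      by (rule measurable_compose[OF comp measurable_ternary_code])
    have "AE x in power_measure m F2_space. \<forall>g\<in>carrier F2 - {[]}. F2_action g (x 0) \<noteq> x 0"
      unfolding power_measure_def using m AE_F2_free
      by (intro AE_PiM_component prob_space_F2_space) auto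
    then show "AE x in power_measure m F2_space. \<forall>g\<in>carrier F2 - {\<one>\<^bsub>F2\<^esub>}.
        ternary_code (power_action m F2_space F2_action g x 0) \<noteq> ternary_code (x 0)"
      using AE_space
    proof eventually_elim
      case (elim x)
      then have "x 0 \<in> space F2_space" using m by (auto simp: F2A.space_power_measure)
      then show ?case
        using elim m by (auto simp: power_action_def ternary_code_inj F2_action_space)
    qed
    show "AE x in power_measure m F2_space. \<forall>e>0. finite {g \<in> carrier F2. e \<le> (\<Prod>i<m. F2_cocycle g (x i))}"
    proof (rule P.AE_finite_large_cocycle)
      show "(\<lambda>g. (\<rho> ^ m) ^ length g) summable_on carrier F2"
        using \<theta> \<rho>_pos by (intro summable_on_words) auto
      show "0 \<le> (\<rho> ^ m) ^ length g" for g :: "letter list" using \<rho>_pos by simp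
      fix g assume g: "g \<in> carrier F2"
      have "(\<integral>\<^sup>+x. ennreal (sqrt (\<Prod>i<m. F2_cocycle g (x i))) \<partial>power_measure m F2_space)
          = (\<integral>\<^sup>+x. (\<Prod>i<m. ennreal (sqrt (F2_cocycle g (x i)))) \<partial>power_measure m F2_space)"
      proof (rule nn_integral_cong)
        fix x assume x: "x \<in> space (power_measure m F2_space)"
        have nonneg: "0 \<le> F2_cocycle g (x i)" if "i < m" for i
        proof -
          have "x i \<in> space F2_space" using x that by (auto simp: F2A.space_power_measure)
          from F2A.w_pos[OF g this] show ?thesis by (rule less_imp_le)
        qed
        have "ennreal (sqrt (\<Prod>i<m. F2_cocycle g (x i))) = ennreal (\<Prod>i<m. sqrt (F2_cocycle g (x i)))"
          by (simp only: sqrt_prod)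
        also have "\<dots> = (\<Prod>i<m. ennreal (sqrt (F2_cocycle g (x i))))"
          by (rule prod_ennreal[symmetric]) (use nonneg in auto)
        finally show "ennreal (sqrt (\<Prod>i<m. F2_cocycle g (x i))) = (\<Prod>i<m. ennreal (sqrt (F2_cocycle g (x i))))" .
      qed
      also have "\<dots> = (\<integral>\<^sup>+x. ennreal (sqrt (F2_cocycle g x)) \<partial>F2_space) ^ m"
        using measurable_F2_cocycle[OF g]
        by (intro F2A.nn_integral_power_measure measurable_compose[OF _ measurable_ennreal]
            measurable_compose[OF _ borel_measurable_sqrt]) auto
      also have "\<dots> \<le> ennreal (\<rho> ^ length g) ^ m"
        using g by (intro power_mono nn_integral_sqrt_cocycle_le) auto
      also have "\<dots> = ennreal ((\<rho> ^ m) ^ length g)"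
        using \<rho>_pos by (simp add: ennreal_power power_mult[symmetric] mult.commute)
      finally show "(\<integral>\<^sup>+x. ennreal (sqrt (\<Prod>i<m. F2_cocycle g (x i))) \<partial>power_measure m F2_space)
          \<le> ennreal ((\<rho> ^ m) ^ length g)" .
    qed
  qed
qed

section \<open>Nonamenability\<close>

lemma norm_infsum_le_nn_integral:
  fixes f :: "'a \<Rightarrow> complex"
  shows "ennreal (norm (infsum f A)) \<le> (\<integral>\<^sup>+h. ennreal (norm (f h)) \<partial>count_space A)"
proof (cases "(\<lambda>h. norm (f h)) summable_on A")
  case True
  then have "(\<integral>\<^sup>+h. ennreal (norm (f h)) \<partial>count_space A) = ennreal (infsum (\<lambda>h. norm (f h)) A)"
    by (rule nn_integral_count_space_eq_infsum) simp
  then show ?thesis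
    using norm_infsum_bound[OF True] by (simp add: ennreal_leI)
next
  case False
  then have "\<not> f summable_on A" by (simp add: summable_on_iff_abs_summable_on_complex)
  then have "infsum f A = 0" by (rule infsum_not_exists)
  then show ?thesis by simp
qed

lemma norm_integral_le_nn_integral:
  fixes f :: "'a \<Rightarrow> complex"
  shows "ennreal (norm (\<integral>x. f x \<partial>M)) \<le> (\<integral>\<^sup>+x. ennreal (norm (f x)) \<partial>M)"
proof (cases "integrable M f")
  case True
  then show ?thesis by (rule integral_norm_bound_ennreal)
qed (simp add: not_integrable_integral_eq)

lemma ell2_norm_eq_1_nn_integral:
  assumes "f \<in> ell2 G" "ell2_norm G f = 1"
  shows "(\<integral>\<^sup>+h. ennreal ((cmod (f h))\<^sup>2) \<partial>count_space (carrier G)) = 1"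
proof -
  have "(\<lambda>h. (cmod (f h))\<^sup>2) summable_on carrier G" using assms by (simp add: ell2_def)
  then have "(\<integral>\<^sup>+h. ennreal ((cmod (f h))\<^sup>2) \<partial>count_space (carrier G)) = ennreal (infsum (\<lambda>h. (cmod (f h))\<^sup>2) (carrier G))"
    by (rule nn_integral_count_space_eq_infsum) simp
  moreover have "infsum (\<lambda>h. (cmod (f h))\<^sup>2) (carrier G) = 1"
    using assms(2) by (simp add: ell2_norm_def)
  ultimately show ?thesis by simp
qed

lemma cmod_le_ell2_norm_diff:
  assumes f: "f \<in> ell2 G" and k: "k \<in> ell2 G" and h: "h \<in> carrier G"
  shows "cmod (k h - f h) \<le> ell2_norm G (\<lambda>h. k h - f h)"
proof -
  have "(\<lambda>h. 2 * (cmod (k h))\<^sup>2 + 2 * (cmod (f h))\<^sup>2) summable_on carrier G"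
    using f k by (intro summable_on_add summable_on_cmult_right) (auto simp: ell2_def)
  moreover have "norm ((cmod (k h - f h))\<^sup>2) \<le> 2 * (cmod (k h))\<^sup>2 + 2 * (cmod (f h))\<^sup>2" for h
  proof -
    have "(cmod (k h - f h))\<^sup>2 \<le> (cmod (k h) + cmod (f h))\<^sup>2"
      by (intro power_mono norm_triangle_ineq4) simp
    also have "\<dots> \<le> 2 * (cmod (k h))\<^sup>2 + 2 * (cmod (f h))\<^sup>2"
      using zero_le_power2[of "cmod (k h) - cmod (f h)"] by (simp add: power2_eq_square algebra_simps)
    finally show ?thesis by simp
  qed
  ultimately have "(\<lambda>h. norm ((cmod (k h - f h))\<^sup>2)) summable_on carrier G"
    by (rule Infinite_Sum.abs_summable_on_comparison_test')
  then have "(\<lambda>h. (cmod (k h - f h))\<^sup>2) summable_on carrier G" by simp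
  from finite_sum_le_infsum[OF this, of "{h}"]
  have "(cmod (k h - f h))\<^sup>2 \<le> infsum (\<lambda>h. (cmod (k h - f h))\<^sup>2) (carrier G)"
    using h by simp
  then have "sqrt ((cmod (k h - f h))\<^sup>2) \<le> ell2_norm G (\<lambda>h. k h - f h)"
    unfolding ell2_norm_def by (rule real_sqrt_le_mono)
  then show ?thesis by simp
qed

text \<open>Evaluation at a point is continuous on the Hilbert space.\<close>

lemma measurable_ell2_coordinate:
  assumes h: "h \<in> carrier G"
  shows "(\<lambda>f. f h) \<in> borel_measurable (ell2_borel G)"
proof (rule borel_measurableI)
  fix S :: "complex set" assume S: "open S"
  have sub: "Collect (ell2_open G) \<subseteq> Pow (ell2 G)" by (auto simp: ell2_open_def)
  have sp: "space (ell2_borel G) = ell2 G"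
    unfolding ell2_borel_def by (rule space_measure_of[OF sub])
  have "ell2_open G {f \<in> ell2 G. f h \<in> S}"
    unfolding ell2_open_def
  proof (intro conjI ballI)
    fix f assume "f \<in> {f \<in> ell2 G. f h \<in> S}"
    then have f: "f \<in> ell2 G" "f h \<in> S" by auto
    obtain e where e: "0 < e" "\<And>z. dist z (f h) < e \<Longrightarrow> z \<in> S"
      using S f(2) unfolding open_dist by blast
    have "k \<in> {f \<in> ell2 G. f h \<in> S}" if "k \<in> ell2 G" "ell2_norm G (\<lambda>h. k h - f h) < e" for k
      using cmod_le_ell2_norm_diff[OF f(1) that(1) h] that e(2)[of "k h"] by (auto simp: dist_norm)
    then show "\<exists>e>0. \<forall>k\<in>ell2 G. ell2_norm G (\<lambda>h. k h - f h) < e \<longrightarrow> k \<in> {f \<in> ell2 G. f h \<in> S}"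
      using e(1) by blast
  qed auto
  then have "{f \<in> ell2 G. f h \<in> S} \<in> sets (ell2_borel G)"
    unfolding ell2_borel_def sets_measure_of[OF sub] by (intro sigma_sets.Basic) simp
  also have "{f \<in> ell2 G. f h \<in> S} = (\<lambda>f. f h) -` S \<inter> space (ell2_borel G)"
    by (auto simp: sp)
  finally show "(\<lambda>f. f h) -` S \<inter> space (ell2_borel G) \<in> sets (ell2_borel G)" .
qed

lemma F2_cocycle_letter_le: "F2_cocycle [l] x \<le> 5 / 4"
proof -
  have crit: "push_letter l (critical_word l) = (if snd l then [l] else [])"
    by (simp add: critical_word_def)
  have "F2_cocycle [l] x = bit_prob (push_letter l (critical_word l)) (x (critical_word l)) / bit_prob (critical_word l) (x (critical_word l))"
    using F2_cocycle_superset[of "{critical_word l}" "[l]" x] changed_letter[of l] reduced_critical_word[of l]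
    by simp
  also have "\<dots> \<le> 5 / 4"
    unfolding crit by (cases "snd l") (auto simp: critical_word_def bit_prob_def prob_zero_letter prob_zero_Nil)
  finally show ?thesis .
qed

text \<open>The weight of the edge between \<open>h\<close> and \<open>inv l h\<close> in the Cayley tree in the arithmetic-geometric
  mean inequality: the neighbour that is further away from the root gets the larger weight.\<close>

definition edge_weight :: "letter \<Rightarrow> letter list \<Rightarrow> real" where
  "edge_weight l h = (if h \<noteq> [] \<and> hd h = l then 1 / 2 else 2)"

lemma sum_letter_le: "(\<Sum>l\<in>(UNIV :: letter set). if P \<and> l = c then 2 else 1 / 2 :: real) \<le> 7 / 2"
proof (cases P)
  case True
  have "(\<Sum>l\<in>(UNIV :: letter set). if l = c then 2 else 1 / 2 :: real)
      = (\<Sum>l\<in>(UNIV :: letter set). 1 / 2 + (if l = c then 3 / 2 else 0))"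
    by (intro sum.cong) auto
  also have "\<dots> = 7 / 2"
    by (simp only: sum.distrib sum.delta[OF finite_UNIV_letter] sum_constant card_UNIV_letter) simp
  finally show ?thesis using True by simp
next
  case False
  then have "(\<Sum>l\<in>(UNIV :: letter set). if P \<and> l = c then 2 else 1 / 2 :: real) = (\<Sum>l\<in>(UNIV :: letter set). 1 / 2)"
    by (intro sum.cong) auto
  also have "\<dots> = 2"
    by (simp only: sum_constant card_UNIV_letter)
  finally show ?thesis by simp
qed

lemma edge_weight_push:
  "reduced h \<Longrightarrow> edge_weight l (push_letter l h) = (if h \<noteq> [] \<and> l = inv_letter (hd h) then 2 else 1 / 2)"
proof (cases h)
  case (Cons k h')
  assume "reduced h"
  then show ?thesis
    using Cons by (cases h') (auto simp: edge_weight_def)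
qed (simp add: edge_weight_def)

lemma sum_edge_weight_le:
  assumes "reduced h"
  shows "(\<Sum>l\<in>UNIV. edge_weight l (push_letter l h)) \<le> 7 / 2" "(\<Sum>l\<in>UNIV. 1 / edge_weight l h) \<le> 7 / 2"
proof -
  show "(\<Sum>l\<in>UNIV. edge_weight l (push_letter l h)) \<le> 7 / 2"
    unfolding edge_weight_push[OF assms] by (rule sum_letter_le)
  have "(\<Sum>l\<in>UNIV. 1 / edge_weight l h) = (\<Sum>l\<in>(UNIV :: letter set). if h \<noteq> [] \<and> l = hd h then 2 else 1 / 2)"
    by (intro sum.cong) (auto simp: edge_weight_def)
  also have "\<dots> \<le> 7 / 2" by (rule sum_letter_le)
  finally show "(\<Sum>l\<in>UNIV. 1 / edge_weight l h) \<le> 7 / 2" .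
qed

lemma edge_weight_arith_geo: "a * b \<le> 1 / 2 * (edge_weight l h * a\<^sup>2) + 1 / 2 * (1 / edge_weight l h * b\<^sup>2)"
proof -
  have 1: "2 * (a * b) \<le> 2 * a\<^sup>2 + b\<^sup>2 / 2" for a b :: real
    using zero_le_power2[of "2 * a - b"] by (simp add: power2_eq_square algebra_simps)
  show ?thesis using 1[of a b] 1[of b a] by (auto simp: edge_weight_def mult.commute)
qed

text \<open>At each vertex the weights of the four edges add up to at most \<open>7 / 2\<close>. The first term of the
  weighted inequality is transported by a letter, which costs a factor of at most \<open>5 / 4\<close>, and so the
  bound is half of \<open>5 / 4 * 7 / 2 + 7 / 2\<close>.\<close>

lemma sum_letter_inner_le:
  fixes \<eta> :: "(letter list \<Rightarrow> bool) \<Rightarrow> letter list \<Rightarrow> complex"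
  assumes meas: "\<eta> \<in> F2_space \<rightarrow>\<^sub>M ell2_borel F2" and unit: "AE x in F2_space. ell2_norm F2 (\<eta> x) = 1"
  shows "norm (\<Sum>l\<in>UNIV. \<integral>x. ell2_inner F2 (left_regular F2 [l] (\<eta> (F2_action (inv\<^bsub>F2\<^esub> [l]) x))) (\<eta> x) \<partial>F2_space) \<le> 63 / 16"
proof -
  let ?C = "count_space (carrier F2)"
  define a where "a x h = ennreal ((cmod (\<eta> x h))\<^sup>2)" for x h
  have a_meas: "(\<lambda>x. a x h) \<in> borel_measurable F2_space" if "h \<in> carrier F2" for h
  proof -
    have "(\<lambda>x. \<eta> x h) \<in> borel_measurable F2_space"
      using measurable_compose[OF meas measurable_ell2_coordinate[OF that]] .
    then show ?thesis unfolding a_def by measurable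
  qed
  have ell2: "\<eta> x \<in> ell2 F2" if "x \<in> space F2_space" for x
  proof -
    have "Collect (ell2_open F2) \<subseteq> Pow (ell2 F2)" by (auto simp: ell2_open_def)
    then have "space (ell2_borel F2) = ell2 F2" unfolding ell2_borel_def by (rule space_measure_of)
    then show ?thesis using measurable_space[OF meas that] by simp
  qed
  have a_sum: "AE x in F2_space. (\<integral>\<^sup>+h. a x h \<partial>?C) = 1"
    using unit AE_space by eventually_elim (simp add: a_def ell2_norm_eq_1_nn_integral ell2)
  define \<phi> where "\<phi> l x = (\<integral>\<^sup>+h. ennreal (edge_weight l (push_letter l h)) * a x h \<partial>?C)" for l x
  define \<psi> where "\<psi> l x = (\<integral>\<^sup>+h. ennreal (1 / edge_weight l h) * a x h \<partial>?C)" for l x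
  have \<phi>_meas: "\<phi> l \<in> borel_measurable F2_space" and \<psi>_meas: "\<psi> l \<in> borel_measurable F2_space" for l
    unfolding \<phi>_def \<psi>_def using a_meas
    by (intro borel_measurable_nn_integral_count_space countable_F2 borel_measurable_times_ennreal; simp)+
  have bound: "(\<Sum>l\<in>UNIV. \<integral>\<^sup>+x. (\<integral>\<^sup>+h. ennreal (c l h) * a x h \<partial>?C) \<partial>F2_space) \<le> ennreal (7 / 2)"
    if c: "\<And>l h. 0 \<le> c l h" "\<And>h. reduced h \<Longrightarrow> (\<Sum>l\<in>(UNIV :: letter set). c l h) \<le> 7 / 2" for c
  proof -
    have "(\<Sum>l\<in>UNIV. \<integral>\<^sup>+x. (\<integral>\<^sup>+h. ennreal (c l h) * a x h \<partial>?C) \<partial>F2_space)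
        = (\<integral>\<^sup>+x. (\<Sum>l\<in>UNIV. \<integral>\<^sup>+h. ennreal (c l h) * a x h \<partial>?C) \<partial>F2_space)"
      using a_meas by (intro nn_integral_sum[symmetric] borel_measurable_nn_integral_count_space countable_F2) auto
    also have "\<dots> \<le> (\<integral>\<^sup>+x. ennreal (7 / 2) \<partial>F2_space)"
    proof (rule nn_integral_mono_AE)
      from a_sum show "AE x in F2_space. (\<Sum>l\<in>UNIV. \<integral>\<^sup>+h. ennreal (c l h) * a x h \<partial>?C) \<le> ennreal (7 / 2)"
      proof eventually_elim
        case (elim x)
        have "(\<Sum>l\<in>UNIV. \<integral>\<^sup>+h. ennreal (c l h) * a x h \<partial>?C) = (\<integral>\<^sup>+h. (\<Sum>l\<in>UNIV. ennreal (c l h) * a x h) \<partial>?C)"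
          by (intro nn_integral_sum[symmetric]) simp
        also have "\<dots> = (\<integral>\<^sup>+h. ennreal (\<Sum>l\<in>UNIV. c l h) * a x h \<partial>?C)"
          using c(1) by (simp add: sum_distrib_right[symmetric])
        also have "\<dots> \<le> (\<integral>\<^sup>+h. ennreal (7 / 2) * a x h \<partial>?C)"
          using c(2) by (intro nn_integral_mono mult_right_mono ennreal_leI) auto
        also have "\<dots> = ennreal (7 / 2) * (\<integral>\<^sup>+h. a x h \<partial>?C)"
          by (rule nn_integral_cmult) simp
        finally show ?case by (simp add: elim)
      qed
    qed
    also have "\<dots> = ennreal (7 / 2)" by (simp add: F2S.emeasure_space_1)
    finally show ?thesis .
  qed
  have \<phi>_sum: "(\<Sum>l\<in>UNIV. \<integral>\<^sup>+x. \<phi> l x \<partial>F2_space) \<le> ennreal (7 / 2)"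
    unfolding \<phi>_def
  proof (rule bound)
    show "0 \<le> edge_weight l (push_letter l h)" for l h by (simp add: edge_weight_def)
  qed (rule sum_edge_weight_le)
  have \<psi>_sum: "(\<Sum>l\<in>UNIV. \<integral>\<^sup>+x. \<psi> l x \<partial>F2_space) \<le> ennreal (7 / 2)"
    unfolding \<psi>_def
  proof (rule bound)
    show "0 \<le> 1 / edge_weight l h" for l h by (simp add: edge_weight_def)
  qed (rule sum_edge_weight_le)
  let ?I = "\<lambda>l. \<integral>x. ell2_inner F2 (left_regular F2 [l] (\<eta> (F2_action (inv\<^bsub>F2\<^esub> [l]) x))) (\<eta> x) \<partial>F2_space"
  have letter: "ennreal (norm (?I l)) \<le> ennreal (5 / 8) * (\<integral>\<^sup>+x. \<phi> l x \<partial>F2_space) + ennreal (1 / 2) * (\<integral>\<^sup>+x. \<psi> l x \<partial>F2_space)" for l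
  proof -
    have inv_closed: "inv\<^bsub>F2\<^esub> [l] \<in> carrier F2" by (simp add: inv_letter_F2)
    have pointwise: "ennreal (norm (ell2_inner F2 (left_regular F2 [l] f) k))
        \<le> ennreal (1 / 2) * (\<integral>\<^sup>+h. ennreal (edge_weight l (push_letter l h)) * ennreal ((cmod (f h))\<^sup>2) \<partial>?C)
          + ennreal (1 / 2) * (\<integral>\<^sup>+h. ennreal (1 / edge_weight l h) * ennreal ((cmod (k h))\<^sup>2) \<partial>?C)" for f k
    proof -
      let ?t = "\<lambda>h. inv\<^bsub>F2\<^esub> [l] \<cdot> h"
      have "ennreal (norm (ell2_inner F2 (left_regular F2 [l] f) k))
          \<le> (\<integral>\<^sup>+h. ennreal (norm (left_regular F2 [l] f h * cnj (k h))) \<partial>?C)"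
        unfolding ell2_inner_def by (rule norm_infsum_le_nn_integral)
      also have "\<dots> \<le> (\<integral>\<^sup>+h. ennreal (1 / 2) * (ennreal (edge_weight l h) * ennreal ((cmod (f (?t h)))\<^sup>2))
          + ennreal (1 / 2) * (ennreal (1 / edge_weight l h) * ennreal ((cmod (k h))\<^sup>2)) \<partial>?C)"
      proof (rule nn_integral_mono)
        fix h assume "h \<in> space ?C"
        then have "norm (left_regular F2 [l] f h * cnj (k h)) = cmod (f (?t h)) * cmod (k h)"
          by (simp add: left_regular_def norm_mult)
        also have "\<dots> \<le> 1 / 2 * (edge_weight l h * (cmod (f (?t h)))\<^sup>2) + 1 / 2 * (1 / edge_weight l h * (cmod (k h))\<^sup>2)"
          by (rule edge_weight_arith_geo)
        finally have "ennreal (norm (left_regular F2 [l] f h * cnj (k h)))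
            \<le> ennreal (1 / 2 * (edge_weight l h * (cmod (f (?t h)))\<^sup>2) + 1 / 2 * (1 / edge_weight l h * (cmod (k h))\<^sup>2))"
          by (rule ennreal_leI)
        moreover have "0 < edge_weight l h" by (simp add: edge_weight_def)
        ultimately show "ennreal (norm (left_regular F2 [l] f h * cnj (k h)))
            \<le> ennreal (1 / 2) * (ennreal (edge_weight l h) * ennreal ((cmod (f (?t h)))\<^sup>2))
            + ennreal (1 / 2) * (ennreal (1 / edge_weight l h) * ennreal ((cmod (k h))\<^sup>2))"
          by (simp only: ennreal_mult'[symmetric] ennreal_plus[symmetric] zero_le_mult_iff zero_le_power2
              less_imp_le zero_le_divide_iff zero_le_one zero_le_numeral mult_nonneg_nonneg simp_thms)
      qed
      also have "\<dots> = ennreal (1 / 2) * (\<integral>\<^sup>+h. ennreal (edge_weight l h) * ennreal ((cmod (f (?t h)))\<^sup>2) \<partial>?C)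
          + ennreal (1 / 2) * (\<integral>\<^sup>+h. ennreal (1 / edge_weight l h) * ennreal ((cmod (k h))\<^sup>2) \<partial>?C)"
        by (simp add: nn_integral_add nn_integral_cmult)
      also have "(\<integral>\<^sup>+h. ennreal (edge_weight l h) * ennreal ((cmod (f (?t h)))\<^sup>2) \<partial>?C)
          = (\<integral>\<^sup>+h. ennreal (edge_weight l (push_letter l h)) * ennreal ((cmod (f h))\<^sup>2) \<partial>?C)"
      proof -
        have t_closed: "?t h \<in> carrier F2" if "h \<in> carrier F2" for h
          using F2.m_closed[OF inv_closed that] .
        have p_closed: "push_letter l h \<in> carrier F2" if "h \<in> carrier F2" for h
          using that reduced_push_letter by simp
        have pt: "push_letter l (?t h) = h" "?t (push_letter l h) = h" if "h \<in> carrier F2" for h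
          using F2.mult_inv_cancel_left[of "[l]" h] F2.inv_mult_cancel_left[of "[l]" h] that by simp_all
        have "bij_betw (push_letter l) (carrier F2) (carrier F2)"
          by (rule bij_betw_byWitness[where f' = ?t]) (use pt t_closed p_closed in blast)+
        from nn_integral_bij_count_space[OF this, of "\<lambda>h. ennreal (edge_weight l h) * ennreal ((cmod (f (?t h)))\<^sup>2)"]
        have "(\<integral>\<^sup>+h. ennreal (edge_weight l h) * ennreal ((cmod (f (?t h)))\<^sup>2) \<partial>?C)
            = (\<integral>\<^sup>+h. ennreal (edge_weight l (push_letter l h)) * ennreal ((cmod (f (?t (push_letter l h))))\<^sup>2) \<partial>?C)"
          by simp
        also have "\<dots> = (\<integral>\<^sup>+h. ennreal (edge_weight l (push_letter l h)) * ennreal ((cmod (f h))\<^sup>2) \<partial>?C)"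
          by (rule nn_integral_cong) (simp only: space_count_space pt)
        finally show ?thesis .
      qed
      finally show ?thesis .
    qed
    have "ennreal (norm (?I l)) \<le> (\<integral>\<^sup>+x. ennreal (norm (ell2_inner F2 (left_regular F2 [l] (\<eta> (F2_action (inv\<^bsub>F2\<^esub> [l]) x))) (\<eta> x))) \<partial>F2_space)"
      by (rule norm_integral_le_nn_integral)
    also have "\<dots> \<le> (\<integral>\<^sup>+x. ennreal (1 / 2) * \<phi> l (F2_action (inv\<^bsub>F2\<^esub> [l]) x) + ennreal (1 / 2) * \<psi> l x \<partial>F2_space)"
      unfolding \<phi>_def \<psi>_def a_def by (intro nn_integral_mono pointwise)
    also have "\<dots> = ennreal (1 / 2) * (\<integral>\<^sup>+x. \<phi> l (F2_action (inv\<^bsub>F2\<^esub> [l]) x) \<partial>F2_space) + ennreal (1 / 2) * (\<integral>\<^sup>+x. \<psi> l x \<partial>F2_space)"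
      using \<phi>_meas[of l] \<psi>_meas[of l] measurable_compose[OF measurable_F2_action[OF inv_closed] \<phi>_meas[of l]]
      by (subst nn_integral_add) (auto simp: nn_integral_cmult)
    also have "(\<integral>\<^sup>+x. \<phi> l (F2_action (inv\<^bsub>F2\<^esub> [l]) x) \<partial>F2_space) = (\<integral>\<^sup>+x. ennreal (F2_cocycle [l] x) * \<phi> l x \<partial>F2_space)"
      using \<phi>_meas by (intro F2A.nn_integral_act_inv) auto
    also have "\<dots> \<le> (\<integral>\<^sup>+x. ennreal (5 / 4) * \<phi> l x \<partial>F2_space)"
      by (intro nn_integral_mono mult_right_mono ennreal_leI F2_cocycle_letter_le) simp
    also have "\<dots> = ennreal (5 / 4) * (\<integral>\<^sup>+x. \<phi> l x \<partial>F2_space)"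
      using \<phi>_meas by (rule nn_integral_cmult)
    also have "ennreal (1 / 2) * \<dots> = ennreal (5 / 8) * (\<integral>\<^sup>+x. \<phi> l x \<partial>F2_space)"
      by (simp only: mult.assoc[symmetric] ennreal_mult'[symmetric]) simp
    finally show ?thesis by (simp add: add_right_mono mult_left_mono)
  qed
  have "ennreal (norm (\<Sum>l\<in>UNIV. ?I l)) \<le> ennreal (\<Sum>l\<in>UNIV. norm (?I l))"
    by (intro ennreal_leI norm_sum)
  also have "\<dots> = (\<Sum>l\<in>UNIV. ennreal (norm (?I l)))" by simp
  also have "\<dots> \<le> (\<Sum>l\<in>UNIV. ennreal (5 / 8) * (\<integral>\<^sup>+x. \<phi> l x \<partial>F2_space) + ennreal (1 / 2) * (\<integral>\<^sup>+x. \<psi> l x \<partial>F2_space))"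
    by (intro sum_mono letter)
  also have "\<dots> = ennreal (5 / 8) * (\<Sum>l\<in>UNIV. \<integral>\<^sup>+x. \<phi> l x \<partial>F2_space) + ennreal (1 / 2) * (\<Sum>l\<in>UNIV. \<integral>\<^sup>+x. \<psi> l x \<partial>F2_space)"
    by (simp only: sum.distrib sum_distrib_left)
  also have "\<dots> \<le> ennreal (5 / 8) * ennreal (7 / 2) + ennreal (1 / 2) * ennreal (7 / 2)"
    by (intro add_mono mult_left_mono \<phi>_sum \<psi>_sum) simp_all
  also have "\<dots> = ennreal (63 / 16)"
    by (simp only: ennreal_mult'[symmetric] ennreal_plus[symmetric]) simp
  finally show ?thesis by (subst (asm) ennreal_le_iff) auto
qed

text \<open>For \<open>P = 1\<close> an amenable action would make the four integrals converge to 1, and their sum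
  to 4.\<close>

lemma F2_not_zimmer_amenable: "\<not> zimmer_amenable F2 F2_space F2_action"
proof
  assume "zimmer_amenable F2 F2_space F2_action"
  then obtain \<xi> :: "nat \<Rightarrow> (letter list \<Rightarrow> bool) \<Rightarrow> letter list \<Rightarrow> complex"
    where meas: "\<And>n. \<xi> n \<in> F2_space \<rightarrow>\<^sub>M ell2_borel F2"
      and unit: "\<And>n. AE x in F2_space. ell2_norm F2 (\<xi> n x) = 1"
      and lim: "\<And>g (P :: _ \<Rightarrow> complex). g \<in> carrier F2 \<Longrightarrow> integrable F2_space P \<Longrightarrow>
        (\<lambda>n. \<integral>x. ell2_inner F2 (left_regular F2 g (\<xi> n (F2_action (inv\<^bsub>F2\<^esub> g) x))) (\<xi> n x) * P x \<partial>F2_space)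
          \<longlonglongrightarrow> (\<integral>x. P x \<partial>F2_space)"
    unfolding zimmer_amenable_def by blast
  let ?I = "\<lambda>n l. \<integral>x. ell2_inner F2 (left_regular F2 [l] (\<xi> n (F2_action (inv\<^bsub>F2\<^esub> [l]) x))) (\<xi> n x) \<partial>F2_space"
  have "(\<lambda>n. ?I n l) \<longlonglongrightarrow> 1" for l
    using lim[of "[l]" "\<lambda>_. 1"] F2S.prob_space by simp
  then have "(\<lambda>n. \<Sum>l\<in>UNIV. ?I n l) \<longlonglongrightarrow> (\<Sum>l\<in>(UNIV :: letter set). 1)"
    by (intro tendsto_sum)
  then have "(\<lambda>n. norm (\<Sum>l\<in>UNIV. ?I n l)) \<longlonglongrightarrow> norm (\<Sum>l\<in>(UNIV :: letter set). 1 :: complex)"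
    by (rule tendsto_norm)
  then have "norm (\<Sum>l\<in>(UNIV :: letter set). 1 :: complex) \<le> 63 / 16"
    by (rule LIMSEQ_le_const2) (intro exI[of _ 0] allI impI sum_letter_inner_le meas unit)
  moreover have "norm (\<Sum>l\<in>(UNIV :: letter set). 1 :: complex) = 4"
    by (simp only: sum_constant card_UNIV_letter) simp
  ultimately show False by simp
qed

section \<open>A random walk with constant cocycle\<close>

lemma F2_cocycle_generator:
  "F2_cocycle [(s, True)] x = (if (s = gen_a) = x [] then 4 / 5 else 6 / 5)"
proof -
  have "F2_cocycle [(s, True)] x = bit_prob [(s, True)] (x []) / bit_prob [] (x [])"
    using F2_cocycle_superset[of "{[]}" "[(s, True)]" x] changed_letter[of "(s, True)"]
    by (simp add: critical_word_def)
  then show ?thesis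
    by (cases s) (auto simp: bit_prob_def prob_zero_letter prob_zero_Nil)
qed

text \<open>At each point one of the two generators multiplies the density by \<open>6 / 5\<close> and the other one by
  \<open>4 / 5\<close>; which is which depends on the coordinate \<open>[]\<close>. The step \<open>True\<close> applies the former and the step
  \<open>False\<close> the latter. The steps are not injective, but the cocycle is constant along each of them.\<close>

definition step :: "bool \<Rightarrow> (letter list \<Rightarrow> bool) \<Rightarrow> letter list \<Rightarrow> bool" where
  "step t x = F2_action [(if x [] = t then gen_b else gen_a, True)] x"

lemma F2_cocycle_step:
  "F2_cocycle [(if x [] = t then gen_b else gen_a, True)] x = (if t then 6 / 5 else 4 / 5)"
  by (auto simp: F2_cocycle_generator)

lemma step_space: "x \<in> space F2_space \<Longrightarrow> step t x \<in> space F2_space"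
  by (simp add: step_def F2_action_space)

definition pre :: "bool \<Rightarrow> (letter list \<Rightarrow> bool) set \<Rightarrow> (letter list \<Rightarrow> bool) set" where
  "pre t E = {x \<in> space F2_space. step t x \<in> E}"

abbreviation act_pre :: "gen \<Rightarrow> (letter list \<Rightarrow> bool) set \<Rightarrow> (letter list \<Rightarrow> bool) set" where
  "act_pre s E \<equiv> {x \<in> space F2_space. F2_action [(s, True)] x \<in> E}"

definition first_bit :: "bool \<Rightarrow> (letter list \<Rightarrow> bool) set" where
  "first_bit c = {x \<in> space F2_space. x [] = c}"

abbreviation determined :: "letter list set \<Rightarrow> (letter list \<Rightarrow> bool) set set" where
  "determined J \<equiv> determined_on (carrier F2) F2_base J"

lemma act_pre_sets [measurable]: "E \<in> sets F2_space \<Longrightarrow> act_pre s E \<in> sets F2_space"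
  using measurable_sets[OF measurable_F2_action[of "[(s, True)]"], of E]
  by (simp add: vimage_def Int_def conj_commute)

lemma first_bit_sets [measurable]: "first_bit c \<in> sets F2_space"
  using measurable_sets[OF measurable_coordinate[of "[]"], of "{c}"]
  by (simp add: first_bit_def vimage_def Int_def conj_commute)

lemma pre_eq:
  "pre t E = (first_bit (\<not> t) \<inter> act_pre gen_a E) \<union> (first_bit t \<inter> act_pre gen_b E)"
  by (auto simp: pre_def step_def first_bit_def)

lemma pre_sets [measurable]: "E \<in> sets F2_space \<Longrightarrow> pre t E \<in> sets F2_space"
  unfolding pre_eq by (intro sets.Un sets.Int first_bit_sets act_pre_sets)

lemma pre_mono: "E \<subseteq> F \<Longrightarrow> pre t E \<subseteq> pre t F"
  by (auto simp: pre_def)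

lemma measure_eq_act_pre:
  assumes E: "E \<in> sets F2_space"
  shows "F2S.prob E = (\<Sum>c\<in>UNIV. (if (s = gen_a) = c then 4 / 5 else 6 / 5) * F2S.prob (first_bit c \<inter> act_pre s E))"
proof -
  let ?g = "[(s, True)]" and ?r = "\<lambda>c. (if (s = gen_a) = c then 4 / 5 else 6 / 5) :: real"
  have f: "(\<lambda>x. indicator E (F2_action ?g x) :: ennreal) \<in> borel_measurable F2_space"
    using E measurable_F2_action[of ?g] by (intro measurable_compose[OF _ borel_measurable_indicator]) auto
  have "emeasure F2_space E = (\<integral>\<^sup>+x. indicator E x \<partial>F2_space)" using E by simp
  also have "\<dots> = (\<integral>\<^sup>+x. indicator E (F2_action ?g (F2_action (inv\<^bsub>F2\<^esub> ?g) x)) \<partial>F2_space)"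
    using F2A.act_act_inv[of ?g] by (intro nn_integral_cong) simp
  also have "\<dots> = (\<integral>\<^sup>+x. ennreal (F2_cocycle ?g x) * indicator E (F2_action ?g x) \<partial>F2_space)"
    using f by (intro F2A.nn_integral_act_inv) auto
  also have "\<dots> = (\<integral>\<^sup>+x. (\<Sum>c\<in>UNIV. ennreal (?r c) * indicator (first_bit c \<inter> act_pre s E) x) \<partial>F2_space)"
    by (intro nn_integral_cong) (auto simp: F2_cocycle_generator UNIV_bool indicator_def first_bit_def)
  also have "\<dots> = (\<Sum>c\<in>UNIV. ennreal (?r c) * emeasure F2_space (first_bit c \<inter> act_pre s E))"
    using E by (subst nn_integral_sum) (auto simp: nn_integral_cmult_indicator)
  also have "\<dots> = ennreal (\<Sum>c\<in>UNIV. ?r c * F2S.prob (first_bit c \<inter> act_pre s E))"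
    by (simp add: F2S.emeasure_eq_measure UNIV_bool ennreal_mult'[symmetric] ennreal_plus[symmetric] del: ennreal_plus)
  finally show ?thesis
    by (simp add: F2S.emeasure_eq_measure sum_nonneg)
qed

text \<open>The probabilities are half of the factors \<open>6 / 5\<close> and \<open>4 / 5\<close>: averaging the change of
  variables formula over the two generators shows that the walk with these step probabilities
  preserves the measure.\<close>

definition weight :: "bool \<Rightarrow> real" where
  "weight t = (if t then 3 / 5 else 2 / 5)"

lemma measure_pre_average:
  assumes E: "E \<in> sets F2_space"
  shows "(\<Sum>t\<in>UNIV. weight t * F2S.prob (pre t E)) = F2S.prob E"
proof -
  have "F2S.prob (pre t E) = F2S.prob (first_bit (\<not> t) \<inter> act_pre gen_a E) + F2S.prob (first_bit t \<inter> act_pre gen_b E)" for t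
    unfolding pre_eq using E by (intro F2S.finite_measure_Union) (auto simp: first_bit_def)
  then have "(\<Sum>t\<in>UNIV. weight t * F2S.prob (pre t E))
      = 3 / 5 * F2S.prob (first_bit False \<inter> act_pre gen_a E) + 3 / 5 * F2S.prob (first_bit True \<inter> act_pre gen_b E)
      + (2 / 5 * F2S.prob (first_bit True \<inter> act_pre gen_a E) + 2 / 5 * F2S.prob (first_bit False \<inter> act_pre gen_b E))"
    by (simp add: UNIV_bool weight_def algebra_simps)
  moreover have "F2S.prob E = 6 / 5 * F2S.prob (first_bit False \<inter> act_pre gen_a E) + 4 / 5 * F2S.prob (first_bit True \<inter> act_pre gen_a E)"
    using measure_eq_act_pre[OF E, of gen_a] by (simp add: UNIV_bool)
  moreover have "F2S.prob E = 4 / 5 * F2S.prob (first_bit False \<inter> act_pre gen_b E) + 6 / 5 * F2S.prob (first_bit True \<inter> act_pre gen_b E)"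
    using measure_eq_act_pre[OF E, of gen_b] by (simp add: UNIV_bool)
  ultimately show ?thesis by linarith
qed

lemma measure_pre_le:
  assumes "E \<in> sets F2_space"
  shows "F2S.prob (pre t E) \<le> 1 / weight t * F2S.prob E"
proof -
  have "weight t * F2S.prob (pre t E) + weight (\<not> t) * F2S.prob (pre (\<not> t) E) = F2S.prob E"
    using measure_pre_average[OF assms] by (cases t) (simp_all add: UNIV_bool)
  moreover have "0 \<le> weight (\<not> t) * F2S.prob (pre (\<not> t) E)" by (simp add: weight_def)
  ultimately have "weight t * F2S.prob (pre t E) \<le> F2S.prob E" by linarith
  then show ?thesis by (simp add: weight_def field_simps)
qed

lemma prob_first_bit: "F2S.prob (first_bit c) = 1 / 2"
proof -
  have "F2S.prob (first_bit c) = measure (distr F2_space (F2_base []) (\<lambda>x. x [])) {c}"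
    using measurable_coordinate[of "[]"]
    by (subst measure_distr) (auto simp: first_bit_def vimage_def Int_def conj_commute measurable_def)
  also have "\<dots> = measure (F2_base []) {c}"
    unfolding F2_space_def by (subst F2P.PiM_component) auto
  also have "\<dots> = 1 / 2"
    by (cases c) (simp_all add: F2_base_def measure_pmf_single prob_zero_Nil)
  finally show ?thesis .
qed

lemma first_bit_determined: "first_bit c \<in> determined {[]}"
  using first_bit_sets[of c] by (intro determined_onI) (auto simp: first_bit_def F2_space_def)

lemma act_pre_determined:
  assumes E: "E \<in> determined J" and J: "J \<subseteq> carrier F2"
  shows "act_pre s E \<in> determined (push_letter (s, False) ` J)"
proof (rule determined_onI)
  have "E \<in> sets F2_space" using E by (auto simp: F2_space_def)
  then show "act_pre s E \<in> sets (PiM (carrier F2) F2_base)"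
    using act_pre_sets[of E s] by (simp add: F2_space_def)
  fix x y assume x: "x \<in> act_pre s E" and y: "y \<in> space (PiM (carrier F2) F2_base)"
    and eq: "\<And>j. j \<in> push_letter (s, False) ` J \<Longrightarrow> x j = y j"
  have sp: "x \<in> space F2_space" "y \<in> space F2_space" using x y by (auto simp: F2_space_def)
  have "F2_action [(s, True)] x j = F2_action [(s, True)] y j" if "j \<in> J" for j
    using that J sp eq by (auto simp: F2_action_apply inv_letter_F2 inv_letter_def)
  then show "y \<in> act_pre s E"
    using determined_onD[OF E, of "F2_action [(s, True)] x" "F2_action [(s, True)] y"] x sp F2_action_space
    by (auto simp: F2_space_def)
qed

text \<open>The letter applied by a step depends on the coordinate \<open>[]\<close>, and after a step with letter \<open>s\<close>
  the coordinates of a negative cone are those of the smaller cone of words that start with the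
  inverse of \<open>s\<close>.\<close>

definition negative_cone :: "letter list set" where
  "negative_cone = {w. reduced w \<and> (w = [] \<or> \<not> snd (hd w))}"

definition letter_cone :: "gen \<Rightarrow> letter list set" where
  "letter_cone s = {w. reduced w \<and> w \<noteq> [] \<and> hd w = (s, False)}"

lemma negative_cone_subset: "negative_cone \<subseteq> carrier F2" and letter_cone_subset: "letter_cone s \<subseteq> carrier F2"
  by (auto simp: negative_cone_def letter_cone_def)

lemma letter_cone_negative: "letter_cone s \<subseteq> negative_cone"
  by (auto simp: negative_cone_def letter_cone_def)

lemma push_negative_cone: "push_letter (s, False) ` negative_cone \<subseteq> letter_cone s"
proof
  fix w assume "w \<in> push_letter (s, False) ` negative_cone"
  then obtain h where h: "w = push_letter (s, False) h" "reduced h" "h = [] \<or> \<not> snd (hd h)"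
    by (auto simp: negative_cone_def)
  then have "w = (s, False) # h" by (cases h) (auto simp: inv_letter_def)
  then show "w \<in> letter_cone s"
    using reduced_push_letter[OF h(2), of "(s, False)"] h(1) by (simp add: letter_cone_def)
qed

lemma act_pre_negative_cone: "E \<in> determined negative_cone \<Longrightarrow> act_pre s E \<in> determined (letter_cone s)"
  using act_pre_determined[OF _ negative_cone_subset, of E s] determined_on_mono[OF push_negative_cone[of s]] by blast

lemma determined_indep:
  assumes "E \<in> determined J" "F \<in> determined K" "J \<inter> K = {}" "J \<subseteq> carrier F2" "K \<subseteq> carrier F2"
  shows "F2S.prob (E \<inter> F) = F2S.prob E * F2S.prob F"
  using F2P.determined_on_indep[OF assms] by (simp add: F2_space_def)

lemma determined_sets: "E \<in> determined J \<Longrightarrow> E \<in> sets F2_space"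
  by (auto simp: F2_space_def)

lemma measure_act_pre_negative_cone:
  assumes E: "E \<in> determined negative_cone"
  shows "F2S.prob (act_pre s E) = F2S.prob E"
proof -
  have half: "F2S.prob (first_bit c \<inter> act_pre s E) = 1 / 2 * F2S.prob (act_pre s E)" for c
    using determined_indep[OF first_bit_determined act_pre_negative_cone[OF E, of s], of c] letter_cone_subset[of s]
    by (simp add: prob_first_bit letter_cone_def)
  show ?thesis
    using measure_eq_act_pre[OF determined_sets[OF E], of s] unfolding half by (cases "s = gen_a") (simp_all add: UNIV_bool)
qed

text \<open>From the same point the two steps apply different generators, and therefore they see the
  coordinates in two disjoint cones.\<close>

lemma measure_pre_Int_pre:
  assumes E: "E \<in> determined negative_cone" and F: "F \<in> determined negative_cone"
  shows "F2S.prob (pre t E \<inter> pre (\<not> t) F) = F2S.prob E * F2S.prob F"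
proof -
  have half: "F2S.prob (first_bit c \<inter> (act_pre gen_a A \<inter> act_pre gen_b B)) = 1 / 2 * (F2S.prob A * F2S.prob B)"
    if A: "A \<in> determined negative_cone" and B: "B \<in> determined negative_cone" for A B c
  proof -
    let ?C = "letter_cone gen_a \<union> letter_cone gen_b"
    have disj: "letter_cone gen_a \<inter> letter_cone gen_b = {}"
      by (auto simp: letter_cone_def)
    have "act_pre gen_a A \<inter> act_pre gen_b B \<in> determined ?C"
      by (intro determined_on_Int act_pre_negative_cone[OF A, THEN determined_on_mono[THEN subsetD, rotated]]
          act_pre_negative_cone[OF B, THEN determined_on_mono[THEN subsetD, rotated]]) auto
    then have "F2S.prob (first_bit c \<inter> (act_pre gen_a A \<inter> act_pre gen_b B))
        = 1 / 2 * F2S.prob (act_pre gen_a A \<inter> act_pre gen_b B)"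
      using determined_indep[OF first_bit_determined, of _ ?C c] letter_cone_subset
      by (auto simp: prob_first_bit letter_cone_def)
    also have "F2S.prob (act_pre gen_a A \<inter> act_pre gen_b B) = F2S.prob A * F2S.prob B"
      using determined_indep[OF act_pre_negative_cone[OF A, of gen_a] act_pre_negative_cone[OF B, of gen_b] disj]
        letter_cone_subset measure_act_pre_negative_cone[OF A] measure_act_pre_negative_cone[OF B]
      by simp
    finally show ?thesis .
  qed
  have eq: "pre t E \<inter> pre (\<not> t) F = (first_bit (\<not> t) \<inter> (act_pre gen_a E \<inter> act_pre gen_b F))
      \<union> (first_bit t \<inter> (act_pre gen_a F \<inter> act_pre gen_b E))"
    unfolding pre_eq by (auto simp: first_bit_def)
  have "F2S.prob (pre t E \<inter> pre (\<not> t) F) = F2S.prob (first_bit (\<not> t) \<inter> (act_pre gen_a E \<inter> act_pre gen_b F))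
      + F2S.prob (first_bit t \<inter> (act_pre gen_a F \<inter> act_pre gen_b E))"
    unfolding eq using determined_sets[OF E] determined_sets[OF F]
    by (intro F2S.finite_measure_Union sets.Int first_bit_sets act_pre_sets) (auto simp: first_bit_def)
  then show ?thesis
    unfolding half[OF E F] half[OF F E] by (simp add: field_simps)
qed

lemma measure_pre_negative_cone:
  assumes E: "E \<in> determined negative_cone"
  shows "F2S.prob (pre t E) = F2S.prob E"
proof -
  have sp: "space F2_space \<in> determined negative_cone"
    unfolding F2_space_def by (rule space_determined_on)
  have "pre t E \<inter> pre (\<not> t) (space F2_space) = pre t E"
    by (auto simp: pre_def step_space)
  then show ?thesis
    using measure_pre_Int_pre[OF E sp, of t] F2S.prob_space by simp
qed

lemma pre_determined:
  assumes E: "E \<in> determined J" and J: "J \<subseteq> carrier F2"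
    and K: "[] \<in> K" "\<And>s h. h \<in> J \<Longrightarrow> push_letter (s, False) h \<in> K"
  shows "pre t E \<in> determined K"
proof -
  have fb: "first_bit c \<in> determined K" for c
    using first_bit_determined[of c] determined_on_mono[of "{[]}" K] K(1) by auto
  have ap: "act_pre s E \<in> determined K" for s
    using act_pre_determined[OF E J, of s] determined_on_mono[of "push_letter (s, False) ` J" K] K(2) by auto
  show ?thesis
    unfolding pre_eq by (intro determined_on_Un determined_on_Int fb ap)
qed

lemma pre_determined_negative_cone:
  assumes "E \<in> determined negative_cone"
  shows "pre t E \<in> determined negative_cone"
  using assms negative_cone_subset
proof (rule pre_determined)
  show "push_letter (s, False) h \<in> negative_cone" if "h \<in> negative_cone" for s h
    using push_negative_cone[of s] letter_cone_negative[of s] that by blast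
qed (simp add: negative_cone_def)

definition ball_F2 :: "nat \<Rightarrow> letter list set" where
  "ball_F2 m = {w. reduced w \<and> length w \<le> m}"

text \<open>A step brings each coordinate outside the negative cone one letter closer to \<open>[]\<close> or moves it into
  the cone.\<close>

lemma pre_determined_ball:
  assumes "E \<in> determined (negative_cone \<union> ball_F2 (Suc m))"
  shows "pre t E \<in> determined (negative_cone \<union> ball_F2 m)"
  using assms
proof (rule pre_determined)
  show "negative_cone \<union> ball_F2 (Suc m) \<subseteq> carrier F2"
    using negative_cone_subset by (auto simp: ball_F2_def)
  show "push_letter (s, False) h \<in> negative_cone \<union> ball_F2 m" if "h \<in> negative_cone \<union> ball_F2 (Suc m)" for s h
  proof (cases "h \<in> negative_cone")
    case True
    then show ?thesis using push_negative_cone[of s] letter_cone_negative[of s] by blast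
  next
    case False
    then have h: "reduced h" "length h \<le> Suc m" "h \<noteq> []" using that by (auto simp: ball_F2_def negative_cone_def)
    then have red: "reduced (push_letter (s, False) h)" by (intro reduced_push_letter)
    show ?thesis
    proof (cases "hd h = (s, True)")
      case True
      then have "push_letter (s, False) h = tl h" using h by (cases h) (auto simp: inv_letter_def)
      then show ?thesis using red h by (auto simp: ball_F2_def)
    next
      case False
      then have "push_letter (s, False) h = (s, False) # h" using h by (cases h) (auto simp: inv_letter_def)
      then show ?thesis using red by (auto simp: negative_cone_def)
    qed
  qed
qed (simp add: negative_cone_def)

lemma determined_ball_0: "determined (negative_cone \<union> ball_F2 0) = determined negative_cone"
proof -
  have "negative_cone \<union> ball_F2 0 = negative_cone" by (auto simp: ball_F2_def negative_cone_def)
  then show ?thesis by simp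
qed

lemma foldr_pre_sets [measurable]: "E \<in> sets F2_space \<Longrightarrow> foldr pre u E \<in> sets F2_space"
  by (induction u) auto

lemma foldr_pre_determined_negative_cone: "E \<in> determined negative_cone \<Longrightarrow> foldr pre u E \<in> determined negative_cone"
  by (induction u) (auto intro: pre_determined_negative_cone)

lemma measure_foldr_pre_negative_cone: "E \<in> determined negative_cone \<Longrightarrow> F2S.prob (foldr pre u E) = F2S.prob E"
  by (induction u) (auto simp: measure_pre_negative_cone foldr_pre_determined_negative_cone)

lemma foldr_pre_determined_ball:
  "E \<in> determined (negative_cone \<union> ball_F2 (length u + m)) \<Longrightarrow> foldr pre u E \<in> determined (negative_cone \<union> ball_F2 m)"
proof (induction u arbitrary: m)
  case (Cons t u)
  then have "foldr pre u E \<in> determined (negative_cone \<union> ball_F2 (Suc m))"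
    by (intro Cons.IH) simp
  then show ?case by (simp add: pre_determined_ball)
qed simp

lemma foldr_pre_mono: "E \<subseteq> F \<Longrightarrow> foldr pre u E \<subseteq> foldr pre u F"
  by (induction u) (simp_all add: pre_mono)

lemma foldr_pre_Un: "foldr pre u (E \<union> F) = foldr pre u E \<union> foldr pre u F"
proof (induction u)
  case (Cons t u)
  have "pre t (A \<union> B) = pre t A \<union> pre t B" for A B by (auto simp: pre_def)
  with Cons show ?case by simp
qed simp

section \<open>Averages over types of paths\<close>

text \<open>The expectation over \<open>m\<close> independent steps.\<close>

definition average :: "nat \<Rightarrow> (bool list \<Rightarrow> real) \<Rightarrow> real" where
  "average m \<Phi> = (\<Sum>u | length u = m. prod_list (map weight u) * \<Phi> u)"

lemma average_0: "average 0 \<Phi> = \<Phi> []"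
  by (simp add: average_def)

lemma finite_bool_lists: "finite {u :: bool list. length u = m}"
  using finite_lists_length_eq[of "UNIV :: bool set" m] by simp

lemma average_Suc: "average (Suc m) \<Phi> = average m (\<lambda>u. \<Sum>t\<in>UNIV. weight t * \<Phi> (t # u))"
proof -
  have eq: "{u. length u = Suc m} = Cons True ` {u. length u = m} \<union> Cons False ` {u. length u = m}"
    by (auto simp: length_Suc_conv image_iff)
  show ?thesis
    unfolding average_def eq
    by (subst sum.union_disjoint)
      (auto simp: finite_bool_lists sum.reindex UNIV_bool sum.distrib[symmetric] algebra_simps)
qed

lemma average_mono: "(\<And>u. length u = m \<Longrightarrow> \<Phi> u \<le> \<Psi> u) \<Longrightarrow> average m \<Phi> \<le> average m \<Psi>"
  unfolding average_def
  by (intro sum_mono mult_left_mono) (auto intro!: prod_list_nonneg simp: weight_def)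

lemma average_add: "average m (\<lambda>u. \<Phi> u + \<Psi> u) = average m \<Phi> + average m \<Psi>"
  by (simp add: average_def algebra_simps sum.distrib)

lemma average_cmult: "average m (\<lambda>u. c * \<Phi> u) = c * average m \<Phi>"
  by (simp add: average_def sum_distrib_left algebra_simps)

lemma average_cmult_right: "average m (\<lambda>u. \<Phi> u * c) = average m \<Phi> * c"
  unfolding average_def sum_distrib_right by (simp add: mult.assoc)

lemma average_const: "average m (\<lambda>u. c) = c"
  by (induction m) (simp_all add: average_0 average_Suc UNIV_bool weight_def)

lemma average_swap: "average m (\<lambda>u. average n (\<lambda>v. \<Phi> u v)) = average n (\<lambda>v. average m (\<lambda>u. \<Phi> u v))"
  unfolding average_def sum_distrib_left
  by (subst sum.swap) (simp add: algebra_simps)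

lemma average_measure_foldr_pre:
  "E \<in> sets F2_space \<Longrightarrow> average m (\<lambda>u. F2S.prob (foldr pre u E)) = F2S.prob E"
  by (induction m) (simp_all add: average_0 average_Suc measure_pre_average)

section \<open>Sets invariant under exchange of steps\<close>

text \<open>The walk preserves the measure. Each of the two steps with a prescribed type costs the inverse of
  the probability of that type.\<close>

lemma average_measure_exchange_le:
  assumes D: "D \<in> sets F2_space"
  shows "average m (\<lambda>u. average m (\<lambda>v. F2S.prob (foldr pre (t # u @ (\<not> t) # v) D))) \<le> 25 / 6 * F2S.prob D"
proof -
  have sets: "foldr pre v D \<in> sets F2_space" for v using D by (rule foldr_pre_sets)
  have "average m (\<lambda>v. F2S.prob (foldr pre (t # u @ (\<not> t) # v) D))
      \<le> 1 / weight t * average m (\<lambda>v. F2S.prob (foldr pre u (pre (\<not> t) (foldr pre v D))))" for u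
    unfolding average_cmult[symmetric]
    using measure_pre_le[OF foldr_pre_sets[OF pre_sets[OF sets]]]
    by (intro average_mono) (simp only: foldr_Cons foldr_append o_apply)
  then have "average m (\<lambda>u. average m (\<lambda>v. F2S.prob (foldr pre (t # u @ (\<not> t) # v) D)))
      \<le> average m (\<lambda>u. 1 / weight t * average m (\<lambda>v. F2S.prob (foldr pre u (pre (\<not> t) (foldr pre v D)))))"
    by (rule average_mono)
  also have "\<dots> = 1 / weight t * average m (\<lambda>v. average m (\<lambda>u. F2S.prob (foldr pre u (pre (\<not> t) (foldr pre v D)))))"
    unfolding average_cmult by (subst average_swap) (rule refl)
  also have "\<dots> = 1 / weight t * average m (\<lambda>v. F2S.prob (pre (\<not> t) (foldr pre v D)))"
    by (simp add: average_measure_foldr_pre pre_sets sets)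
  also have "\<dots> \<le> 1 / weight t * average m (\<lambda>v. 1 / weight (\<not> t) * F2S.prob (foldr pre v D))"
    by (intro mult_left_mono average_mono measure_pre_le sets) (simp add: weight_def)
  also have "\<dots> = 1 / weight t * (1 / weight (\<not> t) * F2S.prob D)"
    by (simp only: average_cmult average_measure_foldr_pre[OF D])
  also have "\<dots> = 25 / 6 * F2S.prob D" by (simp add: weight_def)
  finally show ?thesis .
qed

text \<open>For a set \<open>F\<close> determined on a ball of radius \<open>m\<close>, the preimages under the two paths
  are independent as soon as the paths separate at their first step: after the last \<open>m\<close> steps
  only coordinates in the negative cone matter.\<close>

lemma exchange_independent:
  assumes F: "F \<in> determined (negative_cone \<union> ball_F2 m)" and u: "length u = m" and v: "length v = m"
  shows "F2S.prob (foldr pre (True # u @ False # v) F) = F2S.prob (foldr pre v F)"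
    and "F2S.prob (foldr pre (True # u @ False # v) F \<inter> foldr pre (False # v @ True # u) F)
      = F2S.prob (foldr pre v F) * F2S.prob (foldr pre u F)"
proof -
  have det: "foldr pre u F \<in> determined negative_cone" "foldr pre v F \<in> determined negative_cone"
    using foldr_pre_determined_ball[of F u 0] foldr_pre_determined_ball[of F v 0] F u v by (simp_all add: determined_ball_0)
  have S: "foldr pre (u @ False # v) F \<in> determined negative_cone" "F2S.prob (foldr pre (u @ False # v) F) = F2S.prob (foldr pre v F)"
    using det by (simp_all add: foldr_pre_determined_negative_cone measure_foldr_pre_negative_cone
        pre_determined_negative_cone measure_pre_negative_cone)
  have T: "foldr pre (v @ True # u) F \<in> determined negative_cone" "F2S.prob (foldr pre (v @ True # u) F) = F2S.prob (foldr pre u F)"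
    using det by (simp_all add: foldr_pre_determined_negative_cone measure_foldr_pre_negative_cone
        pre_determined_negative_cone measure_pre_negative_cone)
  show "F2S.prob (foldr pre (True # u @ False # v) F) = F2S.prob (foldr pre v F)"
    using measure_pre_negative_cone[OF S(1), of True] S(2) by (simp only: foldr.simps o_apply)
  show "F2S.prob (foldr pre (True # u @ False # v) F \<inter> foldr pre (False # v @ True # u) F)
      = F2S.prob (foldr pre v F) * F2S.prob (foldr pre u F)"
    using measure_pre_Int_pre[OF S(1) T(1), of True] S(2) T(2) by (simp only: foldr.simps o_apply not_True_eq_False)
qed

text \<open>For an invariant set \<open>E\<close> the two preimages agree almost everywhere. Approximation of \<open>E\<close> by
  a set determined on a ball, where they are independent with the measure of \<open>E\<close> on average, shows
  that the measure of \<open>E\<close> is equal to its square.\<close>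

lemma exchange_invariant_zero_one:
  assumes E: "E \<in> sets F2_space"
    and inv: "\<And>u v. length u = length v \<Longrightarrow>
      AE x in F2_space. x \<in> foldr pre (True # u @ False # v) E \<longleftrightarrow> x \<in> foldr pre (False # v @ True # u) E"
  shows "F2S.prob E = 0 \<or> F2S.prob E = 1"
proof -
  let ?p = "F2S.prob E"
  have le: "?p - ?p\<^sup>2 \<le> 27 / 2 * e" if e: "0 < e" for e
  proof -
    obtain J F where J: "finite J" "J \<subseteq> carrier F2" and F: "F \<in> determined J"
      and close: "F2S.prob ((E - F) \<union> (F - E)) < e"
      using F2P.determined_on_approx[of E e] E e by (auto simp: F2_space_def)
    define m where "m = Max (insert 0 (length ` J))"
    have "J \<subseteq> negative_cone \<union> ball_F2 m"
      using J by (auto simp: m_def ball_F2_def intro!: Max_ge)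
    then have F': "F \<in> determined (negative_cone \<union> ball_F2 m)"
      using F determined_on_mono by blast
    define D where "D = (E - F) \<union> (F - E)"
    have sets: "F \<in> sets F2_space" "D \<in> sets F2_space"
      using determined_sets[OF F] E by (auto simp: D_def)
    let ?A = "\<lambda>u v. foldr pre (True # u @ False # v)" and ?B = "\<lambda>u v. foldr pre (False # v @ True # u)"
    have "F2S.prob (foldr pre v F) - F2S.prob (foldr pre v F) * F2S.prob (foldr pre u F)
        \<le> 2 * F2S.prob (?A u v D) + F2S.prob (?B u v D)"
      if u: "length u = m" and v: "length v = m" for u v
    proof -
      have mono: "foldr pre w S \<subseteq> foldr pre w (T \<union> U)" if "S \<subseteq> T \<union> U" for w S T U
        using that by (rule foldr_pre_mono)
      have "F2S.prob (foldr pre w S) \<le> F2S.prob (foldr pre w T) + F2S.prob (foldr pre w D)"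
        if "S \<in> sets F2_space" "T \<in> sets F2_space" "S \<subseteq> T \<union> D" for w S T
      proof -
        have "F2S.prob (foldr pre w S) \<le> F2S.prob (foldr pre w (T \<union> D))"
          using that sets by (intro F2S.finite_measure_mono mono foldr_pre_sets) auto
        also have "\<dots> \<le> F2S.prob (foldr pre w T) + F2S.prob (foldr pre w D)"
          unfolding foldr_pre_Un using that sets by (intro measure_Un_le foldr_pre_sets) auto
        finally show ?thesis .
      qed
      from this[of F E "True # u @ False # v"]
      have 1: "F2S.prob (?A u v F) \<le> F2S.prob (?A u v E) + F2S.prob (?A u v D)"
        using E sets by (auto simp: D_def)
      have "F2S.prob (?A u v E) = F2S.prob (?A u v E \<inter> ?B u v E)"
        using inv[of u v] u v E by (intro F2S.finite_measure_eq_AE sets.Int foldr_pre_sets) auto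
      also have "\<dots> \<le> F2S.prob ((?A u v F \<inter> ?B u v F) \<union> (?A u v D \<union> ?B u v D))"
      proof (rule F2S.finite_measure_mono)
        have "?A u v E \<subseteq> ?A u v F \<union> ?A u v D" "?B u v E \<subseteq> ?B u v F \<union> ?B u v D"
          unfolding foldr_pre_Un[symmetric] by (intro foldr_pre_mono; auto simp: D_def)+
        then show "?A u v E \<inter> ?B u v E \<subseteq> (?A u v F \<inter> ?B u v F) \<union> (?A u v D \<union> ?B u v D)"
          by blast
      qed (intro sets.Un sets.Int foldr_pre_sets sets)
      also have "\<dots> \<le> F2S.prob (?A u v F \<inter> ?B u v F) + F2S.prob (?A u v D \<union> ?B u v D)"
        by (intro measure_Un_le sets.Un sets.Int foldr_pre_sets sets)
      also have "F2S.prob (?A u v D \<union> ?B u v D) \<le> F2S.prob (?A u v D) + F2S.prob (?B u v D)"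
        by (intro measure_Un_le foldr_pre_sets sets)
      finally show ?thesis
        using 1 exchange_independent[OF F' u v] by linarith
    qed
    then have "average m (\<lambda>u. average m (\<lambda>v. F2S.prob (foldr pre v F)))
        \<le> average m (\<lambda>u. average m (\<lambda>v. F2S.prob (foldr pre u F) * F2S.prob (foldr pre v F)
          + (2 * F2S.prob (?A u v D) + F2S.prob (?B u v D))))"
      by (intro average_mono) (simp add: algebra_simps)
    also have "\<dots> = F2S.prob F * F2S.prob F + (2 * average m (\<lambda>u. average m (\<lambda>v. F2S.prob (?A u v D)))
        + average m (\<lambda>u. average m (\<lambda>v. F2S.prob (?B u v D))))"
      by (simp only: average_add average_cmult average_cmult_right average_measure_foldr_pre[OF sets(1)])
    also have "\<dots> \<le> F2S.prob F * F2S.prob F + (2 * (25 / 6 * F2S.prob D) + 25 / 6 * F2S.prob D)"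
    proof -
      have "average m (\<lambda>u. average m (\<lambda>v. F2S.prob (?A u v D))) \<le> 25 / 6 * F2S.prob D"
        using average_measure_exchange_le[OF sets(2), of m True] by simp
      moreover have "average m (\<lambda>u. average m (\<lambda>v. F2S.prob (?B u v D))) \<le> 25 / 6 * F2S.prob D"
        using average_measure_exchange_le[OF sets(2), of m False] by (subst average_swap) simp
      ultimately show ?thesis by linarith
    qed
    finally have F_le: "F2S.prob F - (F2S.prob F)\<^sup>2 \<le> 25 / 2 * F2S.prob D"
      by (simp add: average_measure_foldr_pre[OF sets(1)] average_const power2_eq_square)
    have "?p \<le> F2S.prob (F \<union> D)" "F2S.prob F \<le> F2S.prob (E \<union> D)"
      using E sets by (auto intro!: F2S.finite_measure_mono simp: D_def)
    then have "?p \<le> F2S.prob F + F2S.prob D" "F2S.prob F \<le> ?p + F2S.prob D"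
      using measure_Un_le[of F F2_space D] measure_Un_le[of E F2_space D] E sets by linarith+
    then have pF: "\<bar>?p - F2S.prob F\<bar> \<le> e" "F2S.prob D \<le> e"
      using close by (auto simp: D_def)
    have "\<bar>1 - ?p - F2S.prob F\<bar> \<le> 1"
      using F2S.prob_le_1[of E] F2S.prob_le_1[of F] measure_nonneg[of F2_space E] measure_nonneg[of F2_space F]
      by linarith
    then have "\<bar>(?p - F2S.prob F) * (1 - ?p - F2S.prob F)\<bar> \<le> e * 1"
      unfolding abs_mult using pF by (intro mult_mono) auto
    moreover have "?p - ?p\<^sup>2 = (F2S.prob F - (F2S.prob F)\<^sup>2) + (?p - F2S.prob F) * (1 - ?p - F2S.prob F)"
      by (simp add: power2_eq_square algebra_simps)
    ultimately show ?thesis using F_le pF(2) by linarith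
  qed
  have "?p - ?p\<^sup>2 \<le> 0 + e" if "0 < e" for e
    using le[of "2 / 27 * e"] that by simp
  then have "?p - ?p\<^sup>2 \<le> 0" by (rule field_le_epsilon)
  then have "?p * (1 - ?p) \<le> 0" by (simp add: power2_eq_square algebra_simps)
  moreover have "0 \<le> ?p" "?p \<le> 1" by simp_all
  ultimately show ?thesis
    by (smt (verit) mult_pos_pos)
qed

section \<open>Ergodicity of dense groups of translations of the line\<close>

lemma AE_lborel_translate:
  fixes P :: "real \<Rightarrow> bool"
  assumes "AE s in lborel. P s"
  shows "AE s in lborel. P (d + s)"
proof -
  have "AE s in distr lborel borel ((+) d). P s"
    unfolding lborel_distr_plus by (rule assms)
  from AE_distrD[OF _ this] show ?thesis by simp
qed

lemma emeasure_density_translate: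
  fixes H :: "real set"
  assumes H [measurable]: "H \<in> sets borel" and A [measurable]: "A \<in> sets borel"
    and inv: "AE s in lborel. d + s \<in> H \<longleftrightarrow> s \<in> H"
  shows "emeasure lborel (H \<inter> (+) d ` A) = emeasure lborel (H \<inter> A)"
proof -
  have im: "(+) d ` A = (\<lambda>s. - d + s) -` A"
    by (force simp: image_iff)
  then have [measurable]: "(+) d ` A \<in> sets borel"
    using measurable_sets_borel[of "\<lambda>s. - d + s" borel A] by simp
  have "emeasure lborel (H \<inter> (+) d ` A) = emeasure (distr lborel borel ((+) d)) (H \<inter> (+) d ` A)"
    by (simp add: lborel_distr_plus)
  also have "\<dots> = emeasure lborel ((+) d -` (H \<inter> (+) d ` A) \<inter> space lborel)"
    by (rule emeasure_distr) auto
  also have "\<dots> = emeasure lborel (H \<inter> A)"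
  proof (rule emeasure_eq_AE)
    show "AE s in lborel. s \<in> (+) d -` (H \<inter> (+) d ` A) \<inter> space lborel \<longleftrightarrow> s \<in> H \<inter> A"
      using inv by eventually_elim auto
    show "(+) d -` (H \<inter> (+) d ` A) \<inter> space lborel \<in> sets lborel"
      by (rule measurable_sets[of _ _ borel]) auto
  qed auto
  finally show ?thesis .
qed

text \<open>The measure \<open>H \<inter> _\<close> is invariant under a dense set of translations, and its value on an
  interval depends continuously on the interval. Hence it is invariant under all translations. By
  the theorem of Tonelli, a translation invariant measure that vanishes on a set of positive Lebesgue
  measure vanishes; this is applied to the complement of \<open>H\<close>.\<close>

lemma dense_translations_ergodic:
  fixes H D :: "real set"
  assumes H [measurable]: "H \<in> sets borel"
    and D: "\<And>d. d \<in> D \<Longrightarrow> AE s in lborel. d + s \<in> H \<longleftrightarrow> s \<in> H"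
    and dense: "\<And>t e. 0 < e \<Longrightarrow> \<exists>d\<in>D. \<bar>d - t\<bar> < e"
  shows "H \<in> null_sets lborel \<or> - H \<in> null_sets lborel"
proof -
  define \<nu> where "\<nu> = density lborel (indicator H)"
  have sets_\<nu> [simp, measurable_cong]: "sets \<nu> = sets borel" by (simp add: \<nu>_def)
  have \<nu>: "emeasure \<nu> A = emeasure lborel (H \<inter> A)" if "A \<in> sets borel" for A
    using that unfolding \<nu>_def by (subst emeasure_density)
      (auto simp: indicator_inter_arith[symmetric] Int_commute)
  have \<nu>_box: "emeasure \<nu> {t + a<..<t + b} = emeasure \<nu> {a<..<b}" for a b t :: real
  proof -
    have fmeasurable_bounded: "A \<in> fmeasurable lborel" if "bounded A" "A \<in> sets borel" for A :: "real set"
      using that emeasure_bounded_finite[OF that(1)] by (simp add: fmeasurable_def)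
    have fin: "H \<inter> {x<..<y} \<in> fmeasurable lborel" for x y :: real
      by (rule fmeasurableI2[of "{x<..<y}"]) (auto simp: fmeasurable_bounded)
    let ?m = "\<lambda>u. measure lborel (H \<inter> {u + a<..<u + b})"
    have fmeasurable_Icc: "{x..y} \<in> fmeasurable lborel" for x y :: real
      by (simp add: fmeasurable_bounded)
    have close: "?m u \<le> ?m v + 2 * \<bar>u - v\<bar>" for u v
    proof -
      have "?m u \<le> measure lborel ((H \<inter> {v + a<..<v + b}) \<union> ({u + a..u + a + \<bar>u - v\<bar>} \<union> {u + b - \<bar>u - v\<bar>..u + b}))"
        by (rule measure_mono_fmeasurable) (auto intro!: fmeasurable.Un fin fmeasurable_Icc)
      also have "\<dots> \<le> ?m v + measure lborel ({u + a..u + a + \<bar>u - v\<bar>} \<union> {u + b - \<bar>u - v\<bar>..u + b})"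
        by (rule measure_Un_le) auto
      also have "measure lborel ({u + a..u + a + \<bar>u - v\<bar>} \<union> {u + b - \<bar>u - v\<bar>..u + b})
          \<le> measure lborel {u + a..u + a + \<bar>u - v\<bar>} + measure lborel {u + b - \<bar>u - v\<bar>..u + b}"
        by (rule measure_Un_le) auto
      finally show ?thesis by simp
    qed
    have inv: "?m d = ?m 0" if "d \<in> D" for d
    proof -
      have "(+) d ` {a<..<b} = {d + a<..<d + b}"
      proof (intro Set.set_eqI iffI)
        fix x assume "x \<in> {d + a<..<d + b}"
        then show "x \<in> (+) d ` {a<..<b}" by (intro image_eqI[of _ _ "x - d"]) auto
      qed auto
      then show ?thesis
        using emeasure_density_translate[OF H _ D[OF that], of "{a<..<b}"] by (simp add: measure_def)
    qed
    have "\<bar>?m t - ?m 0\<bar> \<le> e" if e: "0 < e" for e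
    proof -
      obtain d where d: "d \<in> D" "\<bar>d - t\<bar> < e / 2" using dense[of "e / 2" t] e by auto
      then have "2 * \<bar>t - d\<bar> < e" "2 * \<bar>d - t\<bar> < e" by (auto simp: abs_minus_commute)
      then show ?thesis using close[of t d] close[of d t] inv[OF d(1)] by simp
    qed
    then have "?m t = ?m 0" using field_le_epsilon[of "\<bar>?m t - ?m 0\<bar>" 0] by simp
    then show ?thesis
      using fin[of "t + a" "t + b"] fin[of a b] by (simp add: \<nu> emeasure_eq_measure2)
  qed
  have \<nu>_translate: "distr \<nu> borel ((+) t) = \<nu>" for t
  proof (rule measure_eqI_generator_eq)
    let ?E = "range (\<lambda>(a, b). {a<..<b :: real})"
    show "Int_stable ?E"
    proof (rule Int_stableI_image)
      fix p q :: "real \<times> real"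
      have "(case p of (a, b) \<Rightarrow> {a<..<b}) \<inter> (case q of (a, b) \<Rightarrow> {a<..<b})
          = (case (max (fst p) (fst q), min (snd p) (snd q)) of (a, b) \<Rightarrow> {a<..<b})"
        by (auto simp: case_prod_beta)
      then show "\<exists>r\<in>UNIV. (case p of (a, b) \<Rightarrow> {a<..<b}) \<inter> (case q of (a, b) \<Rightarrow> {a<..<b}) = (case r of (a, b) \<Rightarrow> {a<..<b})"
        by blast
    qed
    have gen: "sets borel = sigma_sets UNIV ?E"
    proof -
      have box: "(\<lambda>(a, b). box a b) = (\<lambda>(a, b). {a<..<b :: real})"
        by (auto simp: fun_eq_iff box_real)
      have "sets borel = sigma_sets UNIV (range (\<lambda>(a, b). box a b :: real set))"
        by (subst borel_eq_box) simp
      then show ?thesis unfolding box .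
    qed
    show "sets (distr \<nu> borel ((+) t)) = sigma_sets UNIV ?E" "sets \<nu> = sigma_sets UNIV ?E"
      using gen by simp_all
    show "?E \<subseteq> Pow UNIV" by simp
    show "range (\<lambda>n::nat. {- real n<..<real n}) \<subseteq> ?E" by auto
    have "\<exists>n::nat. - real n < x \<and> x < real n" for x
      using reals_Archimedean2[of "\<bar>x\<bar>"] by (metis abs_less_iff minus_less_iff)
    then show "(\<Union>n::nat. {- real n<..<real n}) = UNIV" by auto
    fix E assume "E \<in> ?E"
    then obtain a b where E: "E = {a<..<b}" by auto
    have "(+) t -` {a<..<b} = {- t + a<..<- t + b}" by auto
    then have "emeasure (distr \<nu> borel ((+) t)) E = emeasure \<nu> {- t + a<..<- t + b}"
      unfolding E by (subst emeasure_distr) (auto simp: \<nu>_def)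
    then show "emeasure (distr \<nu> borel ((+) t)) E = emeasure \<nu> E"
      by (simp only: E \<nu>_box)
  next
    fix n :: nat
    have "(+) t -` {- real n<..<real n} \<inter> space \<nu> = {- t - real n<..<- t + real n}"
      by (auto simp: \<nu>_def)
    then have "emeasure \<nu> ((+) t -` {- real n<..<real n} \<inter> space \<nu>) = emeasure lborel (H \<inter> {- t - real n<..<- t + real n})"
      by (simp only: \<nu> borel_open[OF open_greaterThanLessThan])
    also have "\<dots> \<le> emeasure lborel {- t - real n<..<- t + real n}"
      by (intro emeasure_mono) auto
    also have "\<dots> < \<infinity>" by (rule emeasure_bounded_finite) simp
    finally show "emeasure (distr \<nu> borel ((+) t)) {- real n<..<real n} \<noteq> \<infinity>"
      by (subst emeasure_distr) auto
  qed
  have \<nu>_null: "emeasure \<nu> ((\<lambda>s. t + s) -` (- H)) = 0" for t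
  proof -
    have "emeasure \<nu> ((\<lambda>s. t + s) -` (- H)) = emeasure (distr \<nu> borel ((+) t)) (- H)"
      by (subst emeasure_distr) (auto simp: \<nu>_def)
    also have "\<dots> = emeasure \<nu> (- H)" by (simp add: \<nu>_translate)
    also have "\<dots> = 0" by (subst \<nu>) auto
    finally show ?thesis .
  qed
  have "emeasure lborel H * emeasure lborel (- H)
      = (\<integral>\<^sup>+s. indicator H s * (\<integral>\<^sup>+t. indicator (- H) (t + s) \<partial>lborel) \<partial>lborel)"
  proof -
    have "(\<integral>\<^sup>+t. indicator (- H) (t + s) \<partial>lborel) = emeasure lborel (- H)" for s
    proof -
      have "(\<integral>\<^sup>+t. indicator (- H) (t + s) \<partial>lborel) = (\<integral>\<^sup>+t. indicator (- H) t \<partial>distr lborel borel ((+) s))"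
        by (subst nn_integral_distr) (auto simp: add.commute)
      also have "\<dots> = emeasure lborel (- H)"
        by (simp add: lborel_distr_plus)
      finally show ?thesis .
    qed
    then show ?thesis by (simp add: nn_integral_multc)
  qed
  also have "\<dots> = (\<integral>\<^sup>+s. (\<integral>\<^sup>+t. indicator H s * indicator (- H) (t + s) \<partial>lborel) \<partial>lborel)"
    by (simp add: nn_integral_cmult)
  also have "\<dots> = (\<integral>\<^sup>+t. (\<integral>\<^sup>+s. indicator H s * indicator (- H) (t + s) \<partial>lborel) \<partial>lborel)"
    by (rule lborel_pair.Fubini') measurable
  also have "\<dots> = (\<integral>\<^sup>+t. emeasure \<nu> ((\<lambda>s. t + s) -` (- H)) \<partial>lborel)"
  proof (rule nn_integral_cong)
    fix t :: real
    have [measurable]: "(\<lambda>s. t + s) -` (- H) \<in> sets borel"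
      by (rule measurable_sets_borel[of _ borel]) auto
    show "(\<integral>\<^sup>+s. indicator H s * indicator (- H) (t + s) \<partial>lborel) = emeasure \<nu> ((\<lambda>s. t + s) -` (- H))"
      unfolding \<nu>_def by (subst emeasure_density) (auto intro!: nn_integral_cong simp: indicator_def)
  qed
  also have "\<dots> = 0" by (simp add: \<nu>_null)
  finally show ?thesis
    by (auto simp: null_sets_def)
qed

section \<open>Ergodicity of the action and of its Maharam extension\<close>

lemma measurable_step [measurable]: "step t \<in> F2_space \<rightarrow>\<^sub>M F2_space"
proof -
  have "{x \<in> space F2_space. x [] = t} \<in> sets F2_space"
    using first_bit_sets[of t] by (simp add: first_bit_def)
  then have "(\<lambda>x. if x [] = t then F2_action [(gen_b, True)] x else F2_action [(gen_a, True)] x) \<in> F2_space \<rightarrow>\<^sub>M F2_space"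
    using measurable_F2_action[of "[(gen_a, True)]"] measurable_F2_action[of "[(gen_b, True)]"]
    by (intro measurable_If) auto
  also have "(\<lambda>x. if x [] = t then F2_action [(gen_b, True)] x else F2_action [(gen_a, True)] x) = step t"
    by (auto simp: step_def fun_eq_iff)
  finally show ?thesis .
qed

lemma AE_step:
  assumes "AE x in F2_space. P x"
  shows "AE x in F2_space. P (step t x)"
  using F2A.AE_act[OF assms, of "[(gen_a, True)]"] F2A.AE_act[OF assms, of "[(gen_b, True)]"]
  by (auto simp: step_def elim: eventually_elim2)

definition log_factor :: "bool \<Rightarrow> real" where
  "log_factor t = ln (if t then 6 / 5 else 4 / 5)"

definition log_weight :: "bool list \<Rightarrow> real" where
  "log_weight u = sum_list (map log_factor u)"

lemma AE_foldr_pre: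
  fixes B :: "real \<Rightarrow> (letter list \<Rightarrow> bool) set"
  assumes step: "\<And>t v. AE x in F2_space. step t x \<in> B (r - log_weight v) \<longleftrightarrow> x \<in> B (r - log_weight (t # v))"
  shows "AE x in F2_space. x \<in> foldr pre u (B r) \<longleftrightarrow> x \<in> B (r - log_weight u)"
proof (induction u)
  case (Cons t u)
  from AE_step[OF Cons.IH, of t] step[of t u] AE_space show ?case
    by eventually_elim (simp add: pre_def)
qed (simp add: log_weight_def)

text \<open>The two paths in the exchange take the same steps in a different order, so they change the
  logarithm of the density by the same amount.\<close>

lemma step_equivariant_zero_one:
  fixes B :: "real \<Rightarrow> (letter list \<Rightarrow> bool) set"
  assumes step: "\<And>t v. AE x in F2_space. step t x \<in> B (r - log_weight v) \<longleftrightarrow> x \<in> B (r - log_weight (t # v))"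
    and B: "B r \<in> sets F2_space"
  shows "F2S.prob (B r) = 0 \<or> F2S.prob (B r) = 1"
proof (rule exchange_invariant_zero_one[OF B])
  fix u v :: "bool list"
  have eq: "log_weight (True # u @ False # v) = log_weight (False # v @ True # u)"
    by (simp add: log_weight_def)
  from AE_foldr_pre[OF step, where u = "True # u @ False # v"] AE_foldr_pre[OF step, where u = "False # v @ True # u"]
  show "AE x in F2_space. x \<in> foldr pre (True # u @ False # v) (B r) \<longleftrightarrow> x \<in> foldr pre (False # v @ True # u) (B r)"
    unfolding eq by eventually_elim (simp only:)
qed

lemma F2_ergodic: "ergodic F2 F2_space F2_action"
  unfolding ergodic_def
proof (intro ballI impI)
  fix A assume A: "A \<in> sets F2_space" and inv: "\<forall>g\<in>carrier F2. AE x in F2_space. F2_action g x \<in> A \<longleftrightarrow> x \<in> A"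
  have "AE x in F2_space. step t x \<in> A \<longleftrightarrow> x \<in> A" for t
    using inv[rule_format, of "[(gen_a, True)]"] inv[rule_format, of "[(gen_b, True)]"]
    by (auto simp: step_def elim: eventually_elim2)
  then have "F2S.prob A = 0 \<or> F2S.prob A = 1"
    using A by (intro step_equivariant_zero_one[where B = "\<lambda>_. A"])
  then show "A \<in> null_sets F2_space \<or> space F2_space - A \<in> null_sets F2_space"
    using A F2S.prob_compl[OF A] by (auto simp: null_sets_def F2S.emeasure_eq_measure)
qed

lemma RN_cocycle_F2:
  assumes "g \<in> carrier F2"
  shows "AE x in F2_space. RN_cocycle F2 F2_space F2_action g x = F2_cocycle g x"
proof -
  have "AE x in F2_space. ennreal (F2_cocycle g x) = RN_deriv F2_space (density F2_space (\<lambda>x. ennreal (F2_cocycle g x))) x"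
    using measurable_F2_cocycle[OF assms] by (intro F2S.RN_deriv_unique) auto
  then show ?thesis
    using AE_space
  proof eventually_elim
    case (elim x)
    then show ?case
      using F2A.w_pos[OF assms elim(2)]
      by (simp add: RN_cocycle_def distr_F2_action_inv[OF assms] elim(1)[symmetric])
  qed
qed

text \<open>A rational quotient would give \<open>6 ^ k * 4 ^ l = 5 ^ (k + l)\<close> with \<open>k > 0\<close>, but the right-hand side
  is odd.\<close>

lemma log_factor_ratio_irrational: "log_factor True / log_factor False \<notin> \<rat>"
proof
  assume "log_factor True / log_factor False \<in> \<rat>"
  then obtain m n :: int where n: "0 < n" and mn: "log_factor True / log_factor False = of_int m / of_int n"
    by (metis Rats_cases')
  have pos: "0 < ln (6 / 5 :: real)" "ln (4 / 5 :: real) < 0" by simp_all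
  have eq: "of_int n * ln (6 / 5 :: real) = of_int m * ln (4 / 5)"
    using mn n pos by (simp add: log_factor_def field_simps)
  have "m < 0"
  proof (rule ccontr)
    assume "\<not> m < 0"
    then have "of_int m * ln (4 / 5 :: real) \<le> 0" using pos by (simp add: mult_nonneg_nonpos)
    moreover have "0 < of_int n * ln (6 / 5 :: real)" using n pos by simp
    ultimately show False using eq by simp
  qed
  define k l where "k = nat n" and "l = nat (- m)"
  have "real k * ln (6 / 5) + real l * ln (4 / 5) = 0"
    using eq n \<open>m < 0\<close> by (simp add: k_def l_def)
  then have "ln ((6 / 5) ^ k * (4 / 5 :: real) ^ l) = 0"
    by (simp add: ln_mult ln_realpow)
  then have "(6 / 5) ^ k * (4 / 5 :: real) ^ l = 1"
    by (subst (asm) ln_eq_zero_iff) auto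
  then have "real (6 ^ k * 4 ^ l) = real (5 ^ (k + l))"
    by (simp add: power_divide power_add field_simps)
  then have "(6 :: nat) ^ k * 4 ^ l = 5 ^ (k + l)"
    by (rule of_nat_eq_iff[THEN iffD1])
  moreover have "even ((6 :: nat) ^ k * 4 ^ l)" using n by (simp add: k_def)
  moreover have "odd ((5 :: nat) ^ (k + l))" by simp
  ultimately show False by simp
qed

text \<open>Almost every horizontal section of an invariant set has measure 0 or 1 by the exchange argument.
  The set of heights with sections of measure 1 is invariant under translation by the logarithms of
  \<open>6 / 5\<close> and \<open>4 / 5\<close>, which generate a dense group.\<close>

lemma F2_maharam_ergodic: "ergodic F2 (maharam_measure F2_space) (maharam_action F2 F2_space F2_action)"
  unfolding ergodic_def
proof (intro ballI impI)
  let ?N = "density lborel (\<lambda>s. ennreal (exp (- s)))"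
  let ?MM = "maharam_measure F2_space" and ?act = "maharam_action F2 F2_space F2_action"
  fix A assume A: "A \<in> sets ?MM" and inv: "\<forall>g\<in>carrier F2. AE z in ?MM. ?act g z \<in> A \<longleftrightarrow> z \<in> A"
  have sets_MM: "sets ?MM = sets (F2_space \<Otimes>\<^sub>M borel)"
    unfolding maharam_measure_def by (intro sets_pair_measure_cong) auto
  have A' [measurable]: "A \<in> sets (F2_space \<Otimes>\<^sub>M borel)" using A sets_MM by simp
  have sigma_N: "sigma_finite_measure ?N"
    by (subst sigma_finite_measure.sigma_finite_iff_density_finite[OF sigma_finite_lborel]) auto
  interpret N: sigma_finite_measure ?N by (rule sigma_N)
  interpret PN: pair_sigma_finite F2_space ?N ..
  interpret PL: pair_sigma_finite F2_space lborel ..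
  have AE_N: "(AE s in ?N. P s) \<longleftrightarrow> (AE s in lborel. P s)" for P
    by (subst AE_density) auto
  have step_inv: "AE x in F2_space. AE s in lborel. (step t x, log_factor t + s) \<in> A \<longleftrightarrow> (x, s) \<in> A" for t
  proof -
    have gen: "AE x in F2_space. AE s in lborel. (F2_action g x, ln (F2_cocycle g x) + s) \<in> A \<longleftrightarrow> (x, s) \<in> A"
      if g: "g \<in> carrier F2" for g
    proof -
      have "AE z in F2_space \<Otimes>\<^sub>M ?N. ?act g z \<in> A \<longleftrightarrow> z \<in> A"
        using bspec[OF inv g] unfolding maharam_measure_def .
      from PN.AE_pair[OF this] RN_cocycle_F2[OF g] show ?thesis
        by eventually_elim (simp add: AE_N maharam_action_def)
    qed
    have "[(gen_a, True)] \<in> carrier F2" "[(gen_b, True)] \<in> carrier F2" by simp_all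
    from gen[OF this(1)] gen[OF this(2)] show ?thesis
    proof eventually_elim
      case (elim x)
      then have "AE s in lborel. (F2_action [(if x [] = t then gen_b else gen_a, True)] x,
          ln (F2_cocycle [(if x [] = t then gen_b else gen_a, True)] x) + s) \<in> A \<longleftrightarrow> (x, s) \<in> A"
        by (cases "x [] = t") auto
      then show ?case unfolding F2_cocycle_step by (simp only: step_def log_factor_def)
    qed
  qed
  have "AE s in lborel. AE x in F2_space. (step t x, log_factor t + s) \<in> A \<longleftrightarrow> (x, s) \<in> A" for t
  proof (subst PL.AE_commute[symmetric])
    show "{z \<in> space (F2_space \<Otimes>\<^sub>M lborel). (step t (fst z), log_factor t + snd z) \<in> A \<longleftrightarrow> (fst z, snd z) \<in> A}
        \<in> sets (F2_space \<Otimes>\<^sub>M lborel)"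
      by measurable
  qed (rule step_inv)
  then have "AE s in lborel. \<forall>t. AE x in F2_space. (step t x, log_factor t + s) \<in> A \<longleftrightarrow> (x, s) \<in> A"
    unfolding AE_all_countable by blast
  from AE_lborel_translate[OF this]
  have good: "AE s in lborel. \<forall>v t. AE x in F2_space.
      (step t x, log_factor t + (- log_weight v + s)) \<in> A \<longleftrightarrow> (x, - log_weight v + s) \<in> A"
    unfolding AE_all_countable by blast
  define B where "B s = {x \<in> space F2_space. (x, s) \<in> A}" for s
  have B_vimage: "B s = (\<lambda>x. (x, s)) -` A" for s
    using sets.sets_into_space[OF A'] by (auto simp: B_def space_pair_measure)
  have B: "B s \<in> sets F2_space" for s
    using measurable_sets[OF measurable_Pair2'[of s borel F2_space] A'] by (simp add: B_def vimage_def Int_def conj_commute)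
  have zero_one: "AE s in lborel. F2S.prob (B s) = 0 \<or> F2S.prob (B s) = 1"
    using good
  proof eventually_elim
    case (elim s)
    show ?case
    proof (rule step_equivariant_zero_one[OF _ B])
      fix t v
      from elim[rule_format, of t "t # v"] AE_space
      show "AE x in F2_space. step t x \<in> B (s - log_weight v) \<longleftrightarrow> x \<in> B (s - log_weight (t # v))"
        by eventually_elim (simp add: B_def log_weight_def step_space algebra_simps)
    qed
  qed
  define H where "H = {s. F2S.prob (B s) = 1}"
  have H: "H \<in> sets borel"
  proof -
    have "(\<lambda>s. emeasure F2_space (B s)) \<in> borel_measurable lborel"
      unfolding B_vimage by (rule PL.measurable_emeasure_Pair2) measurable
    then have "(\<lambda>s. F2S.prob (B s)) \<in> borel_measurable borel"
      unfolding measure_def by simp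
    then have "(\<lambda>s. F2S.prob (B s)) -` {1} \<inter> space borel \<in> sets borel"
      by (rule measurable_sets) simp
    then show ?thesis by (simp add: H_def vimage_def)
  qed
  define Inv where "Inv d \<longleftrightarrow> (AE s in lborel. d + s \<in> H \<longleftrightarrow> s \<in> H)" for d
  have Inv_log_factor: "Inv (log_factor t)" for t
    unfolding Inv_def using good zero_one AE_lborel_translate[OF zero_one, of "log_factor t"]
  proof eventually_elim
    case (elim s)
    from elim(1)[rule_format, of t "[]"] AE_space
    have "AE x in F2_space. x \<in> pre t (B (log_factor t + s)) \<longleftrightarrow> x \<in> B s"
      by eventually_elim (simp add: B_def pre_def log_weight_def step_space)
    then have eq: "F2S.prob (pre t (B (log_factor t + s))) = F2S.prob (B s)"
      using B by (intro F2S.finite_measure_eq_AE pre_sets) auto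
    from elim(3) show ?case
    proof
      assume 0: "F2S.prob (B (log_factor t + s)) = 0"
      then have "F2S.prob (pre t (B (log_factor t + s))) \<le> 0"
        using measure_pre_le[OF B, of t "log_factor t + s"] by simp
      then show ?thesis using 0 eq measure_nonneg[of F2_space "B s"] by (simp add: H_def)
    next
      assume 1: "F2S.prob (B (log_factor t + s)) = 1"
      then have "AE x in F2_space. x \<in> B (log_factor t + s)"
        using F2S.prob_eq_1[OF B] by simp
      from AE_step[OF this, of t] AE_space have "AE x in F2_space. x \<in> pre t (B (log_factor t + s))"
        by eventually_elim (simp add: pre_def)
      then have "F2S.prob (pre t (B (log_factor t + s))) = 1"
        using F2S.prob_eq_1[OF pre_sets[OF B]] by simp
      then show ?thesis using 1 eq by (simp add: H_def)
    qed
  qed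
  have Inv_add: "Inv (d + d')" if d: "Inv d" and d': "Inv d'" for d d'
    unfolding Inv_def using d[unfolded Inv_def] AE_lborel_translate[OF d'[unfolded Inv_def], of d]
    by eventually_elim (simp add: algebra_simps)
  have Inv_minus: "Inv (- d)" if d: "Inv d" for d
    unfolding Inv_def using AE_lborel_translate[OF d[unfolded Inv_def], of "- d"]
    by eventually_elim simp
  have Inv_nat: "Inv (real n * d)" if "Inv d" for d n
  proof (induction n)
    case (Suc n)
    have "Inv (d + real n * d)" using Inv_add that Suc by blast
    then show ?case by (simp add: algebra_simps)
  qed (simp add: Inv_def)
  have Inv_int: "Inv (of_int k * d)" if "Inv d" for d k
  proof (cases "0 \<le> k")
    case True
    then show ?thesis using Inv_nat[OF that, of "nat k"] by simp
  next
    case False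
    then show ?thesis using Inv_minus[OF Inv_nat[OF that, of "nat (- k)"]] by simp
  qed
  have "H \<in> null_sets lborel \<or> - H \<in> null_sets lborel"
  proof (rule dense_translations_ergodic[OF H, where D = "Collect Inv"])
    show "AE s in lborel. d + s \<in> H \<longleftrightarrow> s \<in> H" if "d \<in> Collect Inv" for d
      using that by (simp add: Inv_def)
    fix r e :: real assume "0 < e"
    let ?T = "log_factor True" and ?F = "log_factor False"
    have F: "?F < 0" by (simp add: log_factor_def)
    then have pos: "0 < e / \<bar>?F\<bar>" using \<open>0 < e\<close> by (intro divide_pos_pos) auto
    obtain h k where "0 < k" and hk: "\<bar>of_int k * (?T / ?F) - of_int h - r / ?F\<bar> < e / \<bar>?F\<bar>"
      by (rule sequence_of_fractional_parts_is_dense[OF log_factor_ratio_irrational pos])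
    have "of_int k * ?T + of_int (- h) * ?F - r = ?F * (of_int k * (?T / ?F) - of_int h - r / ?F)"
      using F by (simp add: field_simps)
    then have "\<bar>of_int k * ?T + of_int (- h) * ?F - r\<bar> = \<bar>?F\<bar> * \<bar>of_int k * (?T / ?F) - of_int h - r / ?F\<bar>"
      by (simp only: abs_mult)
    also have "\<dots> < \<bar>?F\<bar> * (e / \<bar>?F\<bar>)"
      using hk F by (intro mult_strict_left_mono) auto
    also have "\<dots> = e" using F by simp
    finally have "\<bar>of_int k * ?T + of_int (- h) * ?F - r\<bar> < e" .
    then show "\<exists>d\<in>Collect Inv. \<bar>d - r\<bar> < e"
      using Inv_add[OF Inv_int[OF Inv_log_factor] Inv_int[OF Inv_log_factor]] by blast
  qed
  then show "A \<in> null_sets ?MM \<or> space ?MM - A \<in> null_sets ?MM"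
  proof
    assume "H \<in> null_sets lborel"
    then have "AE s in lborel. s \<notin> H" by (rule AE_not_in)
    with zero_one have "AE s in lborel. AE x in F2_space. (x, s) \<notin> A"
    proof eventually_elim
      case (elim s)
      then have "B s \<in> null_sets F2_space"
        using B[of s] by (auto simp: H_def null_sets_def F2S.emeasure_eq_measure)
      from AE_not_in[OF this] AE_space show ?case by eventually_elim (simp add: B_def)
    qed
    then have "AE x in F2_space. AE s in lborel. (x, s) \<notin> A"
      by (subst PL.AE_commute) measurable
    then have "AE z in F2_space \<Otimes>\<^sub>M ?N. z \<notin> A"
    proof (intro PN.AE_pair_measure)
      show "{z \<in> space (F2_space \<Otimes>\<^sub>M ?N). z \<notin> A} \<in> sets (F2_space \<Otimes>\<^sub>M ?N)"
        using sets.compl_sets[OF A] unfolding maharam_measure_def set_diff_eq .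
    qed (simp add: AE_N)
    then show ?thesis using A by (simp add: AE_iff_null_sets maharam_measure_def)
  next
    assume "- H \<in> null_sets lborel"
    then have "AE s in lborel. s \<notin> - H" by (rule AE_not_in)
    then have "AE s in lborel. AE x in F2_space. (x, s) \<in> A"
    proof eventually_elim
      case (elim s)
      then have "AE x in F2_space. x \<in> B s"
        using F2S.prob_eq_1[OF B[of s]] by (simp add: H_def)
      then show ?case by eventually_elim (simp add: B_def)
    qed
    then have "AE x in F2_space. AE s in lborel. (x, s) \<in> A"
      by (subst PL.AE_commute) measurable
    then have "AE z in F2_space \<Otimes>\<^sub>M ?N. z \<in> A"
    proof (intro PN.AE_pair_measure)
      show "{z \<in> space (F2_space \<Otimes>\<^sub>M ?N). z \<in> A} \<in> sets (F2_space \<Otimes>\<^sub>M ?N)"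
        using sets.Int[OF sets.top A] unfolding maharam_measure_def Int_def .
    qed (simp add: AE_N)
    then have "AE z in ?MM. z \<notin> space ?MM - A"
      unfolding maharam_measure_def by eventually_elim simp
    then show ?thesis using AE_iff_null_sets[OF sets.compl_sets[OF A]] by blast
  qed
qed

theorem proposition7p5:
  shows "nonsingular_action F2 F2_space F2_action
     \<and> essentially_free F2 F2_space F2_action
     \<and> ergodic F2 F2_space F2_action
     \<and> \<not> zimmer_amenable F2 F2_space F2_action
     \<and> type_III\<^sub>1 F2 F2_space F2_action
     \<and> (\<forall>g\<in>carrier F2 - {\<one>\<^bsub>F2\<^esub>}. dissipative_transformation F2_space (F2_action g))
     \<and> (\<forall>m::nat. m \<ge> 220 \<longrightarrow>
          dissipative F2 (power_measure m F2_space) (power_action m F2_space F2_action))"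
  using F2A.nonsingular F2_essentially_free F2_ergodic F2_not_zimmer_amenable F2_maharam_ergodic
    F2_dissipative_transformation F2_power_dissipative
  by (auto simp: type_III\<^sub>1_def)

end
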